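(* Assume $\mathbb{E}(|\nu_v|^{2+\varepsilon}+|\omega_e|^{2+\varepsilon})<\infty$ for some $\varepsilon>0$. Let $\mathfrak{m}$ be a matching chosen from the Gibbs measure $\mu$ and let $U=U(\mathfrak{m})$ be the number of unpaired vertices of $\mathfrak{m}$. Let $\sigma_Q^2$ be the deterministic limit in probability of $n^{-1}(\langle U^2\rangle_n-\langle U\rangle_n^2)$ as $n\to\infty$ (this limit exists). Then, as $n\to\infty$, $$n^{-1/2}\,(U-\langle U\rangle_n)\to N(0,\sigma_Q^2)\quad\text{in distribution under }\mu,\text{ in probability with respect to the weights},$$ that is, for every bounded continuous $\varphi:\mathbb{R}\to\mathbb{R}$, $\bigl\langle\varphi\bigl(n^{-1/2}(U-\langle U\rangle_n)\bigr)\bigr\rangle_n\to\mathbb{E}\,\varphi(Y)$ in probability, where $Y\sim N(0,\sigma_Q^2)$.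
   Context: Let $H=(V_H,E_H)$ be a fixed finite graph with $|V_H|=h\ge 1$, and let $G_n$ be the line graph (path) on the $n$ vertices $1,\dots,n$ with $i\sim i+1$. The cylinder graph $\mathcal{G}_n=G_n\times H$ is the Cartesian product: its vertex set is $V=\{1,\dots,n\}\times V_H$, and $(i,j)\sim(i',j')$ iff either $i\sim i'$ in $G_n$ and $j=j'$, or $i=i'$ and $j\sim j'$ in $H$. Let $E$ be its edge set. The vertex weights $\{\nu_v\}_{v\in V}$ are i.i.d. real random variables; the edge weights $\{\omega_e\}_{e\in E}$ are i.i.d. real random variables, independent of the vertex weights, possibly with a different law; the two laws do not depend on $n$. A matching $\mathfrak{m}\subseteq E$ is a (possibly empty) set of pairwise vertex-disjoint edges; $\mathcal{M}$ is the set of all matchings of $\mathcal{G}_n$; $v\notin\mathfrak{m}$ ($v$ is unpaired) means that $v$ is not covered by any edge of $\mathfrak{m}$. The Hamiltonian is $\mathcal{H}(\mathfrak{m})=\sum_{v\notin\mathfrak{m}}\nu_v+\sum_{e\in\mathfrak{m}}\omega_e$, the partition function is $Z_n=\sum_{\mathfrak{m}\in\mathcal{M}}\exp(\mathcal{H}(\mathfrak{m}))$, and the (random) Gibbs measure is $\mu(\mathfrak{m})=Z_n^{-1}\exp(\mathcal{H}(\mathfrak{m}))$. For $X:\mathcal{M}\to\mathbb{R}$, $\langle X\rangle_n=\sum_{\mathfrak{m}\in\mathcal{M}}X(\mathfrak{m})\mu(\mathfrak{m})$ is its Gibbs average, a random variable depending on the weights. *)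

theory Defs
  imports "HOL-Probability.Probability"
begin

text \<open>
  A finite simple undirected graph is given by its vertex set \<open>V\<close> and its edge set \<open>E\<close>,
  every edge being the two-element set of its endpoints.
\<close>

definition finite_simple_graph :: "'v set \<Rightarrow> 'v set set \<Rightarrow> bool" where
  "finite_simple_graph V E \<longleftrightarrow> finite V \<and> (\<forall>e\<in>E. e \<subseteq> V \<and> card e = 2)"

definition path_vertices :: "nat \<Rightarrow> nat set" where
  "path_vertices n = {1..n}"

definition path_edges :: "nat \<Rightarrow> nat set set" where
  "path_edges n = {{i, i + 1} |i. i \<in> path_vertices n \<and> i + 1 \<in> path_vertices n}"

definition cartesian_edges ::
    "'u set \<Rightarrow> 'u set set \<Rightarrow> 'v set \<Rightarrow> 'v set set \<Rightarrow> ('u \<times> 'v) set set" where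
  "cartesian_edges V\<^sub>1 E\<^sub>1 V\<^sub>2 E\<^sub>2 =
     {{(i, j), (i', j')} |i j i' j'.
        (i, j) \<in> V\<^sub>1 \<times> V\<^sub>2 \<and> (i', j') \<in> V\<^sub>1 \<times> V\<^sub>2 \<and>
        ({i, i'} \<in> E\<^sub>1 \<and> j = j' \<or> i = i' \<and> {j, j'} \<in> E\<^sub>2)}"

definition cylinder_vertices :: "nat \<Rightarrow> 'h set \<Rightarrow> (nat \<times> 'h) set" where
  "cylinder_vertices n VH = path_vertices n \<times> VH"

definition cylinder_edges :: "nat \<Rightarrow> 'h set \<Rightarrow> 'h set set \<Rightarrow> (nat \<times> 'h) set set" where
  "cylinder_edges n VH EH = cartesian_edges (path_vertices n) (path_edges n) VH EH"

definition matchings :: "'v set set \<Rightarrow> 'v set set set" where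
  "matchings E = {m. m \<subseteq> E \<and> pairwise disjnt m}"

definition unpaired :: "'v set \<Rightarrow> 'v set set \<Rightarrow> 'v set" where
  "unpaired V m = {v \<in> V. \<forall>e\<in>m. v \<notin> e}"

text \<open>
  The Gibbs measure for a fixed realisation \<open>\<nu>\<close> of the vertex weights and \<open>\<omega>\<close> of the
  edge weights.
\<close>

definition hamiltonian ::
    "'v set \<Rightarrow> ('v \<Rightarrow> real) \<Rightarrow> ('v set \<Rightarrow> real) \<Rightarrow> 'v set set \<Rightarrow> real" where
  "hamiltonian V \<nu> \<omega> m = (\<Sum>v\<in>unpaired V m. \<nu> v) + (\<Sum>e\<in>m. \<omega> e)"

definition partition_function ::
    "'v set \<Rightarrow> 'v set set \<Rightarrow> ('v \<Rightarrow> real) \<Rightarrow> ('v set \<Rightarrow> real) \<Rightarrow> real" where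
  "partition_function V E \<nu> \<omega> = (\<Sum>m\<in>matchings E. exp (hamiltonian V \<nu> \<omega> m))"

definition gibbs_weight ::
    "'v set \<Rightarrow> 'v set set \<Rightarrow> ('v \<Rightarrow> real) \<Rightarrow> ('v set \<Rightarrow> real) \<Rightarrow> 'v set set \<Rightarrow> real" where
  "gibbs_weight V E \<nu> \<omega> m = exp (hamiltonian V \<nu> \<omega> m) / partition_function V E \<nu> \<omega>"

definition gibbs_average ::
    "'v set \<Rightarrow> 'v set set \<Rightarrow> ('v \<Rightarrow> real) \<Rightarrow> ('v set \<Rightarrow> real) \<Rightarrow> ('v set set \<Rightarrow> real) \<Rightarrow> real" where
  "gibbs_average V E \<nu> \<omega> X = (\<Sum>m\<in>matchings E. X m * gibbs_weight V E \<nu> \<omega> m)"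

definition num_unpaired :: "'v set \<Rightarrow> 'v set set \<Rightarrow> real" where
  "num_unpaired V m = real (card (unpaired V m))"

text \<open>
  Convergence in probability to a constant; the \<open>n\<close>-th variable may live on its own
  probability space.
\<close>

definition converges_in_probability ::
    "(nat \<Rightarrow> 'a measure) \<Rightarrow> (nat \<Rightarrow> 'a \<Rightarrow> real) \<Rightarrow> real \<Rightarrow> bool" where
  "converges_in_probability M X c \<longleftrightarrow>
     (\<forall>\<delta>>0. (\<lambda>n. measure (M n) {x \<in> space (M n). \<bar>X n x - c\<bar> > \<delta>}) \<longlonglongrightarrow> 0)"

text \<open>
  The normal law with mean \<open>a\<close> and variance \<open>s\<close>. The case \<open>s = 0\<close> is separate because
  \<^const>\<open>normal_density\<close> with standard deviation \<open>0\<close> is identically zero, not a point mass.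
\<close>

definition normal_law :: "real \<Rightarrow> real \<Rightarrow> real measure" where
  "normal_law a s =
     (if s = 0 then return borel a else density lborel (normal_density a (sqrt s)))"

end

theory Submission
  imports Defs "HOL-Computational_Algebra.Fundamental_Theorem_Algebra" "HOL-Real_Asymp.Real_Asymp"
begin

text \<open>
  By the Heilmann--Lieb theorem the generating polynomial of the number of edges of a Gibbs
  matching has only negative real zeros, so for fixed weights this number is a sum of independent
  Bernoulli variables. Since \<open>U = |V| - 2|m|\<close>, the quenched central limit theorem therefore follows
  from the convergence of the variance of \<open>U\<close> divided by \<open>n\<close>. That variance is the second
  derivative at \<open>s = 0\<close> of the free energy with edge weights \<open>\<omega> + s\<close> (up to the factor 4); as the
  third derivative is of order \<open>n\<close>, second differences reduce the claim to a law of large numbers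
  for the free energy. The latter holds because deleting the edges between consecutive blocks of
  \<open>L\<close> layers costs \<open>O(n/L)\<close> and leaves a sum of i.i.d. terms.
\<close>

section \<open>The Heilmann--Lieb theorem\<close>

text \<open>For each n the weights may live on a different space \<open>M n\<close>, so variables
  for different n cannot be compared pointwise. Limits in probability are therefore reached through
  constants: a Cauchy-type criterion, and block moments computed on a product space built from the
  laws \<open>P\<close> and \<open>Q\<close> alone. The limiting variance is never identified and
  the limiting free energy is never differentiated; one second difference with a fixed step already
  pins the variance down to a prescribed accuracy. This works because the logarithmic moment
  generating function of a Bernoulli variable has third derivative at most 1 in absolute value,
  whatever the success probability, so the error is uniform in the weights. The same uniformity
  makes the limit law a deterministic statement, into which the randomness of the weights enters
  only through the variance. A vanishing limit variance is covered: the Gaussian approximation is an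
  additive bound on characteristic functions, and nothing is divided by a standard
  deviation.\<close>

definition matching_sum :: "'v set \<Rightarrow> 'v set set \<Rightarrow> ('v \<Rightarrow> 'r) \<Rightarrow> ('v set \<Rightarrow> 'r) \<Rightarrow> 'r::comm_ring_1" where
  "matching_sum V E x w = (\<Sum>m\<in>matchings E. (\<Prod>v\<in>unpaired V m. x v) * (\<Prod>e\<in>m. w e))"

lemma finite_simple_graph_finite_edges:
  assumes "finite_simple_graph V E"
  shows "finite E"
  using assms unfolding finite_simple_graph_def by (meson Pow_iff finite_Pow_iff finite_subset subsetI)

lemma finite_simple_graph_subset:
  assumes "finite_simple_graph V E" "E' \<subseteq> E"
  shows "finite_simple_graph V E'"
  using assms unfolding finite_simple_graph_def by blast

lemma finite_matchings: "finite E \<Longrightarrow> finite (matchings E)"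
  unfolding matchings_def by (rule finite_subset[of _ "Pow E"]) auto

lemma finite_in_matchings: "finite E \<Longrightarrow> m \<in> matchings E \<Longrightarrow> finite m"
  unfolding matchings_def using finite_subset by auto

lemma empty_in_matchings: "{} \<in> matchings E"
  by (simp add: matchings_def pairwise_def)

lemma matchings_delete_edge:
  assumes "e \<in> E" "e \<noteq> {}"
  shows "matchings E = matchings (E - {e}) \<union> insert e ` matchings {e'\<in>E. disjnt e e'}"
proof (intro set_eqI iffI)
  fix m assume m: "m \<in> matchings E"
  show "m \<in> matchings (E - {e}) \<union> insert e ` matchings {e'\<in>E. disjnt e e'}"
  proof (cases "e \<in> m")
    case False
    with m show ?thesis by (auto simp: matchings_def)
  next
    case True
    have "m - {e} \<in> matchings {e'\<in>E. disjnt e e'}"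
      using m True by (auto simp: matchings_def pairwise_def)
    moreover have "m = insert e (m - {e})" using True by auto
    ultimately show ?thesis by blast
  qed
next
  fix m assume "m \<in> matchings (E - {e}) \<union> insert e ` matchings {e'\<in>E. disjnt e e'}"
  then show "m \<in> matchings E"
    using assms(1) unfolding matchings_def by (auto simp: pairwise_insert subset_iff disjnt_iff)
qed

lemma unpaired_insert: "unpaired V (insert e m) = unpaired (V - e) m"
  by (auto simp: unpaired_def)

text \<open>Each matching either avoids \<open>e\<close>, or is \<open>e\<close> together with a
  matching of the edges disjoint from it. The recursion is used twice, which is why it is stated
  over a commutative ring: with complex weights to locate zeros, and with real weights for the
  partition function.\<close>

lemma matching_sum_delete_edge:
  fixes x :: "'v \<Rightarrow> 'r::comm_ring_1"
  assumes "finite E" "e \<in> E" "e \<noteq> {}"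
  shows "matching_sum V E x w =
    matching_sum V (E - {e}) x w + w e * matching_sum (V - e) {e'\<in>E. disjnt e e'} x w"
proof -
  let ?N = "matchings {e'\<in>E. disjnt e e'}"
  \<comment> \<open>A nonempty edge is not disjoint from itself. This makes \<open>insert e\<close>
    injective on \<open>?N\<close> and lets the factor \<open>w e\<close> split off.\<close>
  have e: "e \<notin> m" if "m \<in> ?N" for m
    using that assms(3) by (auto simp: matchings_def)
  have fin: "finite m" if "m \<in> ?N" for m
    by (rule finite_in_matchings[OF _ that]) (simp add: assms(1))
  have inj: "inj_on (insert e) ?N"
    by (rule inj_onI) (metis e insert_ident)
  have "matching_sum V E x w = matching_sum V (E - {e}) x w
      + (\<Sum>m\<in>insert e ` ?N. (\<Prod>v\<in>unpaired V m. x v) * (\<Prod>e\<in>m. w e))"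
    unfolding matching_sum_def matchings_delete_edge[OF assms(2,3)]
    using assms(1) by (intro sum.union_disjoint) (auto simp: finite_matchings matchings_def)
  also have "(\<Sum>m\<in>insert e ` ?N. (\<Prod>v\<in>unpaired V m. x v) * (\<Prod>e\<in>m. w e))
      = (\<Sum>m\<in>?N. (\<Prod>v\<in>unpaired V (insert e m). x v) * (\<Prod>e\<in>insert e m. w e))"
    by (simp add: sum.reindex[OF inj])
  also have "\<dots> = (\<Sum>m\<in>?N. w e * ((\<Prod>v\<in>unpaired (V - e) m. x v) * (\<Prod>e\<in>m. w e)))"
    by (intro sum.cong refl) (simp add: e fin unpaired_insert)
  finally show ?thesis
    by (simp add: matching_sum_def sum_distrib_left)
qed

text \<open>The vertex \<open>v\<close> is either unpaired or lies on exactly one edge of the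
  matching; the two summands are these cases. They arise by applying the edge recursion to the edges
  at \<open>v\<close> one after another.\<close>

lemma matching_sum_delete_vertex:
  fixes x :: "'v \<Rightarrow> 'r::comm_ring_1"
  assumes "finite V" "finite E" "v \<in> V"
  shows "matching_sum V E x w =
    x v * matching_sum (V - {v}) {e\<in>E. v \<notin> e} x w
    + (\<Sum>e\<in>{e\<in>E. v \<in> e}. w e * matching_sum (V - e) {e'\<in>E. disjnt e e'} x w)"
proof -
  have *: "matching_sum V E x w = matching_sum V (E - F) x w
      + (\<Sum>e\<in>F. w e * matching_sum (V - e) {e'\<in>E. disjnt e e'} x w)"
    if "F \<subseteq> {e\<in>E. v \<in> e}" for F
  proof -
    have "finite F" using that assms(2) finite_subset by fastforce
    then show ?thesis using that
    proof (induction F rule: finite_induct)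
      case empty
      show ?case by simp
    next
      case (insert e F)
      \<comment> \<open>Every edge of \<open>F\<close> meets \<open>e\<close> in \<open>v\<close>,
        so the earlier deletions do not change what remains once \<open>e\<close> is used.\<close>
      have "{e'\<in>E - F. disjnt e e'} = {e'\<in>E. disjnt e e'}"
        using insert.prems by (auto simp: disjnt_def)
      moreover have "E - F - {e} = E - insert e F" by auto
      ultimately have "matching_sum V (E - F) x w = matching_sum V (E - insert e F) x w
          + w e * matching_sum (V - e) {e'\<in>E. disjnt e e'} x w"
        using matching_sum_delete_edge[of "E - F" e V x w] assms(2) insert by auto
      with insert show ?case by (simp add: algebra_simps)
    qed
  qed
  have "matching_sum V {e\<in>E. v \<notin> e} x w = x v * matching_sum (V - {v}) {e\<in>E. v \<notin> e} x w"
  proof -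
    have "(\<Prod>v\<in>unpaired V m. x v) = x v * (\<Prod>v\<in>unpaired (V - {v}) m. x v)"
      if "m \<in> matchings {e\<in>E. v \<notin> e}" for m
    proof -
      have "unpaired V m = insert v (unpaired (V - {v}) m)" "v \<notin> unpaired (V - {v}) m"
        "finite (unpaired (V - {v}) m)"
        using that assms by (auto simp: unpaired_def matchings_def)
      then show ?thesis by simp
    qed
    then show ?thesis
      unfolding matching_sum_def sum_distrib_left
      by (intro sum.cong refl) (simp add: mult.assoc)
  qed
  moreover have "E - {e\<in>E. v \<in> e} = {e\<in>E. v \<notin> e}" by auto
  ultimately show ?thesis using *[of "{e\<in>E. v \<in> e}"] by simp
qed

text \<open>
  Dividing the vertex recursion by \<open>matching_sum (V - {v})\<close> writes the ratio of consecutive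
  partition functions as a continued fraction, and the right half-plane is preserved by it.
\<close>

lemma matching_sum_ratio:
  fixes x :: "'v \<Rightarrow> real" and w :: "'v set \<Rightarrow> real" and s :: complex
  assumes "finite_simple_graph V E" "\<And>v. x v > 0" "\<And>e. w e > 0" "Re s > 0"
  defines "S \<equiv> \<lambda>V E. matching_sum V E (\<lambda>v. of_real (x v)) (\<lambda>e. s\<^sup>2 * of_real (w e))"
  shows "S V E \<noteq> 0 \<and> (\<forall>v\<in>V. Re (S V E / (s * S (V - {v}) {e\<in>E. v \<notin> e})) > 0)"
  using assms(1)
proof (induction "card V" arbitrary: V E rule: less_induct)
  case less
  note G = less.prems
  have fV: "finite V" using G by (simp add: finite_simple_graph_def)
  have fE: "finite E" using G by (rule finite_simple_graph_finite_edges)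
  have s0: "s \<noteq> 0" using assms(4) by auto
  have inv_pos: "Re (1 / z) > 0" if "Re z > 0" for z :: complex
    using that by (auto simp: Re_divide intro!: divide_pos_pos add_pos_nonneg)
  have Re_scale: "Re (of_real c * z) = c * Re z" for c and z :: complex
    by simp
  have ratio: "Re (S V E / (s * S (V - {v}) {e\<in>E. v \<notin> e})) > 0" if v: "v \<in> V" for v
  proof -
    let ?V' = "V - {v}" and ?E' = "{e\<in>E. v \<notin> e}"
    have G': "finite_simple_graph ?V' ?E'"
      using G by (auto simp: finite_simple_graph_def)
    have "card ?V' < card V" using v fV by (intro psubset_card_mono) auto
    note IH = less.hyps[OF this G']
    have nz: "S ?V' ?E' \<noteq> 0" using IH by simp
    have pos: "Re (s * S (V - e) {e'\<in>E. disjnt e e'} / S ?V' ?E') > 0" if e: "e \<in> E" "v \<in> e" for e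
    proof -
      obtain u where u: "e = {v, u}" "u \<noteq> v"
      proof -
        have "card e = 2" using G e by (auto simp: finite_simple_graph_def)
        then obtain a b where ab: "e = {a, b}" "a \<noteq> b" by (auto simp: card_2_iff)
        show ?thesis
        proof (cases "v = a")
          case True
          then show ?thesis using that[of b] ab by auto
        next
          case False
          then show ?thesis using that[of a] ab e by auto
        qed
      qed
      have "u \<in> ?V'" using G u e by (auto simp: finite_simple_graph_def)
      \<comment> \<open>What is left after using the edge from \<open>v\<close> to \<open>u\<close>
        is the graph without \<open>v\<close>, with \<open>u\<close> removed as well. The induction
        hypothesis at \<open>u\<close> therefore speaks about it.\<close>
      moreover have "V - e = ?V' - {u}" "{e'\<in>E. disjnt e e'} = {e\<in>?E'. u \<notin> e}"
        using u by (auto simp: disjnt_def)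
      ultimately have "Re (S ?V' ?E' / (s * S (V - e) {e'\<in>E. disjnt e e'})) > 0"
        using IH by auto
      from inv_pos[OF this] show ?thesis by (simp add: divide_simps split: if_splits)
    qed
    have "S V E = of_real (x v) * S ?V' ?E'
        + (\<Sum>e\<in>{e\<in>E. v \<in> e}. s\<^sup>2 * of_real (w e) * S (V - e) {e'\<in>E. disjnt e e'})"
      unfolding S_def by (rule matching_sum_delete_vertex[OF fV fE v])
    \<comment> \<open>Write R_v for the quotient on the left. The identity reads R_v =
      \<open>x v\<close> / s + the sum of \<open>w e\<close> / R_u over the edges \<open>e\<close>
      from \<open>v\<close> to u, with R_u taken in the graph without \<open>v\<close>. Of the
      factor s squared, one s is absorbed by R_v and the other by 1 / R_u.\<close>
    then have "S V E / (s * S ?V' ?E') = of_real (x v) * (1 / s)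
        + (\<Sum>e\<in>{e\<in>E. v \<in> e}. of_real (w e) * (s * S (V - e) {e'\<in>E. disjnt e e'} / S ?V' ?E'))"
      using nz s0 by (simp add: field_simps sum_distrib_left sum_divide_distrib power2_eq_square)
    moreover have "Re (of_real (x v) * (1 / s)) > 0"
      using inv_pos[OF assms(4)] assms(2)[of v] unfolding Re_scale by simp
    moreover have "Re (\<Sum>e\<in>{e\<in>E. v \<in> e}. of_real (w e) *
        (s * S (V - e) {e'\<in>E. disjnt e e'} / S ?V' ?E')) \<ge> 0"
      unfolding Re_sum
    proof (rule sum_nonneg)
      fix e assume "e \<in> {e\<in>E. v \<in> e}"
      then show "0 \<le> Re (of_real (w e) * (s * S (V - e) {e'\<in>E. disjnt e e'} / S ?V' ?E'))"
        using pos[of e] assms(3)[of e] unfolding Re_scale by simp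
    qed
    ultimately show ?thesis by simp
  qed
  show ?case
  proof (cases "V = {}")
    case True
    then have "E = {}" using G by (auto simp: finite_simple_graph_def)
    then have "matchings E = {{}}" by (auto simp: matchings_def)
    then have "S V E = 1" using True by (simp add: S_def matching_sum_def unpaired_def)
    then show ?thesis using True by simp
  next
    case False
    then obtain v where "v \<in> V" by auto
    \<comment> \<open>A vanishing numerator would make the quotient 0, against its positive real
      part.\<close>
    then have "S V E \<noteq> 0" using ratio[of v] by auto
    then show ?thesis using ratio by auto
  qed
qed

text \<open>The principal root \<open>csqrt z\<close> has positive real part precisely when
  \<open>z\<close> is off the nonpositive real axis, and it can then serve as \<open>s\<close> in
  \<open>matching_sum_ratio\<close>.\<close>

theorem Heilmann_Lieb:
  fixes x :: "'v \<Rightarrow> real" and w :: "'v set \<Rightarrow> real" and z :: complex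
  assumes "finite_simple_graph V E" "\<And>v. x v > 0" "\<And>e. w e > 0" "z \<notin> \<real>\<^sub>\<le>\<^sub>0"
  shows "matching_sum V E (\<lambda>v. of_real (x v)) (\<lambda>e. z * of_real (w e)) \<noteq> 0"
proof -
  have "Re (csqrt z) > 0"
  proof (rule ccontr)
    assume "\<not> Re (csqrt z) > 0"
    then have 0: "Re (csqrt z) = 0" using csqrt_principal[of z] by auto
    have "z = (csqrt z)\<^sup>2" by simp
    also have "\<dots> = of_real (- (Im (csqrt z))\<^sup>2)"
      using 0 by (simp add: complex_eq_iff power2_eq_square)
    finally have "z = of_real (- (Im (csqrt z))\<^sup>2)" .
    then have "Re z \<le> 0 \<and> Im z = 0" by (metis Re_complex_of_real Im_complex_of_real neg_le_0_iff_le zero_le_power2)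
    with assms(4) show False by (simp add: complex_nonpos_Reals_iff)
  qed
  from matching_sum_ratio[OF assms(1,2,3) this] show ?thesis by simp
qed

lemma matching_card:
  assumes "finite_simple_graph V E" "m \<in> matchings E"
  shows "card V = card (unpaired V m) + 2 * card m"
proof -
  have m: "\<And>e. e \<in> m \<Longrightarrow> e \<subseteq> V \<and> card e = 2" "disjoint m" "finite V"
    using assms by (auto simp: finite_simple_graph_def matchings_def)
  have "card (\<Union>m) = (\<Sum>e\<in>m. card e)"
    using m(2) by (intro card_Union_disjoint) (auto intro: finite_subset[OF _ m(3)] dest: m(1))
  also have "\<dots> = 2 * card m" using m(1) by simp
  finally have "card (\<Union>m) = 2 * card m" .
  moreover have "V = unpaired V m \<union> \<Union>m" "unpaired V m \<inter> \<Union>m = {}"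
    using m(1) by (auto simp: unpaired_def)
  moreover have "finite (\<Union>m)" using m by (meson Sup_least finite_subset)
  ultimately show ?thesis using m(3) card_Un_disjoint
    by (metis finite_Un)
qed

text \<open>
  The number of edges of a Gibbs matching is distributed as a sum of independent Bernoulli
  variables; this is the identity of the two generating functions.
\<close>

lemma gibbs_edge_count_Bernoulli:
  fixes \<nu> :: "'v \<Rightarrow> real" and \<omega> :: "'v set \<Rightarrow> real"
  assumes "finite_simple_graph V E"
  obtains K :: nat and p :: "nat \<Rightarrow> real" where
    "K \<le> card V" "\<And>k. k < K \<Longrightarrow> 0 < p k \<and> p k < 1"
    "\<And>z :: complex. (\<Sum>m\<in>matchings E. of_real (gibbs_weight V E \<nu> \<omega> m) * z ^ card m)
      = (\<Prod>k<K. 1 - of_real (p k) + of_real (p k) * z)"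
proof -
  have fV: "finite V" using assms by (simp add: finite_simple_graph_def)
  have fE: "finite E" using assms by (rule finite_simple_graph_finite_edges)
  have fM: "finite (matchings E)" using fE by (rule finite_matchings)
  define a where "a = gibbs_weight V E \<nu> \<omega>"
  define Z where "Z = partition_function V E \<nu> \<omega>"
  have Z: "Z > 0" unfolding Z_def partition_function_def
    using fM empty_in_matchings by (intro sum_pos) auto
  have a_pos: "a m > 0" for m using Z by (simp add: a_def gibbs_weight_def Z_def)
  have a_sum: "(\<Sum>m\<in>matchings E. a m) = 1"
    using Z by (simp add: a_def gibbs_weight_def Z_def partition_function_def flip: sum_divide_distrib)
  define G where "G = (\<Sum>m\<in>matchings E. monom (of_real (a m)) (card m) :: complex poly)"
  have poly_G: "poly G z = (\<Sum>m\<in>matchings E. of_real (a m) * z ^ card m)" for z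
    by (simp add: G_def poly_sum poly_monom)
  have G1: "poly G 1 = 1"
    by (simp add: poly_G flip: of_real_sum) (simp add: a_sum)
  have deg: "degree G \<le> card V"
    unfolding G_def
  proof (intro degree_sum_le fM)
    fix m assume m: "m \<in> matchings E"
    have "card m \<le> card V" using matching_card[OF assms m] by linarith
    then show "degree (monom (of_real (a m)) (card m) :: complex poly) \<le> card V"
      using degree_monom_le order_trans by blast
  qed
  \<comment> \<open>Multiplied by \<open>Z\<close>, the generating polynomial becomes a matching sum
    in which every edge weight carries the factor \<open>z\<close>.\<close>
  have nz: "poly G z \<noteq> 0" if z: "z \<notin> \<real>\<^sub>\<le>\<^sub>0" for z
  proof -
    have "of_real Z * poly G z
        = matching_sum V E (\<lambda>v. of_real (exp (\<nu> v))) (\<lambda>e. z * of_real (exp (\<omega> e)))"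
    proof -
      have "of_real Z * (of_real (a m) * z ^ card m)
          = (\<Prod>v\<in>unpaired V m. of_real (exp (\<nu> v))) * (\<Prod>e\<in>m. z * of_real (exp (\<omega> e)))"
        if m: "m \<in> matchings E" for m
      proof -
        have "finite m" using finite_in_matchings[OF fE m] .
        moreover have "finite (unpaired V m)" using fV by (simp add: unpaired_def)
        moreover have "Z * a m = exp (hamiltonian V \<nu> \<omega> m)"
          using Z by (simp add: a_def gibbs_weight_def Z_def)
        ultimately have "Z * a m = (\<Prod>v\<in>unpaired V m. exp (\<nu> v)) * (\<Prod>e\<in>m. exp (\<omega> e))"
          by (simp add: hamiltonian_def exp_add exp_sum)
        then have "of_real Z * of_real (a m) = ((\<Prod>v\<in>unpaired V m. of_real (exp (\<nu> v)))
            * (\<Prod>e\<in>m. of_real (exp (\<omega> e))) :: complex)"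
          by (metis of_real_mult of_real_prod)
        then show ?thesis by (simp add: prod.distrib mult.assoc[symmetric])
      qed
      then show ?thesis
        unfolding poly_G matching_sum_def sum_distrib_left by (intro sum.cong) auto
    qed
    also have "\<dots> \<noteq> 0" using assms z by (intro Heilmann_Lieb) auto
    finally show ?thesis by auto
  qed
  obtain root where root: "smult (lead_coeff G) (\<Prod>i<degree G. [:- root i, 1:]) = G"
    using complex_poly_decompose' by blast
  have poly_root: "poly G z = lead_coeff G * (\<Prod>i<degree G. z - root i)" for z
    by (subst root[symmetric]) (simp add: poly_prod)
  define r where "r = (\<lambda>i. - Re (root i))"
  \<comment> \<open>The zero-free region does not contain 0, so this point is treated separately:
    the constant term is the Gibbs weight of the empty matching, which is positive. It yields
    \<open>r i > 0\<close>, hence \<open>p i < 1\<close>.\<close>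
  have G0: "poly G 0 \<noteq> 0"
  proof -
    have "poly G 0 = (\<Sum>m\<in>matchings E. of_real (a m) * (if m = {} then 1 else 0))"
      unfolding poly_G using finite_in_matchings[OF fE] by (intro sum.cong) (auto simp: power_0_left)
    also have "\<dots> = of_real (a {})"
      using fM empty_in_matchings[of E] by (simp add: sum.delta if_distrib cong: if_cong)
    finally show ?thesis using a_pos[of "{}"] by simp
  qed
  have r: "root i = - of_real (r i) \<and> r i > 0" if "i < degree G" for i
  proof -
    have *: "poly G (root i) = 0" unfolding poly_root using that by auto
    then have "root i \<in> \<real>\<^sub>\<le>\<^sub>0" using nz by blast
    moreover have "root i \<noteq> 0" using * G0 by auto
    ultimately show ?thesis
      by (auto simp: r_def complex_nonpos_Reals_iff complex_eq_iff)
  qed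
  \<comment> \<open>Chosen so that (z + r) / (1 + r) = 1 - p + p z. Together with G(1) = 1, which
    fixes the leading coefficient, this turns the linear factors into Bernoulli generating
    functions.\<close>
  define p where "p = (\<lambda>i. 1 / (1 + r i))"
  have p: "0 < p i \<and> p i < 1" if "i < degree G" for i
    using r[OF that] by (auto simp: p_def)
  have lc: "lead_coeff G * (\<Prod>i<degree G. 1 + of_real (r i)) = 1"
    using G1 r by (simp add: poly_root)
  have main: "poly G z = (\<Prod>k<degree G. 1 - of_real (p k) + of_real (p k) * z)" for z
  proof -
    have "(\<Prod>k<degree G. 1 + of_real (r k)) * (\<Prod>k<degree G. 1 - of_real (p k) + of_real (p k) * z)
       = (\<Prod>k<degree G. z + of_real (r k))"
      unfolding prod.distrib[symmetric]
    proof (intro prod.cong refl)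
      fix k assume "k \<in> {..<degree G}"
      then have "1 + r k \<noteq> 0" using r[of k] by auto
      then have "(1 + r k) * p k = 1" by (simp add: p_def)
      then have "(1 + of_real (r k)) * of_real (p k) = (1 :: complex)"
        by (metis of_real_1 of_real_add of_real_mult)
      then show "(1 + of_real (r k)) * (1 - of_real (p k) + of_real (p k) * z) = z + of_real (r k)"
        by (simp add: algebra_simps)
    qed
    then have "lead_coeff G * (\<Prod>k<degree G. z + of_real (r k))
        = (lead_coeff G * (\<Prod>k<degree G. 1 + of_real (r k)))
          * (\<Prod>k<degree G. 1 - of_real (p k) + of_real (p k) * z)"
      by (simp only: mult.assoc)
    also have "\<dots> = (\<Prod>k<degree G. 1 - of_real (p k) + of_real (p k) * z)"
      by (simp only: lc mult_1)
    finally have "lead_coeff G * (\<Prod>k<degree G. z + of_real (r k))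
        = (\<Prod>k<degree G. 1 - of_real (p k) + of_real (p k) * z)" .
    then show ?thesis using r by (simp add: poly_root)
  qed
  show ?thesis
    by (rule that[of "degree G" p]) (use deg p main in \<open>auto simp: poly_G a_def\<close>)
qed

section \<open>The free energy\<close>

definition free_energy ::
    "'v set \<Rightarrow> 'v set set \<Rightarrow> ('v \<Rightarrow> real) \<Rightarrow> ('v set \<Rightarrow> real) \<Rightarrow> real" where
  "free_energy V E \<nu> \<omega> = ln (partition_function V E \<nu> \<omega>)"

text \<open>An upper bound for the free energy gained from one edge. It comes from ln (1 + exp y)
  \<le> ln 2 + |y|, where y is the change of energy when the two unpaired ends of \<open>e\<close>
  are joined.\<close>

definition edge_cost :: "('v \<Rightarrow> real) \<Rightarrow> ('v set \<Rightarrow> real) \<Rightarrow> 'v set \<Rightarrow> real" where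
  "edge_cost \<nu> \<omega> e = ln 2 + \<bar>\<omega> e\<bar> + (\<Sum>v\<in>e. \<bar>\<nu> v\<bar>)"

lemma edge_cost_nonneg: "edge_cost \<nu> \<omega> e \<ge> 0"
  by (simp add: edge_cost_def sum_nonneg)

lemma partition_function_pos:
  assumes "finite E"
  shows "partition_function V E \<nu> \<omega> > 0"
  unfolding partition_function_def
  using finite_matchings[OF assms] empty_in_matchings by (intro sum_pos) auto

lemma partition_function_eq_matching_sum:
  assumes "finite V" "finite E"
  shows "partition_function V E \<nu> \<omega> = matching_sum V E (\<lambda>v. exp (\<nu> v)) (\<lambda>e. exp (\<omega> e))"
  unfolding partition_function_def matching_sum_def
proof (intro sum.cong refl)
  fix m assume "m \<in> matchings E"
  then have "finite m" using finite_in_matchings[OF assms(2)] by blast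
  moreover have "finite (unpaired V m)" using assms by (simp add: unpaired_def)
  ultimately show "exp (hamiltonian V \<nu> \<omega> m) = (\<Prod>v\<in>unpaired V m. exp (\<nu> v)) * (\<Prod>e\<in>m. exp (\<omega> e))"
    by (simp add: hamiltonian_def exp_add exp_sum)
qed

text \<open>Dropping \<open>e\<close> from a matching that contains it leaves its ends unpaired and
  divides the weight by exp y, with y the difference between \<open>\<omega> e\<close> and the
  vertex weights of \<open>e\<close>. Hence the matchings through \<open>e\<close> weigh at most exp
  y times the total weight \<open>Z1\<close> of those that avoid it.\<close>

lemma free_energy_delete_edge:
  assumes G: "finite_simple_graph V E" and e: "e \<in> E"
  shows "free_energy V (E - {e}) \<nu> \<omega> \<le> free_energy V E \<nu> \<omega>"
    and "free_energy V E \<nu> \<omega> \<le> free_energy V (E - {e}) \<nu> \<omega> + edge_cost \<nu> \<omega> e"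
proof -
  have fV: "finite V" using G by (simp add: finite_simple_graph_def)
  have fE: "finite E" using G by (rule finite_simple_graph_finite_edges)
  have ee: "e \<subseteq> V" "e \<noteq> {}" using G e by (auto simp: finite_simple_graph_def)
  have fe: "finite e" using ee(1) fV finite_subset by blast
  let ?E' = "{e'\<in>E. disjnt e e'}"
  define Z where "Z = partition_function V E \<nu> \<omega>"
  define Z1 where "Z1 = partition_function V (E - {e}) \<nu> \<omega>"
  define Z2 where "Z2 = partition_function (V - e) ?E' \<nu> \<omega>"
  have Z: "Z = Z1 + exp (\<omega> e) * Z2"
    unfolding Z_def Z1_def Z2_def using fV fE
    by (simp add: partition_function_eq_matching_sum matching_sum_delete_edge[OF fE e ee(2)])
  have pos: "Z > 0" "Z1 > 0" "Z2 > 0"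
    unfolding Z_def Z1_def Z2_def using fE by (auto intro: partition_function_pos)
  have "exp (\<Sum>v\<in>e. \<nu> v) * Z2 = (\<Sum>m\<in>matchings ?E'. exp (hamiltonian V \<nu> \<omega> m))"
    unfolding Z2_def partition_function_def sum_distrib_left
  proof (intro sum.cong refl)
    fix m assume m: "m \<in> matchings ?E'"
    have "unpaired V m = e \<union> unpaired (V - e) m"
      using m ee(1) by (fastforce simp: unpaired_def matchings_def disjnt_iff)
    moreover have "e \<inter> unpaired (V - e) m = {}" "finite (unpaired (V - e) m)"
      using fV by (auto simp: unpaired_def)
    ultimately show "exp (\<Sum>v\<in>e. \<nu> v) * exp (hamiltonian (V - e) \<nu> \<omega> m) = exp (hamiltonian V \<nu> \<omega> m)"
      using fe by (simp add: hamiltonian_def sum.union_disjoint exp_add[symmetric] add.assoc)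
  qed
  also have "\<dots> \<le> Z1"
    unfolding Z1_def partition_function_def
    using fE ee(2) by (intro sum_mono2 finite_matchings) (auto simp: matchings_def)
  finally have Z2: "exp (\<Sum>v\<in>e. \<nu> v) * Z2 \<le> Z1" .
  define y where "y = \<omega> e - (\<Sum>v\<in>e. \<nu> v)"
  have "exp (\<omega> e) * Z2 = exp y * (exp (\<Sum>v\<in>e. \<nu> v) * Z2)"
    by (simp add: y_def exp_diff)
  also have "\<dots> \<le> exp y * Z1" using Z2 by simp
  finally have "Z \<le> Z1 + exp y * Z1" by (simp add: Z)
  also have "\<dots> = (1 + exp y) * Z1" by (simp add: algebra_simps)
  also have "\<dots> \<le> (2 * exp \<bar>y\<bar>) * Z1"
    using pos by (intro mult_right_mono) (smt (verit) exp_le_cancel_iff one_le_exp_iff, simp)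
  finally have "ln Z \<le> ln (2 * exp \<bar>y\<bar> * Z1)" using pos by simp
  also have "\<dots> = ln 2 + \<bar>y\<bar> + ln Z1" using pos by (simp add: ln_mult)
  also have "\<bar>y\<bar> \<le> \<bar>\<omega> e\<bar> + (\<Sum>v\<in>e. \<bar>\<nu> v\<bar>)"
    unfolding y_def using sum_abs[of \<nu> e] by linarith
  finally show "free_energy V E \<nu> \<omega> \<le> free_energy V (E - {e}) \<nu> \<omega> + edge_cost \<nu> \<omega> e"
    by (simp add: free_energy_def edge_cost_def Z_def Z1_def)
  have "Z1 \<le> Z" using Z pos by simp
  then show "free_energy V (E - {e}) \<nu> \<omega> \<le> free_energy V E \<nu> \<omega>"
    using pos by (simp add: free_energy_def Z_def Z1_def)
qed

lemma free_energy_delete_edges: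
  assumes G: "finite_simple_graph V E" and F: "F \<subseteq> E"
  shows "\<bar>free_energy V E \<nu> \<omega> - free_energy V (E - F) \<nu> \<omega>\<bar> \<le> (\<Sum>e\<in>F. edge_cost \<nu> \<omega> e)"
proof -
  have "finite F" using F finite_simple_graph_finite_edges[OF G] finite_subset by blast
  then show ?thesis using F
  proof (induction F rule: finite_induct)
    case empty
    then show ?case by simp
  next
    case (insert e F)
    have "finite_simple_graph V (E - F)" "e \<in> E - F"
      using finite_simple_graph_subset[OF G] insert by auto
    note free_energy_delete_edge[OF this, of \<nu> \<omega>]
    moreover have "E - F - {e} = E - insert e F" by auto
    ultimately have "\<bar>free_energy V (E - F) \<nu> \<omega> - free_energy V (E - insert e F) \<nu> \<omega>\<bar> \<le> edge_cost \<nu> \<omega> e"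
      by simp
    with insert show ?case by simp
  qed
qed

lemma free_energy_no_edges:
  "free_energy V {} \<nu> \<omega> = (\<Sum>v\<in>V. \<nu> v)"
  by (simp add: free_energy_def partition_function_def matchings_def hamiltonian_def unpaired_def
      cong: conj_cong)

text \<open>Deleting every edge leaves only the sum of the vertex weights. The bound is a finite sum
  of absolute weights and constants, which later gives square integrability.\<close>

lemma free_energy_bound:
  assumes "finite_simple_graph V E"
  shows "\<bar>free_energy V E \<nu> \<omega>\<bar> \<le> (\<Sum>v\<in>V. \<bar>\<nu> v\<bar>) + (\<Sum>e\<in>E. edge_cost \<nu> \<omega> e)"
  using free_energy_delete_edges[OF assms order_refl, of \<nu> \<omega>] sum_abs[of \<nu> V]
  unfolding Diff_cancel free_energy_no_edges by linarith

lemma hamiltonian_cong: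
  assumes "\<And>v. v \<in> V \<Longrightarrow> \<nu> v = \<nu>' v" "\<And>e. e \<in> E \<Longrightarrow> \<omega> e = \<omega>' e" "m \<in> matchings E"
  shows "hamiltonian V \<nu> \<omega> m = hamiltonian V \<nu>' \<omega>' m"
  using assms unfolding hamiltonian_def
  by (intro arg_cong2[where f = "(+)"] sum.cong) (auto simp: unpaired_def matchings_def)

lemma free_energy_cong:
  assumes "\<And>v. v \<in> V \<Longrightarrow> \<nu> v = \<nu>' v" "\<And>e. e \<in> E \<Longrightarrow> \<omega> e = \<omega>' e"
  shows "free_energy V E \<nu> \<omega> = free_energy V E \<nu>' \<omega>'"
  unfolding free_energy_def partition_function_def
  using hamiltonian_cong[of V \<nu> \<nu>' E \<omega> \<omega>'] assms by (simp cong: sum.cong)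

lemma matchings_Un:
  assumes "V1 \<inter> V2 = {}" "\<And>e. e \<in> E1 \<Longrightarrow> e \<subseteq> V1" "\<And>e. e \<in> E2 \<Longrightarrow> e \<subseteq> V2"
  shows "matchings (E1 \<union> E2) = (\<lambda>(m1, m2). m1 \<union> m2) ` (matchings E1 \<times> matchings E2)"
proof (intro set_eqI iffI)
  fix m assume m: "m \<in> matchings (E1 \<union> E2)"
  then have "m = (m \<inter> E1) \<union> (m \<inter> E2)" "m \<inter> E1 \<in> matchings E1" "m \<inter> E2 \<in> matchings E2"
    by (auto simp: matchings_def pairwise_def)
  then show "m \<in> (\<lambda>(m1, m2). m1 \<union> m2) ` (matchings E1 \<times> matchings E2)"
    by (intro image_eqI[of _ _ "(m \<inter> E1, m \<inter> E2)"]) auto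
next
  fix m assume "m \<in> (\<lambda>(m1, m2). m1 \<union> m2) ` (matchings E1 \<times> matchings E2)"
  then obtain m1 m2 where m: "m = m1 \<union> m2" "m1 \<subseteq> E1" "m2 \<subseteq> E2" "disjoint m1" "disjoint m2"
    by (auto simp: matchings_def)
  have across: "disjnt a b" if "a \<in> m1" "b \<in> m2" for a b
  proof -
    have "a \<subseteq> V1" "b \<subseteq> V2" using that m(2,3) assms(2,3) by blast+
    then show ?thesis using assms(1) unfolding disjnt_def by blast
  qed
  have "disjoint (m1 \<union> m2)"
    unfolding pairwise_def
  proof (intro ballI impI)
    fix a b assume "a \<in> m1 \<union> m2" "b \<in> m1 \<union> m2" "a \<noteq> b"
    then show "disjnt a b"
      using pairwiseD[OF m(4), of a b] pairwiseD[OF m(5), of a b] across[of a b]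
        disjnt_sym[OF across[of b a]] by blast
  qed
  then show "m \<in> matchings (E1 \<union> E2)"
    using m by (auto simp: matchings_def)
qed

text \<open>Matchings of graphs on disjoint vertex sets combine freely, so the partition function
  factorises.\<close>

lemma free_energy_Un:
  assumes G: "finite_simple_graph V1 E1" "finite_simple_graph V2 E2" and dj: "V1 \<inter> V2 = {}"
  shows "free_energy (V1 \<union> V2) (E1 \<union> E2) \<nu> \<omega> = free_energy V1 E1 \<nu> \<omega> + free_energy V2 E2 \<nu> \<omega>"
proof -
  have sub: "\<And>e. e \<in> E1 \<Longrightarrow> e \<subseteq> V1 \<and> e \<noteq> {}" "\<And>e. e \<in> E2 \<Longrightarrow> e \<subseteq> V2 \<and> e \<noteq> {}"
    and fV: "finite V1" "finite V2"
    using G by (auto simp: finite_simple_graph_def)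
  have fE: "finite E1" "finite E2" using G finite_simple_graph_finite_edges by auto
  have EE: "E1 \<inter> E2 = {}" using sub dj by blast
  let ?P = "matchings E1 \<times> matchings E2"
  have inj: "inj_on (\<lambda>(m1, m2). m1 \<union> m2) ?P"
  proof (rule inj_onI, clarify)
    fix a b c d assume *: "a \<in> matchings E1" "b \<in> matchings E2" "c \<in> matchings E1" "d \<in> matchings E2"
      "a \<union> b = c \<union> d"
    then have "a = (a \<union> b) \<inter> E1" "c = (c \<union> d) \<inter> E1" "b = (a \<union> b) \<inter> E2" "d = (c \<union> d) \<inter> E2"
      using EE by (auto simp: matchings_def)
    then show "a = c \<and> b = d" using *(5) by metis
  qed
  have ham: "hamiltonian (V1 \<union> V2) \<nu> \<omega> (m1 \<union> m2) = hamiltonian V1 \<nu> \<omega> m1 + hamiltonian V2 \<nu> \<omega> m2"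
    if m: "m1 \<in> matchings E1" "m2 \<in> matchings E2" for m1 m2
  proof -
    have s: "\<And>e. e \<in> m1 \<Longrightarrow> e \<subseteq> V1" "\<And>e. e \<in> m2 \<Longrightarrow> e \<subseteq> V2"
      using m sub by (auto simp: matchings_def)
    have "unpaired (V1 \<union> V2) (m1 \<union> m2) = unpaired V1 m1 \<union> unpaired V2 m2"
      using s dj unfolding unpaired_def by blast
    moreover have "unpaired V1 m1 \<inter> unpaired V2 m2 = {}" "finite (unpaired V1 m1)" "finite (unpaired V2 m2)"
      using dj fV by (auto simp: unpaired_def)
    moreover have "m1 \<inter> m2 = {}" "finite m1" "finite m2"
      using m EE finite_in_matchings fE by (auto simp: matchings_def)
    ultimately show ?thesis by (simp add: hamiltonian_def sum.union_disjoint)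
  qed
  have matchings: "matchings (E1 \<union> E2) = (\<lambda>(m1, m2). m1 \<union> m2) ` ?P"
    using sub dj by (intro matchings_Un[of V1 V2]) auto
  have "partition_function (V1 \<union> V2) (E1 \<union> E2) \<nu> \<omega>
      = (\<Sum>(m1, m2)\<in>?P. exp (hamiltonian V1 \<nu> \<omega> m1) * exp (hamiltonian V2 \<nu> \<omega> m2))"
    unfolding partition_function_def matchings
    by (subst sum.reindex[OF inj], intro sum.cong refl) (auto simp: ham exp_add)
  also have "\<dots> = partition_function V1 E1 \<nu> \<omega> * partition_function V2 E2 \<nu> \<omega>"
    by (simp add: partition_function_def sum_product sum.cartesian_product)
  finally show ?thesis
    using partition_function_pos[OF fE(1), of V1 \<nu> \<omega>] partition_function_pos[OF fE(2), of V2 \<nu> \<omega>]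
    by (simp add: free_energy_def ln_mult)
qed

lemma free_energy_UN:
  assumes "finite J" "disjoint_family_on V J" "\<And>j. j \<in> J \<Longrightarrow> finite_simple_graph (V j) (E j)"
  shows "free_energy (\<Union>j\<in>J. V j) (\<Union>j\<in>J. E j) \<nu> \<omega> = (\<Sum>j\<in>J. free_energy (V j) (E j) \<nu> \<omega>)"
  using assms
proof (induction J rule: finite_induct)
  case empty
  then show ?case by (simp add: free_energy_no_edges)
next
  case (insert j J)
  have "finite_simple_graph (\<Union>j\<in>J. V j) (\<Union>j\<in>J. E j)"
    using insert.hyps(1) insert.prems(2) by (fastforce simp: finite_simple_graph_def)
  moreover have "V j \<inter> (\<Union>j\<in>J. V j) = {}"
    using insert.prems(1) insert.hyps(2) by (force simp: disjoint_family_on_def)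
  ultimately have "free_energy (V j \<union> (\<Union>j\<in>J. V j)) (E j \<union> (\<Union>j\<in>J. E j)) \<nu> \<omega>
      = free_energy (V j) (E j) \<nu> \<omega> + free_energy (\<Union>j\<in>J. V j) (\<Union>j\<in>J. E j) \<nu> \<omega>"
    using insert.prems(2) by (intro free_energy_Un) auto
  moreover have "disjoint_family_on V J"
    using insert.prems(1) by (auto simp: disjoint_family_on_def)
  ultimately show ?case using insert by simp
qed

text \<open>Serves to carry a block from anywhere along the cylinder back to the first one.\<close>

lemma free_energy_image:
  assumes f: "inj f"
  shows "free_energy (f ` V) ((`) f ` E) \<nu> \<omega> = free_energy V E (\<lambda>v. \<nu> (f v)) (\<lambda>e. \<omega> (f ` e))"
proof -
  \<comment> \<open>The map \<open>f\<close> acts on three levels: vertices, edges and matchings.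
    Injectivity on each of them is needed to reindex the corresponding sum.\<close>
  have inj1: "inj ((`) f)" and inj2: "inj ((`) ((`) f))"
    using f by (auto simp: inj_image_eq_iff inj_on_def)
  have "matchings ((`) f ` E) = (`) ((`) f) ` matchings E"
  proof (intro set_eqI iffI)
    fix m assume m: "m \<in> matchings ((`) f ` E)"
    then obtain m' where m': "m' \<subseteq> E" "m = (`) f ` m'"
      by (auto simp: matchings_def subset_image_iff)
    have "disjnt a b" if "a \<in> m'" "b \<in> m'" "a \<noteq> b" for a b
    proof -
      have "f ` a \<noteq> f ` b" using that(3) inj_image_eq_iff[OF f] by blast
      then have "f ` a \<inter> f ` b = {}"
        using m m'(2) that by (auto simp: matchings_def pairwise_def disjnt_def)
      then have "f ` (a \<inter> b) = {}" by (simp only: image_Int[OF f])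
      then show ?thesis by (simp add: disjnt_def)
    qed
    then have "m' \<in> matchings E" using m'(1) by (auto simp: matchings_def pairwise_def)
    then show "m \<in> (`) ((`) f) ` matchings E" using m' by auto
  next
    fix m assume "m \<in> (`) ((`) f) ` matchings E"
    then obtain m' where m': "m = (`) f ` m'" "m' \<subseteq> E" "disjoint m'" by (auto simp: matchings_def)
    have "disjnt (f ` a) (f ` b)" if "a \<in> m'" "b \<in> m'" "f ` a \<noteq> f ` b" for a b
    proof -
      have "a \<inter> b = {}" using that m'(3) by (auto simp: pairwise_def disjnt_def)
      then have "f ` (a \<inter> b) = {}" by simp
      then show ?thesis by (simp only: disjnt_def image_Int[OF f])
    qed
    then have "disjoint m" unfolding m'(1) pairwise_def by blast
    moreover have "m \<subseteq> (`) f ` E" unfolding m'(1) by (rule image_mono[OF m'(2)])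
    ultimately show "m \<in> matchings ((`) f ` E)" by (simp add: matchings_def)
  qed
  moreover have "hamiltonian (f ` V) \<nu> \<omega> ((`) f ` m) = hamiltonian V (\<lambda>v. \<nu> (f v)) (\<lambda>e. \<omega> (f ` e)) m" for m
  proof -
    have "unpaired (f ` V) ((`) f ` m) = f ` unpaired V m"
      using f by (auto simp: unpaired_def dest: injD)
    then show ?thesis
      by (simp add: hamiltonian_def sum.reindex[OF inj_on_subset[OF f subset_UNIV]]
          sum.reindex[OF inj_on_subset[OF inj1 subset_UNIV]])
  qed
  ultimately show ?thesis
    by (simp add: free_energy_def partition_function_def sum.reindex[OF inj_on_subset[OF inj2 subset_UNIV]])
qed

section \<open>Decomposition of the cylinder into blocks\<close>

text \<open>\<open>S\<close> lists the layers that carry a copy of \<open>EH\<close>, and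
  \<open>T\<close> the lower ends of the edges along the path. Separate index sets keep this form
  closed under translation and union, and let a block omit the edges that leave its last
  layer.\<close>

definition strip_edges :: "nat set \<Rightarrow> nat set \<Rightarrow> 'h set \<Rightarrow> 'h set set \<Rightarrow> (nat \<times> 'h) set set" where
  "strip_edges S T VH EH =
     (\<lambda>(i, f). {i} \<times> f) ` (S \<times> EH) \<union> (\<lambda>(i, j). {(i, j), (Suc i, j)}) ` (T \<times> VH)"

definition translate :: "nat \<Rightarrow> nat \<times> 'h \<Rightarrow> nat \<times> 'h" where
  "translate a = map_prod ((+) a) id"

lemma inj_translate: "inj (translate a)"
  by (auto simp: translate_def inj_on_def)

lemma cylinder_vertices_eq: "cylinder_vertices n VH = {1..n} \<times> VH"
  by (simp add: cylinder_vertices_def path_vertices_def)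

lemma path_edges_iff: "{i, i'} \<in> path_edges n \<longleftrightarrow> (i \<in> {1..<n} \<and> i' = Suc i \<or> i' \<in> {1..<n} \<and> i = Suc i')"
  by (auto simp: path_edges_def path_vertices_def doubleton_eq_iff)

lemma cylinder_edges_eq:
  assumes "finite_simple_graph VH EH"
  shows "cylinder_edges n VH EH = strip_edges {1..n} {1..<n} VH EH"
proof (intro set_eqI iffI)
  fix e assume "e \<in> cylinder_edges n VH EH"
  then obtain i j i' j' where e: "e = {(i, j), (i', j')}" "i \<in> {1..n}" "j \<in> VH" "i' \<in> {1..n}" "j' \<in> VH"
    and c: "{i, i'} \<in> path_edges n \<and> j = j' \<or> i = i' \<and> {j, j'} \<in> EH"
    unfolding cylinder_edges_def cartesian_edges_def path_vertices_def by auto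
  from c show "e \<in> strip_edges {1..n} {1..<n} VH EH"
  proof (elim disjE conjE)
    assume *: "{i, i'} \<in> path_edges n" "j = j'"
    from *(1) have "e = {(i, j), (Suc i, j)} \<and> i \<in> {1..<n} \<or> e = {(i', j), (Suc i', j)} \<and> i' \<in> {1..<n}"
      using e(1) *(2) unfolding path_edges_iff by auto
    then show ?thesis using e(3) by (auto simp: strip_edges_def)
  next
    assume *: "i = i'" "{j, j'} \<in> EH"
    then have "e = {i} \<times> {j, j'}" using e(1) by auto
    then show ?thesis using *(2) e(2) unfolding strip_edges_def by auto
  qed
next
  fix e assume "e \<in> strip_edges {1..n} {1..<n} VH EH"
  then consider (vertical) i f where "e = {i} \<times> f" "i \<in> {1..n}" "f \<in> EH"
    | (horizontal) i j where "e = {(i, j), (Suc i, j)}" "i \<in> {1..<n}" "j \<in> VH"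
    unfolding strip_edges_def by auto
  then show "e \<in> cylinder_edges n VH EH"
  proof cases
    case vertical
    then have "f \<subseteq> VH" "card f = 2" using assms by (auto simp: finite_simple_graph_def)
    then obtain j j' where f: "f = {j, j'}" "j \<in> VH" "j' \<in> VH" by (auto simp: card_2_iff)
    then have "e = {(i, j), (i, j')}" using vertical by auto
    then show ?thesis
      unfolding cylinder_edges_def cartesian_edges_def path_vertices_def using vertical f by blast
  next
    case horizontal
    then have "{i, Suc i} \<in> path_edges n" by (simp add: path_edges_iff)
    then show ?thesis
      unfolding cylinder_edges_def cartesian_edges_def path_vertices_def using horizontal
      by (intro CollectI exI[of _ i] exI[of _ j] exI[of _ "Suc i"]) auto
  qed
qed

lemma finite_simple_graph_cylinder:
  assumes "finite_simple_graph VH EH"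
  shows "finite_simple_graph (cylinder_vertices n VH) (cylinder_edges n VH EH)"
  unfolding cylinder_edges_eq[OF assms] cylinder_vertices_eq
  using assms by (auto simp: finite_simple_graph_def strip_edges_def card_cartesian_product)

lemma translate_strip_edges:
  fixes VH :: "'h set"
  shows "(`) (translate a) ` strip_edges S T VH EH = strip_edges ((+) a ` S) ((+) a ` T) VH EH"
proof -
  have prod: "((+) a ` A) \<times> B = map_prod ((+) a) id ` (A \<times> B)" for A and B :: "'b set"
    by (auto simp: image_iff)
  have v: "translate a ` ({i} \<times> f) = {a + i} \<times> f" for i and f :: "'h set"
    by (auto simp: translate_def image_iff)
  have vertical: "(`) (translate a) ` (\<lambda>(i, f). {i} \<times> f) ` (S \<times> EH)
      = (\<lambda>(i, f). {i} \<times> f) ` (((+) a ` S) \<times> EH)"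
    unfolding prod image_image
    by (rule image_cong) (simp_all only: split_paired_all case_prod_conv map_prod_simp id_apply v)
  have h: "translate a ` {(i, j), (Suc i, j)} = {(a + i, j), (Suc (a + i), j)}" for i and j :: 'h
    by (auto simp: translate_def)
  have horizontal: "(`) (translate a) ` (\<lambda>(i, j). {(i, j), (Suc i, j)}) ` (T \<times> VH)
      = (\<lambda>(i, j). {(i, j), (Suc i, j)}) ` (((+) a ` T) \<times> VH)"
    unfolding prod image_image
    by (rule image_cong) (simp_all only: split_paired_all case_prod_conv map_prod_simp id_apply h add_Suc_right)
  show ?thesis
    unfolding strip_edges_def image_Un vertical horizontal ..
qed

lemma strip_edges_Diff_subset:
  "strip_edges S T VH EH - strip_edges S' T' VH EH \<subseteq> strip_edges (S - S') (T - T') VH EH"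
  by (auto simp: strip_edges_def)

lemma strip_edges_UN:
  "(\<Union>j\<in>J. strip_edges (S j) (T j) VH EH) = strip_edges (\<Union>j\<in>J. S j) (\<Union>j\<in>J. T j) VH EH"
  by (auto simp: strip_edges_def)

lemma strip_edges_mono:
  "S \<subseteq> S' \<Longrightarrow> T \<subseteq> T' \<Longrightarrow> strip_edges S T VH EH \<subseteq> strip_edges S' T' VH EH"
  by (auto simp: strip_edges_def)

lemma card_strip_edges_le:
  assumes "finite S" "finite T" "finite VH" "finite EH"
  shows "card (strip_edges S T VH EH) \<le> card S * card EH + card T * card VH"
proof -
  have "card (strip_edges S T VH EH) \<le> card ((\<lambda>(i, f). {i} \<times> f) ` (S \<times> EH))
      + card ((\<lambda>(i, j). {(i, j), (Suc i, j)}) ` (T \<times> VH))"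
    unfolding strip_edges_def by (rule card_Un_le)
  also have "\<dots> \<le> card (S \<times> EH) + card (T \<times> VH)"
    using assms by (intro add_mono card_image_le) auto
  finally show ?thesis by (simp add: card_cartesian_product)
qed

text \<open>Layers are numbered from 1, so block \<open>j\<close> consists of the layers
  \<open>j * L + 1\<close> to \<open>j * L + L\<close>, and it is \<open>i - 1\<close> that has to
  be divided by \<open>L\<close>.\<close>

lemma block_index:
  fixes i L :: nat
  assumes "L \<ge> 1" "i \<ge> 1" "i \<le> k * L"
  obtains j where "j < k" "j * L + 1 \<le> i" "i \<le> j * L + L"
proof
  show "(i - 1) div L < k"
    using assms by (simp add: less_mult_imp_div_less)
  have "(i - 1) div L * L + (i - 1) mod L = i - 1" by simp
  moreover have "(i - 1) mod L < L" using assms by simp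
  ultimately show "(i - 1) div L * L + 1 \<le> i" "i \<le> (i - 1) div L * L + L"
    using assms by linarith+
qed

lemma translate_cylinder_vertices:
  "translate a ` cylinder_vertices L VH = {a + 1..a + L} \<times> VH"
proof -
  have "{a + 1..a + L} = (+) a ` {1..L}" by simp
  then show ?thesis
    unfolding cylinder_vertices_eq translate_def by (simp only: map_prod_surj_on image_id id_apply)
qed

lemma translate_cylinder_edges:
  assumes "finite_simple_graph VH EH"
  shows "(`) (translate a) ` cylinder_edges L VH EH = strip_edges {a + 1..a + L} {a + 1..<a + L} VH EH"
  unfolding cylinder_edges_eq[OF assms] translate_strip_edges by (simp add: add.commute)

lemma translate_cylinder_subset:
  assumes "finite_simple_graph VH EH" "j < n div L"
  shows "translate (j * L) ` cylinder_vertices L VH \<subseteq> cylinder_vertices n VH"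
    and "(`) (translate (j * L)) ` cylinder_edges L VH EH \<subseteq> cylinder_edges n VH EH"
proof -
  have "Suc j * L \<le> n div L * L" using assms(2) by (intro mult_le_mono1) simp
  also have "\<dots> \<le> n" by simp
  finally have "j * L + L \<le> n" by simp
  then have "{j * L + 1..j * L + L} \<subseteq> {1..n}" "{j * L + 1..<j * L + L} \<subseteq> {1..<n}" by auto
  then show "translate (j * L) ` cylinder_vertices L VH \<subseteq> cylinder_vertices n VH"
    "(`) (translate (j * L)) ` cylinder_edges L VH EH \<subseteq> cylinder_edges n VH EH"
    unfolding translate_cylinder_vertices translate_cylinder_edges[OF assms(1)]
    unfolding cylinder_edges_eq[OF assms(1)] cylinder_vertices_eq
    by (simp_all only: strip_edges_mono Sigma_mono order_refl)
qed

lemma disjoint_translated_cylinders: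
  "disjoint_family_on (\<lambda>j. translate (j * L) ` cylinder_vertices L VH) J"
  unfolding disjoint_family_on_def translate_cylinder_vertices
proof (intro ballI impI)
  fix i j :: nat assume "i \<noteq> j"
  have *: "i * L + L \<le> j * L" if "i < j" for i j :: nat
  proof -
    have "Suc i * L \<le> j * L" using that by (intro mult_le_mono1) simp
    then show ?thesis by simp
  qed
  show "{i * L + 1..i * L + L} \<times> VH \<inter> {j * L + 1..j * L + L} \<times> VH = {}"
    using *[of i j] *[of j i] \<open>i \<noteq> j\<close> by (auto simp: neq_iff)
qed

text \<open>\<open>F\<close> collects the path edges that leave the last layer of a block, at most
  \<open>card VH\<close> for each block, and the edges based in the fewer than \<open>L\<close>
  layers after the last full block; \<open>R\<close> consists of the vertices of those layers. For
  fixed \<open>L\<close> only the first kind grows with \<open>n\<close>. Both sets are chosen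
  before the weights, so the bound can be integrated over the weights.\<close>

lemma cylinder_block_decomposition:
  fixes n L :: nat
  assumes G: "finite_simple_graph VH EH" and L: "L \<ge> 1"
  defines "k \<equiv> n div L"
  obtains F R where
    "F \<subseteq> cylinder_edges n VH EH" "card F \<le> k * card VH + L * (card EH + card VH)"
    "R \<subseteq> cylinder_vertices n VH" "card R \<le> L * card VH"
    "\<And>\<nu> \<omega>. \<bar>free_energy (cylinder_vertices n VH) (cylinder_edges n VH EH) \<nu> \<omega>
        - (\<Sum>j<k. free_energy (translate (j * L) ` cylinder_vertices L VH)
                    ((`) (translate (j * L)) ` cylinder_edges L VH EH) \<nu> \<omega>)\<bar>
      \<le> (\<Sum>e\<in>F. edge_cost \<nu> \<omega> e) + (\<Sum>v\<in>R. \<bar>\<nu> v\<bar>)"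
proof -
  let ?V = "cylinder_vertices n VH" and ?E = "cylinder_edges n VH EH"
  let ?Vb = "\<lambda>j. translate (j * L) ` cylinder_vertices L VH"
  let ?Eb = "\<lambda>j. (`) (translate (j * L)) ` cylinder_edges L VH EH"
  have fin: "finite VH" "finite EH"
    using G finite_simple_graph_finite_edges by (auto simp: finite_simple_graph_def)
  define F where "F = ?E - (\<Union>j<k. ?Eb j)"
  define R where "R = ?V - (\<Union>j<k. ?Vb j)"
  have rest: "card {k * L + 1..n} \<le> L"
  proof -
    have "n = k * L + n mod L" by (simp add: k_def)
    moreover have "n mod L < L" using L by simp
    ultimately show ?thesis by simp
  qed
  have cover: "i \<in> (\<Union>j<k. {j * L + 1..j * L + L})" if "1 \<le> i" "i \<le> k * L" for i
    using block_index[OF L that] by fastforce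
  have S: "{1..n} - (\<Union>j<k. {j * L + 1..j * L + L}) \<subseteq> {k * L + 1..n}"
    using cover by fastforce
  \<comment> \<open>The edge range of a block stops one short of its last layer. A path edge missed
    by all blocks thus starts at the last layer \<open>Suc j * L\<close> of a block or in the
    leftover layers.\<close>
  have T: "{1..<n} - (\<Union>j<k. {j * L + 1..<j * L + L}) \<subseteq> (\<lambda>j. Suc j * L) ` {..<k} \<union> {k * L + 1..n}"
  proof
    fix i assume i: "i \<in> {1..<n} - (\<Union>j<k. {j * L + 1..<j * L + L})"
    show "i \<in> (\<lambda>j. Suc j * L) ` {..<k} \<union> {k * L + 1..n}"
    proof (cases "i \<le> k * L")
      case True
      have "i \<ge> 1" using i by simp
      from block_index[OF L this True]
      obtain j where j: "j < k" "j * L + 1 \<le> i" "i \<le> j * L + L" .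
      have "i = j * L + L"
      proof (rule ccontr)
        assume "i \<noteq> j * L + L"
        then have "i \<in> {j * L + 1..<j * L + L}" using j by simp
        then show False using i j(1) by blast
      qed
      then show ?thesis using j(1) by auto
    qed (use i in auto)
  qed
  have "F \<subseteq> strip_edges {k * L + 1..n} ((\<lambda>j. Suc j * L) ` {..<k} \<union> {k * L + 1..n}) VH EH"
    unfolding F_def translate_cylinder_edges[OF G] strip_edges_UN
    unfolding cylinder_edges_eq[OF G]
    by (rule order_trans[OF strip_edges_Diff_subset strip_edges_mono[OF S T]])
  then have "card F \<le> card (strip_edges {k * L + 1..n} ((\<lambda>j. Suc j * L) ` {..<k} \<union> {k * L + 1..n}) VH EH)"
    using fin by (intro card_mono) (auto simp: strip_edges_def)
  also have "\<dots> \<le> card {k * L + 1..n} * card EH + card ((\<lambda>j. Suc j * L) ` {..<k} \<union> {k * L + 1..n}) * card VH"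
    using fin by (intro card_strip_edges_le) auto
  also have "\<dots> \<le> L * card EH + (k + L) * card VH"
  proof (intro add_mono mult_le_mono1 rest)
    have "card ((\<lambda>j. Suc j * L) ` {..<k} \<union> {k * L + 1..n}) \<le> card ((\<lambda>j. Suc j * L) ` {..<k}) + card {k * L + 1..n}"
      by (rule card_Un_le)
    also have "\<dots> \<le> k + L"
      using card_image_le[of "{..<k}" "\<lambda>j. Suc j * L"] by (intro add_mono rest) simp
    finally show "card ((\<lambda>j. Suc j * L) ` {..<k} \<union> {k * L + 1..n}) \<le> k + L" .
  qed
  finally have cF: "card F \<le> k * card VH + L * (card EH + card VH)" by (simp add: algebra_simps)
  have "R \<subseteq> {k * L + 1..n} \<times> VH"
    unfolding R_def translate_cylinder_vertices unfolding cylinder_vertices_eq using S by blast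
  then have "card R \<le> card ({k * L + 1..n} \<times> VH)" using fin by (intro card_mono) auto
  also have "\<dots> \<le> L * card VH"
    unfolding card_cartesian_product by (intro mult_le_mono1 rest)
  finally have cR: "card R \<le> L * card VH" .
  have sub: "?Vb j \<subseteq> ?V" "?Eb j \<subseteq> ?E" if "j < k" for j
    using translate_cylinder_subset[OF G, of j n L] that by (simp_all add: k_def)
  have Gb: "finite_simple_graph (?Vb j) (?Eb j)" for j
    using finite_simple_graph_cylinder[OF G, of L] unfolding finite_simple_graph_def
    by (intro conjI ballI)
       (auto simp: card_image[OF inj_on_subset[OF inj_translate subset_UNIV]])
  have Gu: "finite_simple_graph (\<Union>j<k. ?Vb j) (\<Union>j<k. ?Eb j)"
    using Gb by (fastforce simp: finite_simple_graph_def)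
  have "finite R" using fin by (simp add: R_def cylinder_vertices_eq)
  then have GR: "finite_simple_graph R {}" by (simp add: finite_simple_graph_def)
  have "\<bar>free_energy ?V ?E \<nu> \<omega> - (\<Sum>j<k. free_energy (?Vb j) (?Eb j) \<nu> \<omega>)\<bar>
      \<le> (\<Sum>e\<in>F. edge_cost \<nu> \<omega> e) + (\<Sum>v\<in>R. \<bar>\<nu> v\<bar>)" for \<nu> \<omega>
  proof -
    \<comment> \<open>Without \<open>F\<close> the graph consists of the blocks and the isolated
      vertices in \<open>R\<close>, whose free energy is the sum of their weights.\<close>
    have VE: "?V = (\<Union>j<k. ?Vb j) \<union> R" "?E - F = (\<Union>j<k. ?Eb j) \<union> {}"
      using sub unfolding F_def R_def by blast+
    have "free_energy ?V (?E - F) \<nu> \<omega> = free_energy ((\<Union>j<k. ?Vb j) \<union> R) ((\<Union>j<k. ?Eb j) \<union> {}) \<nu> \<omega>"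
      using VE by simp
    also have "\<dots> = free_energy (\<Union>j<k. ?Vb j) (\<Union>j<k. ?Eb j) \<nu> \<omega> + free_energy R {} \<nu> \<omega>"
      using Gu GR by (rule free_energy_Un) (auto simp: R_def)
    also have "free_energy (\<Union>j<k. ?Vb j) (\<Union>j<k. ?Eb j) \<nu> \<omega> = (\<Sum>j<k. free_energy (?Vb j) (?Eb j) \<nu> \<omega>)"
      by (intro free_energy_UN disjoint_translated_cylinders Gb) simp
    finally have "free_energy ?V (?E - F) \<nu> \<omega> = (\<Sum>j<k. free_energy (?Vb j) (?Eb j) \<nu> \<omega>) + (\<Sum>v\<in>R. \<nu> v)"
      by (simp add: free_energy_no_edges)
    then show ?thesis
      using free_energy_delete_edges[OF finite_simple_graph_cylinder[OF G], of F n \<nu> \<omega>] sum_abs[of \<nu> R]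
      unfolding F_def by (simp, linarith)
  qed
  then show ?thesis
    using that[of F R] cF cR unfolding F_def R_def by blast
qed

section \<open>Poisson binomial distributions\<close>

text \<open>Here \<open>ln (D s)\<close> is the cumulant generating function and \<open>q s\<close>
  the success probability after exponential tilting. The derivatives are q, q (1 - q) and q (1 - q)
  (1 - 2 q), the last bounded by 1. In the symmetric second difference the linear terms cancel, and
  the two Taylor remainders add up to at most a third of \<open>\<delta> ^ 3\<close>.\<close>

lemma ln_Bernoulli_mgf_second_difference:
  fixes p \<delta> :: real
  assumes p: "0 < p" "p < 1" and \<delta>: "\<delta> > 0"
  shows "\<bar>ln (1 - p + p * exp \<delta>) + ln (1 - p + p * exp (- \<delta>)) - \<delta>\<^sup>2 * (p * (1 - p))\<bar> \<le> \<delta> ^ 3"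
proof -
  define D where "D = (\<lambda>s. 1 - p + p * exp s)"
  define q where "q = (\<lambda>s. p * exp s / D s)"
  have D: "D s > p * exp s" "D s > 0" for s
  proof -
    show "D s > p * exp s" using p by (simp add: D_def)
    then show "D s > 0" using p by (smt (verit) exp_gt_zero mult_pos_pos)
  qed
  have q: "0 < q s" "q s < 1" for s
    using D[of s] p by (auto simp: q_def)
  have dD: "(D has_real_derivative p * exp s) (at s)" for s
    unfolding D_def by (auto intro!: derivative_eq_intros)
  have d1: "((\<lambda>s. ln (D s)) has_real_derivative q s) (at s)" for s
    unfolding q_def using D(2)[of s] by (auto intro!: derivative_eq_intros dD)
  have d2: "(q has_real_derivative q s * (1 - q s)) (at s)" for s
  proof -
    have "(q has_real_derivative (p * exp s * D s - p * exp s * (p * exp s)) / (D s * D s)) (at s)"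
      unfolding q_def using D(2)[of s] by (auto intro!: derivative_eq_intros dD)
    also have "(p * exp s * D s - p * exp s * (p * exp s)) / (D s * D s) = q s * (1 - q s)"
      unfolding q_def using D(2)[of s] by (simp add: field_simps)
    finally show ?thesis .
  qed
  have d3: "((\<lambda>s. q s * (1 - q s)) has_real_derivative q s * (1 - q s) * (1 - 2 * q s)) (at s)" for s
    by (auto intro!: derivative_eq_intros d2 simp: algebra_simps)
  define diff where "diff = (\<lambda>m::nat. if m = 0 then (\<lambda>s. ln (D s)) else if m = 1 then q
    else if m = 2 then (\<lambda>s. q s * (1 - q s)) else (\<lambda>s. q s * (1 - q s) * (1 - 2 * q s)))"
  have diff: "DERIV (diff m) s :> diff (Suc m) s" if "m < 3" for m s
  proof -
    have "m = 0 \<or> m = 1 \<or> m = 2" using that by auto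
    then show ?thesis using d1 d2 d3 by (auto simp: diff_def)
  qed
  have diff0: "diff 0 = (\<lambda>s. ln (D s))" by (simp add: diff_def)
  have taylor: "\<exists>r. \<bar>r\<bar> \<le> 1 \<and> ln (D x) = q 0 * x + q 0 * (1 - q 0) / 2 * x\<^sup>2 + r / 6 * x ^ 3" for x
  proof -
    obtain t where "ln (D x) = (\<Sum>m<3. diff m 0 / fact m * x ^ m) + diff 3 t / fact 3 * x ^ 3"
      using Maclaurin_bi_le[of diff "\<lambda>s. ln (D s)" 3 x] diff by (auto simp: diff0)
    moreover have "(\<Sum>m<3. diff m 0 / fact m * x ^ m) = q 0 * x + q 0 * (1 - q 0) / 2 * x\<^sup>2"
      by (simp add: eval_nat_numeral diff_def D_def)
    moreover have "\<bar>diff 3 t\<bar> \<le> 1"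
    proof -
      have "\<bar>diff 3 t\<bar> = \<bar>q t\<bar> * \<bar>1 - q t\<bar> * \<bar>1 - 2 * q t\<bar>" by (simp add: diff_def abs_mult)
      also have "\<dots> \<le> 1 * 1 * 1" using q[of t] by (intro mult_mono) auto
      finally show ?thesis by simp
    qed
    moreover have "fact 3 = (6::real)" by (simp add: fact_numeral)
    ultimately show ?thesis by auto
  qed
  have q0: "q 0 = p" by (simp add: q_def D_def)
  obtain r1 where r1: "\<bar>r1\<bar> \<le> 1" "ln (D \<delta>) = p * \<delta> + p * (1 - p) / 2 * \<delta>\<^sup>2 + r1 / 6 * \<delta> ^ 3"
    using taylor[of \<delta>] q0 by auto
  obtain r2 where r2: "\<bar>r2\<bar> \<le> 1" "ln (D (-\<delta>)) = p * (-\<delta>) + p * (1 - p) / 2 * (-\<delta>)\<^sup>2 + r2 / 6 * (-\<delta>) ^ 3"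
    using taylor[of "-\<delta>"] q0 by auto
  have "ln (D \<delta>) + ln (D (-\<delta>)) - \<delta>\<^sup>2 * (p * (1 - p)) = (r1 - r2) / 6 * \<delta> ^ 3"
    unfolding r1(2) r2(2) by (simp add: field_simps power2_eq_square power3_eq_cube)
  also have "\<bar>\<dots>\<bar> = \<bar>(r1 - r2) / 6\<bar> * \<delta> ^ 3"
    using \<delta> by (simp add: abs_mult)
  also have "\<dots> \<le> 1 * \<delta> ^ 3"
    using r1(1) r2(1) \<delta> by (intro mult_right_mono) auto
  finally show ?thesis by (simp add: D_def)
qed

text \<open>The centred Bernoulli variable and the Gaussian share mean and variance, so both
  characteristic functions agree with the same quadratic polynomial in \<open>u\<close> up to higher
  order. The cubic term is the Taylor remainder of \<open>iexp\<close>, the quartic one that of the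
  real exponential.\<close>

lemma Bernoulli_char_approx:
  fixes p u :: real
  assumes p: "0 < p" "p < 1"
  shows "cmod ((1 - of_real p + of_real p * iexp u) * iexp (- (u * p)) - of_real (exp (- (u\<^sup>2 * (p * (1 - p)) / 2))))
    \<le> \<bar>u\<bar> ^ 3 + u ^ 4"
proof -
  define v where "v = p * (1 - p)"
  have v: "0 \<le> v" "v \<le> 1" using p mult_mono[of p 1 "1 - p" 1] by (auto simp: v_def)
  define T where "T = (\<lambda>y::real. 1 + \<i> * y - of_real (y\<^sup>2 / 2))"
  have T: "cmod (iexp y - T y) \<le> \<bar>y\<bar> ^ 3 / 6" for y
  proof -
    have "(\<Sum>k\<le>2. (\<i> * of_real y) ^ k / fact k) = T y"
      by (simp add: T_def eval_nat_numeral power2_eq_square complex_eq_iff)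
    then show ?thesis using iexp_approx1[of y 2] by (simp add: eval_nat_numeral)
  qed
  have b: "\<bar>u * c\<bar> ^ 3 / 6 \<le> \<bar>u\<bar> ^ 3 / 6" if "\<bar>c\<bar> \<le> 1" for c
  proof -
    have "\<bar>u * c\<bar> \<le> \<bar>u\<bar>" using that by (simp add: abs_mult mult_left_le)
    then have "\<bar>u * c\<bar> ^ 3 \<le> \<bar>u\<bar> ^ 3" by (intro power_mono) auto
    then show ?thesis by simp
  qed
  have e: "iexp u * iexp (- (u * p)) = iexp (u * (1 - p))"
    by (simp add: exp_add[symmetric] algebra_simps)
  have split: "(1 - of_real p + of_real p * iexp u) * iexp (- (u * p))
      = of_real (1 - p) * iexp (u * (- p)) + of_real p * iexp (u * (1 - p))"
    unfolding e[symmetric] by (simp add: algebra_simps)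
  \<comment> \<open>The centred variable takes the values -p and 1 - p with probabilities 1 - p and
    p. Its mean is zero, so the linear terms cancel, and the quadratic ones add up to the variance
    \<open>v\<close>.\<close>
  have split_T: "of_real (1 - p) * T (u * (- p)) + of_real p * T (u * (1 - p)) = of_real (1 - u\<^sup>2 * v / 2)"
    by (simp add: T_def v_def complex_eq_iff field_simps power2_eq_square)
  have "(1 - of_real p + of_real p * iexp u) * iexp (- (u * p)) - of_real (1 - u\<^sup>2 * v / 2)
      = of_real (1 - p) * (iexp (u * (- p)) - T (u * (- p))) + of_real p * (iexp (u * (1 - p)) - T (u * (1 - p)))"
    by (simp only: split split_T[symmetric] right_diff_distrib add_diff_add)
  also have "cmod \<dots> \<le> (1 - p) * (\<bar>u\<bar> ^ 3 / 6) + p * (\<bar>u\<bar> ^ 3 / 6)"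
  proof (rule norm_triangle_le, rule add_mono)
    show "cmod (of_real (1 - p) * (iexp (u * (- p)) - T (u * (- p)))) \<le> (1 - p) * (\<bar>u\<bar> ^ 3 / 6)"
      unfolding norm_mult using order_trans[OF T b[of "-p"]] p by (intro mult_mono) (auto simp: simp del: of_real_diff)
    show "cmod (of_real p * (iexp (u * (1 - p)) - T (u * (1 - p)))) \<le> p * (\<bar>u\<bar> ^ 3 / 6)"
      unfolding norm_mult using order_trans[OF T b[of "1-p"]] p by (intro mult_mono) auto
  qed
  also have "\<dots> = \<bar>u\<bar> ^ 3 / 6" by (simp add: field_simps)
  finally have 1: "cmod ((1 - of_real p + of_real p * iexp u) * iexp (- (u * p)) - of_real (1 - u\<^sup>2 * v / 2))
    \<le> \<bar>u\<bar> ^ 3 / 6" .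
  define a where "a = u\<^sup>2 * v / 2"
  have a: "0 \<le> a" "a \<le> u\<^sup>2" 
    using v mult_left_le[of v "u\<^sup>2"] zero_le_power2[of u] unfolding a_def by (simp, linarith)
  have "\<bar>(1 - a) - exp (- a)\<bar> \<le> a\<^sup>2"
  proof -
    have "1 - a \<le> exp (- a)" using exp_ge_add_one_self[of "-a"] by simp
    moreover have "exp (- a) \<le> 1 - a + a\<^sup>2"
    proof -
      have "(1 + a) * exp (- a) \<le> 1"
        using exp_ge_add_one_self[of a] by (simp add: exp_minus field_simps)
      then have "exp (- a) \<le> 1 / (1 + a)" using a by (simp add: field_simps)
      also have "1 / (1 + a) \<le> 1 - a + a\<^sup>2"
        using a by (simp add: field_simps power2_eq_square)
      finally show ?thesis .
    qed
    ultimately show ?thesis by auto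
  qed
  also have "a\<^sup>2 \<le> u ^ 4"
    using power_mono[OF a(2,1), of 2] by (simp flip: power_mult)
  finally have 2: "cmod (of_real (1 - a) - of_real (exp (- a))) \<le> u ^ 4"
    by (metis norm_of_real of_real_diff real_norm_def)
  have "cmod ((1 - of_real p + of_real p * iexp u) * iexp (- (u * p)) - of_real (exp (- a)))
    \<le> \<bar>u\<bar> ^ 3 / 6 + u ^ 4"
    using norm_triangle_le[OF add_mono[OF 1 2]] by (simp add: a_def)
  also have "\<dots> \<le> \<bar>u\<bar> ^ 3 + u ^ 4" by simp
  finally show ?thesis unfolding a_def v_def .
qed

text \<open>Independent Bernoulli variables are never constructed: that the statistic
  \<open>d\<close> is distributed as their sum is encoded as an identity of generating functions. At
  z = 1 this identity also says that the weights \<open>w\<close> sum to 1.\<close>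

locale poisson_binomial =
  fixes A :: "'a set" and w :: "'a \<Rightarrow> real" and d :: "'a \<Rightarrow> nat" and K :: nat and p :: "nat \<Rightarrow> real"
  assumes finite_A: "finite A"
    and w_nonneg: "\<And>a. a \<in> A \<Longrightarrow> 0 \<le> w a"
    and p_range: "\<And>k. k < K \<Longrightarrow> 0 < p k \<and> p k < 1"
    and pgf: "\<And>z :: complex. (\<Sum>a\<in>A. of_real (w a) * z ^ d a)
      = (\<Prod>k<K. 1 - of_real (p k) + of_real (p k) * z)"
begin

lemma pgf_real: "(\<Sum>a\<in>A. w a * z ^ d a) = (\<Prod>k<K. 1 - p k + p k * z)" for z :: real
proof -
  have "of_real (\<Sum>a\<in>A. w a * z ^ d a) = (of_real (\<Prod>k<K. 1 - p k + p k * z) :: complex)"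
    using pgf[of "of_real z"] by simp
  then show ?thesis by (simp only: of_real_eq_iff)
qed

lemma sum_w: "(\<Sum>a\<in>A. w a) = 1"
  using pgf_real[of 1] by simp

lemma mgf_factor_pos: "k < K \<Longrightarrow> 1 - p k + p k * exp s > 0"
  using p_range[of k] by (smt (verit) exp_gt_zero mult_pos_pos)

lemma mgf: "(\<Sum>a\<in>A. w a * exp (s * real (d a))) = (\<Prod>k<K. 1 - p k + p k * exp s)"
  using pgf_real[of "exp s"] by (simp add: exp_of_nat2_mult)

lemma ln_mgf: "ln (\<Sum>a\<in>A. w a * exp (s * real (d a))) = (\<Sum>k<K. ln (1 - p k + p k * exp s))"
  unfolding mgf by (rule ln_prod) (simp, metis lessThan_iff less_irrefl mgf_factor_pos)

text \<open>The logarithm of the moment generating function \<open>f\<close> is a sum over the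
  factors, hence f' = f times the sum of the tilted probabilities \<open>q\<close>. At 0 this gives
  the mean; one more differentiation gives the second moment.\<close>

lemma mean: "(\<Sum>a\<in>A. w a * real (d a)) = (\<Sum>k<K. p k)" (is ?mean)
  and second_moment: "(\<Sum>a\<in>A. w a * (real (d a))\<^sup>2) = (\<Sum>k<K. p k)\<^sup>2 + (\<Sum>k<K. p k * (1 - p k))" (is ?snd)
proof -
  define f where "f = (\<lambda>s. \<Sum>a\<in>A. w a * exp (s * real (d a)))"
  define D where "D = (\<lambda>k s. 1 - p k + p k * exp s)"
  define q where "q = (\<lambda>k s. p k * exp s / D k s)"
  have D: "k < K \<Longrightarrow> D k s > 0" for k s using mgf_factor_pos by (simp add: D_def)
  have dD: "(D k has_real_derivative p k * exp s) (at s)" for k s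
    unfolding D_def by (auto intro!: derivative_eq_intros)
  have dq: "(q k has_real_derivative q k s * (1 - q k s)) (at s)" if "k < K" for k s
  proof -
    have "(q k has_real_derivative (p k * exp s * D k s - p k * exp s * (p k * exp s)) / (D k s * D k s)) (at s)"
      unfolding q_def using D[OF that, of s] by (auto intro!: derivative_eq_intros dD)
    also have "(p k * exp s * D k s - p k * exp s * (p k * exp s)) / (D k s * D k s) = q k s * (1 - q k s)"
      unfolding q_def using D[OF that, of s] by (simp add: field_simps)
    finally show ?thesis .
  qed
  have f_pos: "f s > 0" for s unfolding f_def mgf by (intro prod_pos) (auto simp: mgf_factor_pos)
  have ln_f: "ln (f s) = (\<Sum>k<K. ln (D k s))" for s
    unfolding f_def D_def by (rule ln_mgf)
  have df: "(f has_real_derivative (\<Sum>a\<in>A. w a * real (d a) * exp (s * real (d a)))) (at s)" for s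
    unfolding f_def by (auto intro!: derivative_eq_intros sum.cong)
  have ddf: "((\<lambda>s. \<Sum>a\<in>A. w a * real (d a) * exp (s * real (d a))) has_real_derivative
      (\<Sum>a\<in>A. w a * (real (d a))\<^sup>2 * exp (s * real (d a)))) (at s)" for s
    by (auto intro!: derivative_eq_intros sum.cong simp: power2_eq_square)
  have f': "(\<Sum>a\<in>A. w a * real (d a) * exp (s * real (d a))) = f s * (\<Sum>k<K. q k s)" for s
  proof -
    have "((\<lambda>s. ln (f s)) has_real_derivative (\<Sum>a\<in>A. w a * real (d a) * exp (s * real (d a))) / f s) (at s)"
      using f_pos[of s] by (auto intro!: derivative_eq_intros df)
    moreover have "((\<lambda>s. ln (f s)) has_real_derivative (\<Sum>k<K. q k s)) (at s)"
      unfolding ln_f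
    proof (rule DERIV_sum)
      fix k assume "k \<in> {..<K}"
      then show "((\<lambda>s. ln (D k s)) has_real_derivative q k s) (at s)"
        unfolding q_def using D[of k s] by (auto intro!: derivative_eq_intros dD)
    qed
    ultimately have "(\<Sum>a\<in>A. w a * real (d a) * exp (s * real (d a))) / f s = (\<Sum>k<K. q k s)"
      by (rule DERIV_unique)
    then show ?thesis using f_pos[of s] by (simp add: field_simps)
  qed
  have f0: "f 0 = 1" by (simp add: f_def sum_w)
  have q0: "q k 0 = p k" for k by (simp add: q_def D_def)
  show m: ?mean using f'[of 0] by (simp add: f0 q0)
  have "((\<lambda>s. f s * (\<Sum>k<K. q k s)) has_real_derivative
      (\<Sum>a\<in>A. w a * real (d a)) * (\<Sum>k<K. q k 0) + (\<Sum>k<K. q k 0 * (1 - q k 0)) * f 0) (at 0)"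
    by (rule DERIV_mult) (use df[of 0] in \<open>auto intro!: DERIV_sum dq\<close>)
  moreover have "((\<lambda>s. f s * (\<Sum>k<K. q k s)) has_real_derivative (\<Sum>a\<in>A. w a * (real (d a))\<^sup>2)) (at 0)"
    using ddf[of 0] unfolding f' by simp
  ultimately have "(\<Sum>a\<in>A. w a * (real (d a))\<^sup>2)
      = (\<Sum>a\<in>A. w a * real (d a)) * (\<Sum>k<K. q k 0) + (\<Sum>k<K. q k 0 * (1 - q k 0)) * f 0"
    by (rule DERIV_unique[rotated])
  then show ?snd by (simp add: m f0 q0 power2_eq_square)
qed

lemma variance:
  "(\<Sum>a\<in>A. w a * (real (d a))\<^sup>2) - (\<Sum>a\<in>A. w a * real (d a))\<^sup>2 = (\<Sum>k<K. p k * (1 - p k))"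
  by (simp add: second_moment mean)

lemma ln_mgf_second_difference:
  fixes \<delta> :: real
  assumes "\<delta> > 0"
  shows "\<bar>ln (\<Sum>a\<in>A. w a * exp (\<delta> * real (d a))) + ln (\<Sum>a\<in>A. w a * exp (- \<delta> * real (d a)))
    - \<delta>\<^sup>2 * ((\<Sum>a\<in>A. w a * (real (d a))\<^sup>2) - (\<Sum>a\<in>A. w a * real (d a))\<^sup>2)\<bar> \<le> K * \<delta> ^ 3"
proof -
  have "ln (\<Sum>a\<in>A. w a * exp (\<delta> * real (d a))) + ln (\<Sum>a\<in>A. w a * exp (- \<delta> * real (d a)))
      - \<delta>\<^sup>2 * ((\<Sum>a\<in>A. w a * (real (d a))\<^sup>2) - (\<Sum>a\<in>A. w a * real (d a))\<^sup>2)
    = (\<Sum>k<K. ln (1 - p k + p k * exp \<delta>) + ln (1 - p k + p k * exp (- \<delta>)) - \<delta>\<^sup>2 * (p k * (1 - p k)))"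
    unfolding ln_mgf mean second_moment by (simp add: sum_subtractf sum.distrib sum_distrib_left)
  also have "\<bar>\<dots>\<bar> \<le> (\<Sum>k<K. \<delta> ^ 3)"
    by (rule order_trans[OF sum_abs], rule sum_mono)
       (use p_range assms in \<open>auto intro!: ln_Bernoulli_mgf_second_difference\<close>)
  finally show ?thesis by simp
qed

text \<open>Both expressions are products of \<open>K\<close> factors of modulus at most 1, and two
  such products differ by at most the sum of the differences of their factors.\<close>

lemma char_approx:
  fixes u :: real
  shows "cmod ((\<Sum>a\<in>A. of_real (w a) * iexp (u * (real (d a) - (\<Sum>a\<in>A. w a * real (d a)))))
     - of_real (exp (- (u\<^sup>2 * ((\<Sum>a\<in>A. w a * (real (d a))\<^sup>2) - (\<Sum>a\<in>A. w a * real (d a))\<^sup>2) / 2))))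
    \<le> K * (\<bar>u\<bar> ^ 3 + u ^ 4)"
proof -
  have "(\<Sum>a\<in>A. of_real (w a) * iexp (u * (real (d a) - (\<Sum>k<K. p k))))
      = (\<Sum>a\<in>A. of_real (w a) * iexp u ^ d a) * iexp (- (\<Sum>k<K. u * p k))"
    unfolding sum_distrib_right
    by (intro sum.cong refl)
       (simp add: mult.assoc exp_add[symmetric] exp_of_nat_mult[symmetric] algebra_simps sum_distrib_left)
  also have "iexp (- (\<Sum>k<K. u * p k)) = (\<Prod>k<K. iexp (- (u * p k)))"
    by (simp add: exp_sum sum_negf[symmetric] sum_distrib_left del: sum_negf)
  finally have 1: "(\<Sum>a\<in>A. of_real (w a) * iexp (u * (real (d a) - (\<Sum>k<K. p k))))
      = (\<Prod>k<K. (1 - of_real (p k) + of_real (p k) * iexp u) * iexp (- (u * p k)))"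
    by (simp only: pgf prod.distrib)
  have "exp (- (u\<^sup>2 * (\<Sum>k<K. p k * (1 - p k)) / 2)) = (\<Prod>k<K. exp (- (u\<^sup>2 * (p k * (1 - p k)) / 2)))"
    by (simp add: exp_sum[symmetric] sum_negf sum_distrib_left sum_divide_distrib)
  then have 2: "of_real (exp (- (u\<^sup>2 * (\<Sum>k<K. p k * (1 - p k)) / 2)))
      = (\<Prod>k<K. of_real (exp (- (u\<^sup>2 * (p k * (1 - p k)) / 2))) :: complex)"
    by (simp only: of_real_prod)
  have "cmod ((\<Prod>k<K. (1 - of_real (p k) + of_real (p k) * iexp u) * iexp (- (u * p k)))
      - (\<Prod>k<K. of_real (exp (- (u\<^sup>2 * (p k * (1 - p k)) / 2)))))
    \<le> (\<Sum>k<K. cmod ((1 - of_real (p k) + of_real (p k) * iexp u) * iexp (- (u * p k))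
        - of_real (exp (- (u\<^sup>2 * (p k * (1 - p k)) / 2)))))"
  proof (rule norm_prod_diff)
    fix k assume "k \<in> {..<K}"
    then have k: "0 < p k" "p k < 1" using p_range by auto
    have "cmod (of_real (1 - p k) + of_real (p k) * iexp u) \<le> (1 - p k) + p k"
      using k by (intro norm_triangle_le add_mono) (auto simp: norm_mult simp del: of_real_diff)
    then show "cmod ((1 - of_real (p k) + of_real (p k) * iexp u) * iexp (- (u * p k))) \<le> 1"
      by (simp add: norm_mult)
    show "cmod (of_real (exp (- (u\<^sup>2 * (p k * (1 - p k)) / 2)))) \<le> 1"
      using k by simp
  qed
  also have "\<dots> \<le> (\<Sum>k<K. \<bar>u\<bar> ^ 3 + u ^ 4)"
    by (intro sum_mono Bernoulli_char_approx) (use p_range in auto)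
  finally show ?thesis
    unfolding variance unfolding mean 1 2 by (simp only: sum_constant card_lessThan)
qed

end

section \<open>Normal laws and the central limit theorem for arrays of Poisson binomial
  variables\<close>

text \<open>Scaling a standard normal variable by \<open>sqrt s\<close> covers the point mass at
  \<open>s = 0\<close> along with the densities, so the characteristic function needs no case
  distinction afterwards.\<close>

lemma normal_law_eq_distr:
  assumes "s \<ge> 0"
  shows "normal_law 0 s = distr std_normal_distribution borel (\<lambda>x. sqrt s * x)"
proof (cases "s = 0")
  case True
  interpret real_distribution std_normal_distribution by (rule real_dist_normal_dist)
  show ?thesis using True by (simp add: normal_law_def distr_const)
next
  case False
  interpret real_distribution std_normal_distribution by (rule real_dist_normal_dist)
  have "distributed std_normal_distribution lborel (\<lambda>x. x) std_normal_density"
    by (simp add: distributed_def distr_id2)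
  from normal_density_affine[OF this, of "sqrt s" 0]
  have "distributed std_normal_distribution lborel (\<lambda>x. sqrt s * x) (normal_density 0 (sqrt s))"
    using assms False by simp
  then have "distr std_normal_distribution lborel (\<lambda>x. sqrt s * x) = density lborel (normal_density 0 (sqrt s))"
    by (simp add: distributed_def)
  moreover have "distr std_normal_distribution lborel (\<lambda>x. sqrt s * x)
      = distr std_normal_distribution borel (\<lambda>x. sqrt s * x)"
    by (intro distr_cong) auto
  ultimately show ?thesis using False by (simp add: normal_law_def)
qed

lemma real_distribution_normal_law:
  assumes "s \<ge> 0"
  shows "real_distribution (normal_law 0 s)"
proof -
  interpret real_distribution std_normal_distribution by (rule real_dist_normal_dist)
  show ?thesis unfolding normal_law_eq_distr[OF assms] by (rule real_distribution_distr) simp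
qed

lemma char_normal_law:
  assumes "s \<ge> 0"
  shows "char (normal_law 0 s) t = of_real (exp (- (t\<^sup>2 * s / 2)))"
proof -
  have "char (normal_law 0 s) t = char std_normal_distribution (t * sqrt s)"
    unfolding normal_law_eq_distr[OF assms] char_def by (subst integral_distr) (auto simp: mult_ac)
  then show ?thesis
    using assms by (simp add: char_std_normal_distribution power_mult_distrib)
qed

text \<open>Levy's continuity theorem combined with \<open>char_approx\<close>. The scale
  \<open>b\<close> is prescribed instead of being a reciprocal standard deviation, which admits
  \<open>s = 0\<close> as well as negative scales. The assumption on \<open>K\<close> is of Lyapunov
  type: it controls the cubic error, and the quartic one is smaller by a factor |b|.\<close>

lemma poisson_binomial_clt:
  fixes A :: "nat \<Rightarrow> 'a set" and w :: "nat \<Rightarrow> 'a \<Rightarrow> real" and d :: "nat \<Rightarrow> 'a \<Rightarrow> nat"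
    and K :: "nat \<Rightarrow> nat" and p :: "nat \<Rightarrow> nat \<Rightarrow> real" and b :: "nat \<Rightarrow> real"
  assumes pb: "\<And>j. poisson_binomial (A j) (w j) (d j) (K j) (p j)"
  defines "mean \<equiv> \<lambda>j. \<Sum>a\<in>A j. w j a * real (d j a)"
  assumes Kb: "(\<lambda>j. real (K j) * \<bar>b j\<bar> ^ 3) \<longlonglongrightarrow> 0" and b: "b \<longlonglongrightarrow> 0"
    and var: "(\<lambda>j. (b j)\<^sup>2 * ((\<Sum>a\<in>A j. w j a * (real (d j a))\<^sup>2) - (mean j)\<^sup>2)) \<longlonglongrightarrow> s"
    and s: "s \<ge> 0"
    and \<phi>: "continuous_on UNIV \<phi>" "bounded (range \<phi>)"
  shows "(\<lambda>j. \<Sum>a\<in>A j. w j a * \<phi> (b j * (real (d j a) - mean j))) \<longlonglongrightarrow> (\<integral>y. \<phi> y \<partial>normal_law 0 s)"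
proof -
  define X where "X = (\<lambda>j a. b j * (real (d j a) - mean j))"
  define N where "N = (\<lambda>j. point_measure (A j) (\<lambda>a. ennreal (w j a)))"
  define \<mu> where "\<mu> = (\<lambda>j. distr (N j) borel (X j))"
  have X_meas: "X j \<in> borel_measurable (N j)" for j
    by (simp add: N_def)
  have integral: "(\<integral>y. f y \<partial>\<mu> j) = (\<Sum>a\<in>A j. w j a *\<^sub>R f (X j a))"
    if "f \<in> borel_measurable borel" for f :: "real \<Rightarrow> 'c::{banach, second_countable_topology}" and j
  proof -
    interpret poisson_binomial "A j" "w j" "d j" "K j" "p j" by (rule pb)
    show ?thesis
      unfolding \<mu>_def using that X_meas finite_A w_nonneg
      by (subst integral_distr) (auto simp: N_def intro!: lebesgue_integral_point_measure_finite)
  qed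
  have real_distr: "real_distribution (\<mu> j)" for j
  proof -
    interpret poisson_binomial "A j" "w j" "d j" "K j" "p j" by (rule pb)
    have "emeasure (N j) (space (N j)) = (\<Sum>a\<in>A j. ennreal (w j a))"
      using finite_A by (simp add: N_def space_point_measure emeasure_point_measure_finite)
    also have "\<dots> = 1" using w_nonneg sum_w by (simp add: sum_ennreal)
    finally interpret prob_space "N j" by (rule prob_spaceI)
    show ?thesis unfolding \<mu>_def by (intro real_distribution_distr X_meas)
  qed
  have char_conv: "(\<lambda>j. char (\<mu> j) t) \<longlonglongrightarrow> char (normal_law 0 s) t" for t
  proof -
    define V where "V = (\<lambda>j. (\<Sum>a\<in>A j. w j a * (real (d j a))\<^sup>2) - (mean j)\<^sup>2)"
    define e where "e = (\<lambda>j. of_real (exp (- ((t * b j)\<^sup>2 * V j / 2))) :: complex)"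
    have bound: "cmod (char (\<mu> j) t - e j) \<le> K j * (\<bar>t * b j\<bar> ^ 3 + (t * b j) ^ 4)" for j
    proof -
      interpret poisson_binomial "A j" "w j" "d j" "K j" "p j" by (rule pb)
      have eq: "char (\<mu> j) t = (\<Sum>a\<in>A j. of_real (w j a) * iexp (t * b j * (real (d j a) - mean j)))"
        unfolding char_def by (subst integral) (auto simp: X_def scaleR_conv_of_real mult_ac)
      show ?thesis
        unfolding eq e_def V_def mean_def by (rule char_approx)
    qed
    have "(\<lambda>j. \<bar>t\<bar> ^ 3 * (K j * \<bar>b j\<bar> ^ 3) + \<bar>t\<bar> ^ 4 * ((K j * \<bar>b j\<bar> ^ 3) * \<bar>b j\<bar>))
        \<longlonglongrightarrow> \<bar>t\<bar> ^ 3 * 0 + \<bar>t\<bar> ^ 4 * (0 * \<bar>0\<bar>)"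
      by (intro tendsto_intros Kb b)
    moreover have "\<bar>t\<bar> ^ 3 * (K j * \<bar>b j\<bar> ^ 3) + \<bar>t\<bar> ^ 4 * ((K j * \<bar>b j\<bar> ^ 3) * \<bar>b j\<bar>)
        = K j * (\<bar>t * b j\<bar> ^ 3 + (t * b j) ^ 4)" for j
    proof -
      have "\<bar>t * b j\<bar> ^ 3 = \<bar>t\<bar> ^ 3 * \<bar>b j\<bar> ^ 3" "(t * b j) ^ 4 = \<bar>t\<bar> ^ 4 * (\<bar>b j\<bar> ^ 3 * \<bar>b j\<bar>)"
        by (simp_all only: abs_mult power_mult_distrib power_even_abs_numeral[symmetric]
            power_Suc2[symmetric]) simp_all
      then show ?thesis by (simp only: distrib_left mult_ac)
    qed
    ultimately have "(\<lambda>j. K j * (\<bar>t * b j\<bar> ^ 3 + (t * b j) ^ 4)) \<longlonglongrightarrow> 0"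
      by simp
    then have "(\<lambda>j. char (\<mu> j) t - e j) \<longlonglongrightarrow> 0"
      by (rule Lim_null_comparison[rotated]) (simp add: bound)
    moreover have "e \<longlonglongrightarrow> of_real (exp (- (t\<^sup>2 * s / 2)))"
    proof -
      have "(\<lambda>j. of_real (exp (- (t\<^sup>2 * ((b j)\<^sup>2 * V j) / 2))) :: complex) \<longlonglongrightarrow> of_real (exp (- (t\<^sup>2 * s / 2)))"
        using var unfolding V_def by (intro tendsto_intros) auto
      then show ?thesis by (simp add: e_def power_mult_distrib mult.assoc)
    qed
    ultimately show ?thesis
      unfolding char_normal_law[OF s] by (rule Lim_transform[rotated])
  qed
  have weak: "weak_conv_m \<mu> (normal_law 0 s)"
    by (rule levy_continuity[OF real_distr real_distribution_normal_law[OF s] char_conv])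
  obtain C where C: "\<And>x. norm (\<phi> x) \<le> C"
    using \<phi>(2) by (auto simp: bounded_iff)
  have "(\<lambda>j. \<integral>y. \<phi> y \<partial>\<mu> j) \<longlonglongrightarrow> (\<integral>y. \<phi> y \<partial>normal_law 0 s)"
    by (rule weak_conv_imp_integral_bdd_continuous_conv[OF real_distr real_distribution_normal_law[OF s] weak _ C])
       (use \<phi>(1) in \<open>simp add: continuous_on_eq_continuous_at\<close>)
  then show ?thesis
    using \<phi>(1) by (simp add: integral borel_measurable_continuous_onI X_def)
qed

section \<open>A Cauchy criterion for convergence in probability to a constant\<close>

text \<open>Variables with different indices may live on different spaces, so the Cauchy property is
  phrased through constants: for every accuracy some constant is eventually close to
  \<open>X n\<close> with high probability. Constants for different accuracies must be close to each
  other, and their limit is the limit of \<open>X\<close>.\<close>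

lemma converges_in_probability_Cauchy:
  fixes X :: "nat \<Rightarrow> 'a \<Rightarrow> real"
  assumes prob: "\<And>n. n \<ge> 1 \<Longrightarrow> prob_space (M n)"
    and meas: "\<And>n. n \<ge> 1 \<Longrightarrow> X n \<in> borel_measurable (M n)"
    and approx: "\<And>\<eta>. \<eta> > 0 \<Longrightarrow> \<exists>c. \<forall>\<^sub>F n in sequentially. measure (M n) {x\<in>space (M n). \<bar>X n x - c\<bar> > \<eta>} \<le> \<eta>"
  shows "\<exists>c. converges_in_probability M X c"
proof -
  \<comment> \<open>As \<open>e j\<close> is at most 1/3, two exceptional events have total
    probability at most 2/3. Some point lies outside both, and there \<open>X n\<close> compares
    \<open>c i\<close> with \<open>c j\<close>.\<close>
  define e where "e = (\<lambda>j::nat. 1 / (real j + 3))"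
  have e: "e j > 0" "e j \<le> 1/3" for j by (auto simp: e_def field_simps)
  have e0: "e \<longlonglongrightarrow> 0" unfolding e_def by real_asymp
  have "\<exists>c. \<forall>j. \<forall>\<^sub>F n in sequentially. measure (M n) {x\<in>space (M n). \<bar>X n x - c j\<bar> > e j} \<le> e j"
    by (intro choice allI approx e(1))
  then obtain c where c: "\<And>j. \<forall>\<^sub>F n in sequentially. measure (M n) {x\<in>space (M n). \<bar>X n x - c j\<bar> > e j} \<le> e j"
    by blast
  have close: "\<bar>c i - c j\<bar> \<le> e i + e j" for i j
  proof -
    have "\<forall>\<^sub>F n in sequentially. \<bar>c i - c j\<bar> \<le> e i + e j"
      using c[of i] c[of j] eventually_ge_at_top[of 1]
    proof eventually_elim
      case (elim n)
      interpret prob_space "M n" by (rule prob[OF elim(3)])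
      have [measurable]: "X n \<in> borel_measurable (M n)" by (rule meas[OF elim(3)])
      show ?case
      proof (rule ccontr)
        assume far: "\<not> \<bar>c i - c j\<bar> \<le> e i + e j"
        have "1 = prob (space (M n))" by (simp add: prob_space)
        also have "\<dots> \<le> prob ({x\<in>space (M n). \<bar>X n x - c i\<bar> > e i} \<union> {x\<in>space (M n). \<bar>X n x - c j\<bar> > e j})"
          using far by (intro finite_measure_mono) auto
        also have "\<dots> \<le> prob {x\<in>space (M n). \<bar>X n x - c i\<bar> > e i} + prob {x\<in>space (M n). \<bar>X n x - c j\<bar> > e j}"
          by (intro measure_Un_le) auto
        also have "\<dots> \<le> 1/3 + 1/3" using elim e(2) by (meson add_mono order_trans)
        finally show False by simp
      qed
    qed
    then show ?thesis by simp
  qed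
  have "Cauchy c"
  proof (rule metric_CauchyI)
    fix r :: real assume "r > 0"
    then have "\<forall>\<^sub>F j in sequentially. e j < r / 2" using e0 by (intro order_tendstoD) auto
    then obtain N where "\<And>j. j \<ge> N \<Longrightarrow> e j < r / 2" by (auto simp: eventually_sequentially)
    then show "\<exists>N. \<forall>i\<ge>N. \<forall>j\<ge>N. dist (c i) (c j) < r"
      using close by (intro exI[of _ N]) (smt (verit) dist_real_def field_sum_of_halves)
  qed
  then obtain L where L: "c \<longlonglongrightarrow> L" using Cauchy_convergent convergent_def by blast
  have cL: "\<bar>c j - L\<bar> \<le> e j" for j
  proof (rule LIMSEQ_le)
    show "(\<lambda>i. \<bar>c j - c i\<bar>) \<longlonglongrightarrow> \<bar>c j - L\<bar>" by (intro tendsto_intros L)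
    show "(\<lambda>i. e j + e i) \<longlonglongrightarrow> e j" using tendsto_add[OF tendsto_const e0, of "e j"] by simp
    show "\<exists>N. \<forall>n\<ge>N. \<bar>c j - c n\<bar> \<le> e j + e n" using close by auto
  qed
  have "converges_in_probability M X L"
    unfolding converges_in_probability_def
  proof (intro allI impI)
    fix \<delta> :: real assume \<delta>: "\<delta> > 0"
    show "(\<lambda>n. measure (M n) {x\<in>space (M n). \<bar>X n x - L\<bar> > \<delta>}) \<longlonglongrightarrow> 0"
    proof (rule order_tendstoI)
      fix r :: real assume r: "0 < r"
      have "\<forall>\<^sub>F j in sequentially. e j < min (\<delta> / 2) r"
        using e0 \<delta> r by (intro order_tendstoD) auto
      then obtain j where j: "e j < \<delta> / 2" "e j < r"
        using eventually_happens' sequentially_bot by fastforce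
      show "\<forall>\<^sub>F n in sequentially. measure (M n) {x\<in>space (M n). \<bar>X n x - L\<bar> > \<delta>} < r"
        using c[of j] eventually_ge_at_top[of 1]
      proof eventually_elim
        case (elim n)
        interpret prob_space "M n" by (rule prob[OF elim(2)])
        have [measurable]: "X n \<in> borel_measurable (M n)" by (rule meas[OF elim(2)])
        have "prob {x\<in>space (M n). \<bar>X n x - L\<bar> > \<delta>} \<le> prob {x\<in>space (M n). \<bar>X n x - c j\<bar> > e j}"
          using j(1) cL[of j] by (intro finite_measure_mono) auto
        with elim(1) j(2) show ?case by linarith
      qed
    next
      fix r :: real assume "r < 0"
      then show "\<forall>\<^sub>F n in sequentially. r < measure (M n) {x\<in>space (M n). \<bar>X n x - L\<bar> > \<delta>}"
        by (intro always_eventually allI) (meson less_le_trans measure_nonneg)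
    qed
  qed
  then show ?thesis by blast
qed

section \<open>Law of large numbers for the free energy\<close>

lemma borel_measurable_hamiltonian:
  assumes "\<And>v. v \<in> V \<Longrightarrow> \<nu> v \<in> borel_measurable N" "\<And>e. e \<in> E \<Longrightarrow> \<omega> e \<in> borel_measurable N"
    and "m \<in> matchings E"
  shows "(\<lambda>x. hamiltonian V (\<lambda>v. \<nu> v x) (\<lambda>e. \<omega> e x) m) \<in> borel_measurable N"
  unfolding hamiltonian_def using assms
  by (intro borel_measurable_add borel_measurable_sum) (auto simp: unpaired_def matchings_def)

lemma borel_measurable_partition_function:
  assumes "\<And>v. v \<in> V \<Longrightarrow> \<nu> v \<in> borel_measurable N" "\<And>e. e \<in> E \<Longrightarrow> \<omega> e \<in> borel_measurable N"
  shows "(\<lambda>x. partition_function V E (\<lambda>v. \<nu> v x) (\<lambda>e. \<omega> e x)) \<in> borel_measurable N"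
  unfolding partition_function_def
  by (intro borel_measurable_sum borel_measurable_exp[THEN measurable_compose[rotated]]
      borel_measurable_hamiltonian[OF assms])

lemma borel_measurable_free_energy:
  assumes "\<And>v. v \<in> V \<Longrightarrow> \<nu> v \<in> borel_measurable N" "\<And>e. e \<in> E \<Longrightarrow> \<omega> e \<in> borel_measurable N"
  shows "(\<lambda>x. free_energy V E (\<lambda>v. \<nu> v x) (\<lambda>e. \<omega> e x)) \<in> borel_measurable N"
  unfolding free_energy_def
  by (intro borel_measurable_ln borel_measurable_partition_function assms)

lemma borel_measurable_gibbs_average:
  assumes "\<And>v. v \<in> V \<Longrightarrow> \<nu> v \<in> borel_measurable N" "\<And>e. e \<in> E \<Longrightarrow> \<omega> e \<in> borel_measurable N"
  shows "(\<lambda>x. gibbs_average V E (\<lambda>v. \<nu> v x) (\<lambda>e. \<omega> e x) X) \<in> borel_measurable N"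
  unfolding gibbs_average_def gibbs_weight_def
  by (intro borel_measurable_sum borel_measurable_times borel_measurable_divide borel_measurable_const
      borel_measurable_exp[THEN measurable_compose[rotated]] borel_measurable_hamiltonian[OF assms]
      borel_measurable_partition_function assms)

text \<open>The centred variables are pairwise uncorrelated, so only the diagonal terms of the
  squared sum contribute. The variables enter through their first two moments alone, which are the
  only features of a block that have to be transferred between spaces.\<close>

lemma (in prob_space) indep_sum_second_moment:
  fixes Y :: "'i \<Rightarrow> 'a \<Rightarrow> real" and m s :: real
  assumes J: "finite J" and indep: "indep_vars (\<lambda>_. borel) Y J"
    and sq: "\<And>j. j \<in> J \<Longrightarrow> integrable M (\<lambda>x. (Y j x)\<^sup>2)"
    and m: "\<And>j. j \<in> J \<Longrightarrow> expectation (Y j) = m"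
    and s: "\<And>j. j \<in> J \<Longrightarrow> expectation (\<lambda>x. (Y j x)\<^sup>2) = s"
  shows "integrable M (\<lambda>x. ((\<Sum>j\<in>J. Y j x) - card J * m)\<^sup>2)"
    and "expectation (\<lambda>x. ((\<Sum>j\<in>J. Y j x) - card J * m)\<^sup>2) = card J * (s - m\<^sup>2)"
proof -
  define X where "X = (\<lambda>j x. Y j x - m)"
  have rv: "random_variable borel (Y j)" if "j \<in> J" for j
    using indep that by (simp add: indep_vars_def)
  have int_Y: "integrable M (Y j)" if "j \<in> J" for j
    using square_integrable_imp_integrable[OF rv sq] that by blast
  have int_X: "integrable M (X j)" if "j \<in> J" for j
    unfolding X_def using int_Y[OF that] by simp
  have EX: "expectation (X j) = 0" if "j \<in> J" for j
    unfolding X_def using int_Y[OF that] m[OF that] by (simp add: prob_space)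
  have indep_X: "indep_vars (\<lambda>_. borel) X J"
    unfolding X_def by (rule indep_vars_compose2[OF indep]) simp
  have prod: "integrable M (\<lambda>x. X i x * X j x)
      \<and> expectation (\<lambda>x. X i x * X j x) = (if i = j then s - m\<^sup>2 else 0)"
    if ij: "i \<in> J" "j \<in> J" for i j
  proof (cases "i = j")
    case True
    have eq: "(\<lambda>x. X j x * X j x) = (\<lambda>x. (Y j x)\<^sup>2 - 2 * m * Y j x + m\<^sup>2)"
      by (auto simp: X_def power2_eq_square algebra_simps)
    show ?thesis
      unfolding True eq using sq[OF ij(2)] int_Y[OF ij(2)] m[OF ij(2)] s[OF ij(2)]
      by (simp add: prob_space power2_eq_square)
  next
    case False
    have ind: "indep_vars (\<lambda>_. borel) X {i, j}"
      by (rule indep_vars_subset[OF indep_X]) (use ij in auto)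
    have int: "integrable M (X l)" if "l \<in> {i, j}" for l using int_X ij that by auto
    have "integrable M (\<lambda>x. \<Prod>l\<in>{i, j}. X l x)"
      by (rule indep_vars_integrable[OF _ ind int]) simp
    moreover have "expectation (\<lambda>x. \<Prod>l\<in>{i, j}. X l x) = (\<Prod>l\<in>{i, j}. expectation (X l))"
      by (rule indep_vars_lebesgue_integral[OF _ ind int]) simp
    ultimately show ?thesis using False EX ij by simp
  qed
  have eq: "(\<lambda>x. ((\<Sum>j\<in>J. Y j x) - card J * m)\<^sup>2) = (\<lambda>x. \<Sum>i\<in>J. \<Sum>j\<in>J. X i x * X j x)"
  proof
    fix x
    have "(\<Sum>j\<in>J. Y j x) - card J * m = (\<Sum>j\<in>J. X j x)" by (simp add: X_def sum_subtractf)
    then show "((\<Sum>j\<in>J. Y j x) - card J * m)\<^sup>2 = (\<Sum>i\<in>J. \<Sum>j\<in>J. X i x * X j x)"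
      by (simp add: power2_eq_square sum_product)
  qed
  show "integrable M (\<lambda>x. ((\<Sum>j\<in>J. Y j x) - card J * m)\<^sup>2)"
    unfolding eq using prod by (intro Bochner_Integration.integrable_sum) blast
  have "expectation (\<lambda>x. \<Sum>i\<in>J. \<Sum>j\<in>J. X i x * X j x) = (\<Sum>i\<in>J. \<Sum>j\<in>J. if i = j then s - m\<^sup>2 else 0)"
    using prod by (simp add: Bochner_Integration.integral_sum)
  also have "\<dots> = card J * (s - m\<^sup>2)" using J by simp
  finally show "expectation (\<lambda>x. ((\<Sum>j\<in>J. Y j x) - card J * m)\<^sup>2) = card J * (s - m\<^sup>2)"
    unfolding eq .
qed

section \<open>Random weights on a graph: integrability, laws and independence of block free
  energies\<close>

text \<open>Computed on a product of copies of \<open>P\<close> and \<open>Q\<close>, hence a number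
  that depends only on the graph and the two laws. It is the same for all spaces \<open>M n\<close>
  and all translates of a block, so it can serve in a limit that does not involve n.\<close>

definition free_energy_moment ::
    "real measure \<Rightarrow> real measure \<Rightarrow> 'v set \<Rightarrow> 'v set set \<Rightarrow> nat \<Rightarrow> real" where
  "free_energy_moment P Q V E r =
     (\<integral>y. (free_energy V E (\<lambda>v. y (Inl v)) (\<lambda>e. y (Inr e))) ^ r
        \<partial>Pi\<^sub>M (V <+> E) (case_sum (\<lambda>_. P) (\<lambda>_. Q)))"

text \<open>Vertex and edge weights form one family over the disjoint sum \<open>V <+> E\<close>; a
  single independence statement then covers independence within each kind and between the two
  kinds.\<close>

locale weighted_graph = prob_space M for M :: "'a measure" +
  fixes V :: "'v set" and E :: "'v set set"
    and \<nu> :: "'v \<Rightarrow> 'a \<Rightarrow> real" and \<omega> :: "'v set \<Rightarrow> 'a \<Rightarrow> real" and P Q :: "real measure"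
  assumes graph: "finite_simple_graph V E"
    and indep: "indep_vars (\<lambda>_. borel) (case_sum \<nu> \<omega>) (V <+> E)"
    and vertex_law: "\<And>v. v \<in> V \<Longrightarrow> distr M borel (\<nu> v) = P"
    and edge_law: "\<And>e. e \<in> E \<Longrightarrow> distr M borel (\<omega> e) = Q"
    and vertex_sq: "integrable P (\<lambda>t. t\<^sup>2)" and edge_sq: "integrable Q (\<lambda>t. t\<^sup>2)"
begin

lemma rv_vertex: "v \<in> V \<Longrightarrow> random_variable borel (\<nu> v)"
  using indep by (auto simp: indep_vars_def dest!: bspec[of _ _ "Inl v"])

lemma rv_edge: "e \<in> E \<Longrightarrow> random_variable borel (\<omega> e)"
  using indep by (auto simp: indep_vars_def dest!: bspec[of _ _ "Inr e"])

lemma vertex_square_integrable: "v \<in> V \<Longrightarrow> integrable M (\<lambda>x. (\<nu> v x)\<^sup>2)"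
  using integrable_distr[OF rv_vertex, of v "\<lambda>t. t\<^sup>2"] vertex_sq by (simp add: vertex_law)

lemma edge_square_integrable: "e \<in> E \<Longrightarrow> integrable M (\<lambda>x. (\<omega> e x)\<^sup>2)"
  using integrable_distr[OF rv_edge, of e "\<lambda>t. t\<^sup>2"] edge_sq by (simp add: edge_law)

lemma vertex_abs_integrable: "v \<in> V \<Longrightarrow> integrable M (\<lambda>x. \<bar>\<nu> v x\<bar>)"
  using square_integrable_imp_integrable[OF rv_vertex vertex_square_integrable] by simp

lemma edge_abs_integrable: "e \<in> E \<Longrightarrow> integrable M (\<lambda>x. \<bar>\<omega> e x\<bar>)"
  using square_integrable_imp_integrable[OF rv_edge edge_square_integrable] by simp

lemma vertex_abs_expectation: "v \<in> V \<Longrightarrow> expectation (\<lambda>x. \<bar>\<nu> v x\<bar>) = (\<integral>t. \<bar>t\<bar> \<partial>P)"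
  using integral_distr[OF rv_vertex, of v "\<lambda>t. \<bar>t\<bar>"] by (simp add: vertex_law)

lemma edge_abs_expectation: "e \<in> E \<Longrightarrow> expectation (\<lambda>x. \<bar>\<omega> e x\<bar>) = (\<integral>t. \<bar>t\<bar> \<partial>Q)"
  using integral_distr[OF rv_edge, of e "\<lambda>t. \<bar>t\<bar>"] by (simp add: edge_law)

lemma edge_subset: "e \<in> E \<Longrightarrow> e \<subseteq> V" and edge_card: "e \<in> E \<Longrightarrow> card e = 2"
  using graph by (auto simp: finite_simple_graph_def)

lemma edge_cost_integrable:
  assumes "e \<in> E"
  shows "integrable M (\<lambda>x. edge_cost (\<lambda>v. \<nu> v x) (\<lambda>e. \<omega> e x) e)"
    and "expectation (\<lambda>x. edge_cost (\<lambda>v. \<nu> v x) (\<lambda>e. \<omega> e x) e)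
      = ln 2 + (\<integral>t. \<bar>t\<bar> \<partial>Q) + 2 * (\<integral>t. \<bar>t\<bar> \<partial>P)"
proof -
  have v: "integrable M (\<lambda>x. \<bar>\<nu> v x\<bar>)" "expectation (\<lambda>x. \<bar>\<nu> v x\<bar>) = (\<integral>t. \<bar>t\<bar> \<partial>P)" if "v \<in> e" for v
    using edge_subset[OF assms] that vertex_abs_integrable vertex_abs_expectation by auto
  show "integrable M (\<lambda>x. edge_cost (\<lambda>v. \<nu> v x) (\<lambda>e. \<omega> e x) e)"
    unfolding edge_cost_def using v edge_abs_integrable[OF assms]
    by (intro Bochner_Integration.integrable_add Bochner_Integration.integrable_sum) auto
  show "expectation (\<lambda>x. edge_cost (\<lambda>v. \<nu> v x) (\<lambda>e. \<omega> e x) e)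
      = ln 2 + (\<integral>t. \<bar>t\<bar> \<partial>Q) + 2 * (\<integral>t. \<bar>t\<bar> \<partial>P)"
    unfolding edge_cost_def using v edge_abs_integrable[OF assms] edge_abs_expectation[OF assms]
    by (simp add: prob_space edge_card[OF assms] Bochner_Integration.integral_sum)
qed

text \<open>\<open>free_energy_bound\<close> dominates the free energy by a finite sum of square
  integrable terms, and finite sums stay square integrable by (f + g)^2 \<le> 2 f^2 + 2 g^2.\<close>

lemma free_energy_square_integrable:
  assumes "finite_simple_graph V' E'" "V' \<subseteq> V" "E' \<subseteq> E"
  shows "integrable M (\<lambda>x. (free_energy V' E' (\<lambda>v. \<nu> v x) (\<lambda>e. \<omega> e x))\<^sup>2)"
proof -
  have add: "integrable M (\<lambda>x. (f x + g x)\<^sup>2)"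
    if "f \<in> borel_measurable M" "g \<in> borel_measurable M"
      "integrable M (\<lambda>x. (f x)\<^sup>2)" "integrable M (\<lambda>x. (g x)\<^sup>2)" for f g :: "'a \<Rightarrow> real"
  proof (rule Bochner_Integration.integrable_bound)
    show "integrable M (\<lambda>x. 2 * (f x)\<^sup>2 + 2 * (g x)\<^sup>2)" using that by simp
    show "AE x in M. norm ((f x + g x)\<^sup>2) \<le> norm (2 * (f x)\<^sup>2 + 2 * (g x)\<^sup>2)"
    proof (rule AE_I2)
      fix x
      have "0 \<le> (f x - g x)\<^sup>2" by simp
      then have "(f x + g x)\<^sup>2 \<le> 2 * (f x)\<^sup>2 + 2 * (g x)\<^sup>2"
        by (simp add: power2_eq_square algebra_simps)
      then show "norm ((f x + g x)\<^sup>2) \<le> norm (2 * (f x)\<^sup>2 + 2 * (g x)\<^sup>2)"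
        by (metis abs_ge_self abs_of_nonneg order_trans real_norm_def zero_le_power2)
    qed
  qed (use that in measurable)
  have sum: "integrable M (\<lambda>x. (\<Sum>i\<in>I. f i x)\<^sup>2)"
    if "finite I" "\<And>i. i \<in> I \<Longrightarrow> f i \<in> borel_measurable M" "\<And>i. i \<in> I \<Longrightarrow> integrable M (\<lambda>x. (f i x)\<^sup>2)"
    for I and f :: "'i \<Rightarrow> 'a \<Rightarrow> real"
    using that by (induction I rule: finite_induct) (auto intro!: add)
  have fin: "finite V'" "finite E'"
    using assms(1) finite_simple_graph_finite_edges by (auto simp: finite_simple_graph_def)
  have rv: "v \<in> V' \<Longrightarrow> (\<lambda>x. \<bar>\<nu> v x\<bar>) \<in> borel_measurable M"
    "e \<in> E' \<Longrightarrow> (\<lambda>x. \<bar>\<omega> e x\<bar>) \<in> borel_measurable M" for v e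
    using rv_vertex rv_edge assms(2,3) by (auto intro!: borel_measurable_abs)
  have sqv: "v \<in> V' \<Longrightarrow> integrable M (\<lambda>x. \<bar>\<nu> v x\<bar>\<^sup>2)" for v
    using vertex_square_integrable assms(2) by auto
  have sqe: "e \<in> E' \<Longrightarrow> integrable M (\<lambda>x. \<bar>\<omega> e x\<bar>\<^sup>2)" for e
    using edge_square_integrable assms(3) by auto
  have sub: "e \<subseteq> V'" "finite e" if "e \<in> E'" for e
    using assms(1) that finite_subset[OF _ fin(1)] by (auto simp: finite_simple_graph_def)
  have cost: "(\<lambda>x. edge_cost (\<lambda>v. \<nu> v x) (\<lambda>e. \<omega> e x) e) \<in> borel_measurable M"
    "integrable M (\<lambda>x. (edge_cost (\<lambda>v. \<nu> v x) (\<lambda>e. \<omega> e x) e)\<^sup>2)" if e: "e \<in> E'" for e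
  proof -
    have m: "(\<lambda>x. \<Sum>v\<in>e. \<bar>\<nu> v x\<bar>) \<in> borel_measurable M"
      using sub[OF e] rv by (intro borel_measurable_sum) auto
    have "integrable M (\<lambda>x. (\<Sum>v\<in>e. \<bar>\<nu> v x\<bar>)\<^sup>2)"
      using sub[OF e] rv sqv by (intro sum) auto
    then show "integrable M (\<lambda>x. (edge_cost (\<lambda>v. \<nu> v x) (\<lambda>e. \<omega> e x) e)\<^sup>2)"
      unfolding edge_cost_def using rv(2)[OF e] sqe[OF e] m
      by (intro add borel_measurable_add) auto
    show "(\<lambda>x. edge_cost (\<lambda>v. \<nu> v x) (\<lambda>e. \<omega> e x) e) \<in> borel_measurable M"
      unfolding edge_cost_def using rv(2)[OF e] m by (intro borel_measurable_add) auto
  qed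
  define B where "B = (\<lambda>x. (\<Sum>v\<in>V'. \<bar>\<nu> v x\<bar>) + (\<Sum>e\<in>E'. edge_cost (\<lambda>v. \<nu> v x) (\<lambda>e. \<omega> e x) e))"
  show ?thesis
  proof (rule Bochner_Integration.integrable_bound)
    show "integrable M (\<lambda>x. (B x)\<^sup>2)"
      unfolding B_def using fin rv(1) sqv cost by (intro add sum borel_measurable_sum) auto
    show "(\<lambda>x. (free_energy V' E' (\<lambda>v. \<nu> v x) (\<lambda>e. \<omega> e x))\<^sup>2) \<in> borel_measurable M"
      using assms rv_vertex rv_edge by (intro borel_measurable_power borel_measurable_free_energy) auto
    show "AE x in M. norm ((free_energy V' E' (\<lambda>v. \<nu> v x) (\<lambda>e. \<omega> e x))\<^sup>2) \<le> norm ((B x)\<^sup>2)"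
    proof (rule AE_I2)
      fix x
      have "\<bar>free_energy V' E' (\<lambda>v. \<nu> v x) (\<lambda>e. \<omega> e x)\<bar> \<le> \<bar>B x\<bar>"
        unfolding B_def using free_energy_bound[OF assms(1)] by (rule order_trans) simp
      then show "norm ((free_energy V' E' (\<lambda>v. \<nu> v x) (\<lambda>e. \<omega> e x))\<^sup>2) \<le> norm ((B x)\<^sup>2)"
        by (simp add: abs_le_square_iff)
    qed
  qed
qed

text \<open>By independence the joint law of all weights is a product measure, and reading off the
  coordinates selected by the injective map \<open>T\<close> gives a product measure again. So an
  embedded copy of a graph has the moments of the original.\<close>

lemma free_energy_moment_image:
  assumes f: "inj f" and sub: "f ` V' \<subseteq> V" "(`) f ` E' \<subseteq> E" and V': "V' \<noteq> {}"
  shows "expectation (\<lambda>x. (free_energy (f ` V') ((`) f ` E') (\<lambda>v. \<nu> v x) (\<lambda>e. \<omega> e x)) ^ r)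
    = free_energy_moment P Q V' E' r"
proof -
  define K where "K = V <+> E"
  define I where "I = V' <+> E'"
  define w where "w = case_sum \<nu> \<omega>"
  define R where "R = case_sum (\<lambda>_::'v. P) (\<lambda>_::'v set. Q)"
  define R' where "R' = case_sum (\<lambda>_::'b. P) (\<lambda>_::'b set. Q)"
  define T where "T = map_sum f ((`) f)"
  define F where "F = (\<lambda>y. (free_energy V' E' (\<lambda>v. y (Inl v)) (\<lambda>e. y (Inr e))) ^ r)"
  have R: "distr M borel (w i) = R i" if "i \<in> K" for i
    using that vertex_law edge_law by (auto simp: K_def w_def R_def)
  have rv: "random_variable borel (w i)" if "i \<in> K" for i
    using that rv_vertex rv_edge by (auto simp: K_def w_def)
  have T: "T i \<in> K" "R (T i) = R' i" if "i \<in> I" for i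
    using that sub by (auto simp: I_def K_def T_def R_def R'_def)
  have injT: "inj_on T I"
  proof -
    have "inj ((`) f)" using f by (auto simp: inj_image_eq_iff inj_on_def)
    with f have "inj T" unfolding T_def by (rule sum.inj_map)
    then show ?thesis by (rule inj_on_subset) simp
  qed
  have ne: "K \<noteq> {}" using V' sub(1) by (auto simp: K_def)
  have prob_R: "prob_space (R i)" if "i \<in> K" for i
    using R[OF that] prob_space_distr[OF rv[OF that]] by simp
  have sets_R: "sets (R i) = sets borel" if "i \<in> K" for i
    using R[OF that] by (metis sets_distr)
  have law: "distr M (Pi\<^sub>M K (\<lambda>_. borel)) (\<lambda>x. \<lambda>i\<in>K. w i x) = Pi\<^sub>M K R"
    using indep_vars_iff_distr_eq_PiM'[where M' = "\<lambda>_. borel" and X = w, OF ne] rv indep R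
    unfolding K_def[symmetric] w_def[symmetric] by (simp cong: PiM_cong)
  have "distr (Pi\<^sub>M K R) (\<Pi>\<^sub>M i\<in>I. R (T i)) (\<lambda>y. \<lambda>i\<in>I. y (T i)) = (\<Pi>\<^sub>M i\<in>I. R (T i))"
    using T prob_R injT by (intro distr_PiM_reindex) auto
  then have reindex: "distr (Pi\<^sub>M K R) (Pi\<^sub>M I R') (\<lambda>y. \<lambda>i\<in>I. y (T i)) = Pi\<^sub>M I R'"
    using T(2) by (simp cong: PiM_cong)
  have F: "F \<in> borel_measurable (Pi\<^sub>M I R')"
  proof -
    have c: "(\<lambda>y. y i) \<in> borel_measurable (Pi\<^sub>M I R')" if "i \<in> I" for i
    proof -
      have "(\<lambda>y. y i) \<in> measurable (Pi\<^sub>M I R') (R' i)" using that by (rule measurable_component_singleton)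
      moreover have "sets (R' i) = sets borel" using sets_R[OF T(1)[OF that]] T(2)[OF that] by simp
      ultimately show ?thesis by (simp cong: measurable_cong_sets)
    qed
    show ?thesis unfolding F_def
      by (intro borel_measurable_power borel_measurable_free_energy c) (auto simp: I_def)
  qed
  have restr: "(\<lambda>x. \<lambda>i\<in>K. w i x) \<in> measurable M (Pi\<^sub>M K (\<lambda>_. borel))"
    by (intro measurable_restrict rv)
  have proj: "(\<lambda>y. \<lambda>i\<in>I. y (T i)) \<in> measurable (Pi\<^sub>M K R) (Pi\<^sub>M I R')"
  proof (rule measurable_restrict)
    fix i assume "i \<in> I"
    then show "(\<lambda>y. y (T i)) \<in> measurable (Pi\<^sub>M K R) (R' i)"
      using measurable_component_singleton[OF T(1), of i R] T(2) by simp
  qed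
  have sets_eq: "sets (Pi\<^sub>M K R) = sets (Pi\<^sub>M K (\<lambda>_. borel))"
    by (intro sets_PiM_cong refl sets_R)
  have "free_energy_moment P Q V' E' r = (\<integral>y. F y \<partial>Pi\<^sub>M I R')"
    by (simp add: free_energy_moment_def F_def I_def R'_def)
  also have "\<dots> = (\<integral>y. F (\<lambda>i\<in>I. y (T i)) \<partial>Pi\<^sub>M K R)"
    by (subst reindex[symmetric]) (rule integral_distr[OF proj F])
  also have "\<dots> = (\<integral>x. F (\<lambda>i\<in>I. (\<lambda>i\<in>K. w i x) (T i)) \<partial>M)"
    unfolding law[symmetric]
    by (rule integral_distr[OF restr])
       (use measurable_compose[OF proj F] sets_eq in \<open>simp cong: measurable_cong_sets\<close>)
  also have "\<dots> = expectation (\<lambda>x. (free_energy (f ` V') ((`) f ` E') (\<lambda>v. \<nu> v x) (\<lambda>e. \<omega> e x)) ^ r)"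
  proof (intro Bochner_Integration.integral_cong refl)
    fix x
    show "F (\<lambda>i\<in>I. (\<lambda>i\<in>K. w i x) (T i))
        = (free_energy (f ` V') ((`) f ` E') (\<lambda>v. \<nu> v x) (\<lambda>e. \<omega> e x)) ^ r"
      unfolding F_def free_energy_image[OF f]
      using sub by (intro arg_cong[where f = "\<lambda>z. z ^ r"] free_energy_cong)
        (auto simp: I_def K_def T_def w_def image_subset_iff)
  qed
  finally show ?thesis by simp
qed

text \<open>Each free energy is a function of the weights in its own block. Disjoint vertex sets
  force disjoint edge sets, since a common edge would be a nonempty subset of both.\<close>

lemma indep_free_energy:
  assumes "disjoint_family_on V' J" "\<And>j. j \<in> J \<Longrightarrow> V' j \<subseteq> V" "\<And>j. j \<in> J \<Longrightarrow> E' j \<subseteq> E"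
    and "\<And>j e. j \<in> J \<Longrightarrow> e \<in> E' j \<Longrightarrow> e \<subseteq> V' j"
  shows "indep_vars (\<lambda>_. borel) (\<lambda>j x. free_energy (V' j) (E' j) (\<lambda>v. \<nu> v x) (\<lambda>e. \<omega> e x)) J"
proof -
  define K where "K = (\<lambda>j. V' j <+> E' j)"
  define w where "w = case_sum \<nu> \<omega>"
  define F where "F = (\<lambda>j y. free_energy (V' j) (E' j) (\<lambda>v. y (Inl v)) (\<lambda>e. y (Inr e)))"
  have "disjoint_family_on K J"
    unfolding disjoint_family_on_def
  proof (intro ballI impI)
    fix i j assume ij: "i \<in> J" "j \<in> J" "i \<noteq> j"
    have VV: "V' i \<inter> V' j = {}" using assms(1) ij by (simp add: disjoint_family_on_def)
    have "e \<notin> E' j" if "e \<in> E' i" for e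
    proof
      assume "e \<in> E' j"
      then have "e \<subseteq> V' i \<inter> V' j" using assms(4) ij that by blast
      moreover have "e \<noteq> {}" using edge_card assms(3)[OF ij(1)] that by fastforce
      ultimately show False using VV by blast
    qed
    then show "K i \<inter> K j = {}" using VV by (auto simp: K_def)
  qed
  then have "indep_vars (\<lambda>j. Pi\<^sub>M (K j) (\<lambda>_. borel)) (\<lambda>j x. restrict (\<lambda>i. w i x) (K j)) J"
    unfolding w_def using assms(2,3) by (intro indep_vars_restrict[OF indep]) (auto simp: K_def)
  then have "indep_vars (\<lambda>_. borel) (\<lambda>j x. F j (restrict (\<lambda>i. w i x) (K j))) J"
  proof (rule indep_vars_compose2)
    fix j assume "j \<in> J"
    show "F j \<in> borel_measurable (Pi\<^sub>M (K j) (\<lambda>_. borel))"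
      unfolding F_def
      by (intro borel_measurable_free_energy measurable_component_singleton) (auto simp: K_def)
  qed
  moreover have "F j (restrict (\<lambda>i. w i x) (K j)) = free_energy (V' j) (E' j) (\<lambda>v. \<nu> v x) (\<lambda>e. \<omega> e x)" for j x
    unfolding F_def by (intro free_energy_cong) (auto simp: K_def w_def)
  ultimately show ?thesis by simp
qed

end

locale weighted_cylinder =
  weighted_graph M "cylinder_vertices n VH" "cylinder_edges n VH EH" \<nu> \<omega> P Q
  for M :: "'a measure" and n :: nat and VH :: "'h set" and EH \<nu> \<omega> P Q +
  assumes base: "finite_simple_graph VH EH" "VH \<noteq> {}"
begin

text \<open>The right side adds three errors: the edges between consecutive blocks (Markov), the
  leftover layers (Markov), and the fluctuation of the sum of block free energies (Chebyshev). Only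
  the first survives as n grows, and it is small for large \<open>L\<close>. In the threshold,
  \<open>t\<close> is granted to the removed edges and vertices and again to the fluctuation, while
  the last term pays for replacing the ratio of the number of blocks to \<open>n\<close> by 1 /
  L.\<close>

lemma block_estimate:
  fixes L :: nat and t a c :: real and FM :: "nat \<Rightarrow> real"
  assumes L: "L \<ge> 1" and t: "t > 0" and n: "n \<ge> 1"
  defines "FM \<equiv> free_energy_moment P Q (cylinder_vertices L VH) (cylinder_edges L VH EH)"
  defines "a \<equiv> \<integral>t. \<bar>t\<bar> \<partial>P"
  defines "c \<equiv> ln 2 + (\<integral>t. \<bar>t\<bar> \<partial>Q) + 2 * a"
  shows "prob {x\<in>space M. \<bar>free_energy (cylinder_vertices n VH) (cylinder_edges n VH EH)
        (\<lambda>v. \<nu> v x) (\<lambda>e. \<omega> e x) / n - FM 1 / L\<bar> > 2 * t + \<bar>FM 1\<bar> / n}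
    \<le> card VH * c / (L * t) + (L * (card EH + card VH) * c + L * card VH * a) / (n * t)
      + \<bar>FM 2 - (FM 1)\<^sup>2\<bar> / (n * t\<^sup>2)"
proof -
  define k where "k = n div L"
  define Vb where "Vb = (\<lambda>j. translate (j * L) ` cylinder_vertices L VH)"
  define Eb where "Eb = (\<lambda>j. (`) (translate (j * L)) ` cylinder_edges L VH EH)"
  define Y where "Y = (\<lambda>j x. free_energy (Vb j) (Eb j) (\<lambda>v. \<nu> v x) (\<lambda>e. \<omega> e x))"
  define FE where "FE = (\<lambda>x. free_energy (cylinder_vertices n VH) (cylinder_edges n VH EH)
        (\<lambda>v. \<nu> v x) (\<lambda>e. \<omega> e x))"
  obtain F R where F: "F \<subseteq> cylinder_edges n VH EH" "card F \<le> k * card VH + L * (card EH + card VH)"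
    and R: "R \<subseteq> cylinder_vertices n VH" "card R \<le> L * card VH"
    and dec: "\<And>\<nu> \<omega>. \<bar>free_energy (cylinder_vertices n VH) (cylinder_edges n VH EH) \<nu> \<omega>
        - (\<Sum>j<k. free_energy (translate (j * L) ` cylinder_vertices L VH)
                    ((`) (translate (j * L)) ` cylinder_edges L VH EH) \<nu> \<omega>)\<bar>
      \<le> (\<Sum>e\<in>F. edge_cost \<nu> \<omega> e) + (\<Sum>v\<in>R. \<bar>\<nu> v\<bar>)"
    using cylinder_block_decomposition[OF base(1) L, of n thesis] unfolding k_def by blast
  define B where "B = (\<lambda>x. (\<Sum>e\<in>F. edge_cost (\<lambda>v. \<nu> v x) (\<lambda>e. \<omega> e x) e) + (\<Sum>v\<in>R. \<bar>\<nu> v x\<bar>))"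
  have FE_Y: "\<bar>FE x - (\<Sum>j<k. Y j x)\<bar> \<le> B x" for x
    unfolding FE_def Y_def Vb_def Eb_def B_def by (rule dec)
  have a: "a \<ge> 0" and c: "c \<ge> 0" by (auto simp: a_def c_def)
  have int_B: "integrable M B"
    unfolding B_def using F(1) R(1) edge_cost_integrable(1) vertex_abs_integrable
    by (intro Bochner_Integration.integrable_add Bochner_Integration.integrable_sum) blast+
  have "expectation B = (\<Sum>e\<in>F. c) + (\<Sum>v\<in>R. a)"
  proof -
    have 1: "integrable M (\<lambda>x. edge_cost (\<lambda>v. \<nu> v x) (\<lambda>e. \<omega> e x) e)"
      "expectation (\<lambda>x. edge_cost (\<lambda>v. \<nu> v x) (\<lambda>e. \<omega> e x) e) = c" if "e \<in> F" for e
      using edge_cost_integrable[of e] F(1) that by (auto simp: c_def a_def)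
    have 2: "integrable M (\<lambda>x. \<bar>\<nu> v x\<bar>)" "expectation (\<lambda>x. \<bar>\<nu> v x\<bar>) = a" if "v \<in> R" for v
      using vertex_abs_integrable[of v] vertex_abs_expectation[of v] R(1) that by (auto simp: a_def)
    show ?thesis
      unfolding B_def using 1 2
      by (subst Bochner_Integration.integral_add) (auto simp: Bochner_Integration.integral_sum)
  qed
  also have "\<dots> = card F * c + card R * a" by simp
  also have "\<dots> \<le> (k * card VH + L * (card EH + card VH)) * c + (L * card VH) * a"
    using F(2) R(2) a c by (intro add_mono mult_right_mono) (simp_all only: of_nat_le_iff)
  finally have EB: "expectation B \<le> (k * card VH + L * (card EH + card VH)) * c + (L * card VH) * a" .
  have B_nonneg: "B x \<ge> 0" for x by (auto simp: B_def intro!: add_nonneg_nonneg sum_nonneg edge_cost_nonneg)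
  have kL: "real k * real L \<le> n"
    unfolding k_def by (metis div_times_less_eq_dividend of_nat_le_iff of_nat_mult)
  \<comment> \<open>There are at most n / L blocks; this is what makes the contribution of the edges
    between them independent of \<open>n\<close>.\<close>
  have kn: "real k / real n \<le> 1 / L" using kL L n by (simp add: field_simps)
  have nt: "n * t > 0" using n t by simp
  have P1: "prob {x\<in>space M. B x \<ge> n * t}
      \<le> card VH * c / (L * t) + (L * (card EH + card VH) * c + L * card VH * a) / (n * t)"
  proof -
    have "prob {x\<in>space M. B x \<ge> n * t} \<le> expectation B / (n * t)"
      using int_B B_nonneg nt by (intro integral_Markov_inequality_measure[where A = "{}"]) auto
    also have "\<dots> \<le> ((k * card VH + L * (card EH + card VH)) * c + (L * card VH) * a) / (n * t)"
      using EB nt by (intro divide_right_mono) auto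
    also have "\<dots> = (real k / n) * (card VH * c / t) + (L * (card EH + card VH) * c + L * card VH * a) / (n * t)"
      using n t by (simp add: field_simps)
    also have "\<dots> \<le> (1 / L) * (card VH * c / t) + (L * (card EH + card VH) * c + L * card VH * a) / (n * t)"
      using kn c t by (intro add_mono mult_right_mono) auto
    finally show ?thesis by simp
  qed
  have sub: "Vb j \<subseteq> cylinder_vertices n VH" "Eb j \<subseteq> cylinder_edges n VH EH" if "j < k" for j
    using translate_cylinder_subset[OF base(1), of j n L] that by (simp_all add: k_def Vb_def Eb_def)
  have graph_b: "finite_simple_graph (Vb j) (Eb j)" for j
    using finite_simple_graph_cylinder[OF base(1), of L] unfolding finite_simple_graph_def Vb_def Eb_def
    by (intro conjI ballI) (auto simp: card_image[OF inj_on_subset[OF inj_translate subset_UNIV]])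
  have "cylinder_vertices L VH \<noteq> {}" using base(2) L by (auto simp: cylinder_vertices_eq)
  then have moment: "expectation (\<lambda>x. Y j x ^ r) = FM r" if "j < k" for j r
    unfolding Y_def FM_def using sub[OF that] unfolding Vb_def Eb_def
    by (intro free_energy_moment_image inj_translate) auto
  have sq: "integrable M (\<lambda>x. (Y j x)\<^sup>2)" if "j < k" for j
    unfolding Y_def using sub[OF that] graph_b by (intro free_energy_square_integrable) auto
  have "indep_vars (\<lambda>_. borel) Y {..<k}"
    unfolding Y_def
  proof (rule indep_free_energy)
    show "disjoint_family_on Vb {..<k}" unfolding Vb_def by (rule disjoint_translated_cylinders)
    show "e \<subseteq> Vb j" if "e \<in> Eb j" for j e
      using graph_b[of j] that by (auto simp: finite_simple_graph_def)
  qed (use sub in auto)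
  define S where "S = (\<lambda>x. (\<Sum>j<k. Y j x) - k * FM 1)"
  from indep_sum_second_moment[OF _ \<open>indep_vars (\<lambda>_. borel) Y {..<k}\<close> sq, of "FM 1" "FM 2"] moment[of _ 1] moment[of _ 2]
  have ES: "integrable M (\<lambda>x. (S x)\<^sup>2)" "expectation (\<lambda>x. (S x)\<^sup>2) = k * (FM 2 - (FM 1)\<^sup>2)"
    unfolding S_def by auto
  have rv_Y: "Y j \<in> borel_measurable M" if "j < k" for j
    unfolding Y_def using sub[OF that] rv_vertex rv_edge by (intro borel_measurable_free_energy) auto
  have rv_FE: "FE \<in> borel_measurable M"
    unfolding FE_def using rv_vertex rv_edge by (intro borel_measurable_free_energy) auto
  have rv_S: "S \<in> borel_measurable M"
    unfolding S_def using rv_Y by (intro borel_measurable_diff borel_measurable_sum) auto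
  have P2: "prob {x\<in>space M. \<bar>S x\<bar> \<ge> n * t}
      \<le> \<bar>FM 2 - (FM 1)\<^sup>2\<bar> / (n * t\<^sup>2)"
  proof -
    have "prob {x\<in>space M. \<bar>S x\<bar> \<ge> n * t}
        \<le> expectation (\<lambda>x. (S x)\<^sup>2) / (n * t)\<^sup>2"
      by (rule second_moment_method[OF rv_S ES(1) nt])
    also have "\<dots> \<le> n * \<bar>FM 2 - (FM 1)\<^sup>2\<bar> / (n * t)\<^sup>2"
      unfolding ES(2)
    proof (intro divide_right_mono)
      have "k * (FM 2 - (FM 1)\<^sup>2) \<le> k * \<bar>FM 2 - (FM 1)\<^sup>2\<bar>" by (intro mult_left_mono) auto
      also have "\<dots> \<le> n * \<bar>FM 2 - (FM 1)\<^sup>2\<bar>" by (intro mult_right_mono) (auto simp: k_def)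
      finally show "k * (FM 2 - (FM 1)\<^sup>2) \<le> n * \<bar>FM 2 - (FM 1)\<^sup>2\<bar>" .
    qed simp
    also have "\<dots> = \<bar>FM 2 - (FM 1)\<^sup>2\<bar> / (n * t\<^sup>2)"
      using n by (simp add: power_mult_distrib power2_eq_square[of "real n"])
    finally show ?thesis .
  qed
  have near: "\<bar>FE x / n - FM 1 / L\<bar> \<le> 2 * t + \<bar>FM 1\<bar> / n"
    if x: "B x < n * t" "\<bar>S x\<bar> < n * t" for x
  proof -
    have "\<bar>FE x - k * FM 1\<bar> \<le> n * (2 * t)" using FE_Y[of x] x by (simp add: S_def algebra_simps)
    then have "\<bar>FE x - k * FM 1\<bar> / n \<le> 2 * t" using n by (simp add: field_simps)
    then have 1: "\<bar>FE x / n - k * FM 1 / n\<bar> \<le> 2 * t"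
      by (simp add: diff_divide_distrib[symmetric])
    have "real n - real k * L \<le> L"
    proof -
      have "n = k * L + n mod L" by (simp add: k_def)
      moreover have "n mod L \<le> L" using L by simp
      ultimately have "n \<le> k * L + L" by linarith
      then have "real n \<le> real (k * L + L)" by (simp only: of_nat_le_iff)
      then show ?thesis by simp
    qed
    then have "(real n - k * L) / (n * L) \<le> L / (n * L)" by (intro divide_right_mono) auto
    moreover have "(real n - k * L) / (n * L) = 1 / L - k / n" "real L / (n * L) = 1 / n"
      using L n by (simp_all add: field_simps)
    moreover have "0 \<le> (real n - k * L) / (n * L)" using kL by simp
    ultimately have "\<bar>k / n - 1 / L\<bar> \<le> 1 / n" by simp
    then have "\<bar>k / n - 1 / L\<bar> * \<bar>FM 1\<bar> \<le> 1 / n * \<bar>FM 1\<bar>" by (rule mult_right_mono) simp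
    moreover have "\<bar>k / n - 1 / L\<bar> * \<bar>FM 1\<bar> = \<bar>k * FM 1 / n - FM 1 / L\<bar>"
      by (simp add: abs_mult[symmetric] left_diff_distrib)
    ultimately have 2: "\<bar>k * FM 1 / n - FM 1 / L\<bar> \<le> \<bar>FM 1\<bar> / n" by simp
    have "\<bar>FE x / n - FM 1 / L\<bar> \<le> \<bar>FE x / n - k * FM 1 / n\<bar> + \<bar>k * FM 1 / n - FM 1 / L\<bar>"
      using abs_triangle_ineq[of "FE x / n - k * FM 1 / n" "k * FM 1 / n - FM 1 / L"] by simp
    also have "\<dots> \<le> 2 * t + \<bar>FM 1\<bar> / n" by (rule add_mono[OF 1 2])
    finally show ?thesis .
  qed
  have rv_B: "B \<in> borel_measurable M" using int_B by (rule borel_measurable_integrable)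
  have "prob {x\<in>space M. \<bar>FE x / n - FM 1 / L\<bar> > 2 * t + \<bar>FM 1\<bar> / n}
      \<le> prob ({x\<in>space M. B x \<ge> n * t} \<union> {x\<in>space M. \<bar>S x\<bar> \<ge> n * t})"
  proof (rule finite_measure_mono)
    show "{x\<in>space M. \<bar>FE x / n - FM 1 / L\<bar> > 2 * t + \<bar>FM 1\<bar> / n}
      \<subseteq> {x\<in>space M. B x \<ge> n * t} \<union> {x\<in>space M. \<bar>S x\<bar> \<ge> n * t}"
      using near by (fastforce simp: not_le[symmetric])
    show "{x\<in>space M. B x \<ge> n * t} \<union> {x\<in>space M. \<bar>S x\<bar> \<ge> n * t} \<in> events"
      using rv_B[measurable] rv_S[measurable] by measurable
  qed
  also have "\<dots> \<le> prob {x\<in>space M. B x \<ge> n * t} + prob {x\<in>space M. \<bar>S x\<bar> \<ge> n * t}"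
    using rv_B[measurable] rv_S[measurable] by (intro measure_Un_le) measurable
  finally show ?thesis using P1 P2 unfolding FE_def by linarith
qed

end

text \<open>The order of choices matters: first \<open>L\<close>, so that the edges between blocks
  are negligible uniformly in n, and only then n large. The constant handed to the Cauchy criterion
  is the mean free energy of one block per layer.\<close>

lemma free_energy_LLN:
  fixes M :: "nat \<Rightarrow> 'a measure" and VH :: "'h set"
  assumes W: "\<And>n. n \<ge> 1 \<Longrightarrow> weighted_cylinder (M n) n VH EH (\<nu> n) (\<omega> n) P Q"
  shows "\<exists>c. converges_in_probability M
    (\<lambda>n x. free_energy (cylinder_vertices n VH) (cylinder_edges n VH EH) (\<lambda>v. \<nu> n v x) (\<lambda>e. \<omega> n e x) / n) c"
proof (rule converges_in_probability_Cauchy)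
  fix n :: nat assume n: "n \<ge> 1"
  interpret weighted_cylinder "M n" n VH EH "\<nu> n" "\<omega> n" P Q by (rule W[OF n])
  show "prob_space (M n)" by unfold_locales
  show "(\<lambda>x. free_energy (cylinder_vertices n VH) (cylinder_edges n VH EH) (\<lambda>v. \<nu> n v x) (\<lambda>e. \<omega> n e x) / n)
    \<in> borel_measurable (M n)"
    using rv_vertex rv_edge by (intro borel_measurable_divide borel_measurable_free_energy) auto
next
  fix \<eta> :: real assume \<eta>: "\<eta> > 0"
  define a where "a = (\<integral>t. \<bar>t\<bar> \<partial>P)"
  define c where "c = ln 2 + (\<integral>t. \<bar>t\<bar> \<partial>Q) + 2 * a"
  define t where "t = \<eta> / 4"
  have t: "t > 0" using \<eta> by (simp add: t_def)
  \<comment> \<open>Large enough for the edges between blocks to account for at most half of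
    \<open>\<eta>\<close>; the successor taken next keeps the block length positive.\<close>
  obtain L0 :: nat where L0: "card VH * c / t / (\<eta> / 2) < L0" using reals_Archimedean2 by blast
  define L where "L = Suc L0"
  have L: "L \<ge> 1" by (simp add: L_def)
  have small: "card VH * c / (L * t) \<le> \<eta> / 2"
  proof -
    have "card VH * c / t / (\<eta> / 2) \<le> L" using L0 by (simp add: L_def)
    then show ?thesis using L t \<eta> by (simp add: field_simps)
  qed
  define FM where "FM = free_energy_moment P Q (cylinder_vertices L VH) (cylinder_edges L VH EH)"
  define b where "b = (\<lambda>n::nat. (L * (card EH + card VH) * c + L * card VH * a) / (n * t)
      + \<bar>FM 2 - (FM 1)\<^sup>2\<bar> / (n * t\<^sup>2))"
  have "b \<longlonglongrightarrow> 0" unfolding b_def using t by real_asymp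
  then have e1: "\<forall>\<^sub>F n in sequentially. b n < \<eta> / 2" using \<eta> by (intro order_tendstoD) auto
  have "(\<lambda>n::nat. \<bar>FM 1\<bar> / n) \<longlonglongrightarrow> 0" by real_asymp
  then have e2: "\<forall>\<^sub>F n::nat in sequentially. \<bar>FM 1\<bar> / n < \<eta> / 2" using \<eta> by (intro order_tendstoD) auto
  have "\<forall>\<^sub>F n in sequentially. measure (M n) {x\<in>space (M n).
      \<bar>free_energy (cylinder_vertices n VH) (cylinder_edges n VH EH) (\<lambda>v. \<nu> n v x) (\<lambda>e. \<omega> n e x) / n
        - FM 1 / L\<bar> > \<eta>} \<le> \<eta>"
    using e1 e2 eventually_ge_at_top[of 1]
  proof eventually_elim
    case (elim n)
    interpret weighted_cylinder "M n" n VH EH "\<nu> n" "\<omega> n" P Q by (rule W[OF elim(3)])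
    let ?X = "\<lambda>x. free_energy (cylinder_vertices n VH) (cylinder_edges n VH EH) (\<lambda>v. \<nu> n v x) (\<lambda>e. \<omega> n e x) / n"
    have [measurable]: "?X \<in> borel_measurable (M n)"
      using rv_vertex rv_edge by (intro borel_measurable_divide borel_measurable_free_energy) auto
    have "prob {x\<in>space (M n). \<bar>?X x - FM 1 / L\<bar> > \<eta>}
        \<le> prob {x\<in>space (M n). \<bar>?X x - FM 1 / L\<bar> > 2 * t + \<bar>FM 1\<bar> / n}"
    proof (rule finite_measure_mono)
      have "2 * t + \<bar>FM 1\<bar> / n \<le> \<eta>" using elim(2) unfolding t_def by linarith
      then show "{x\<in>space (M n). \<bar>?X x - FM 1 / L\<bar> > \<eta>}
          \<subseteq> {x\<in>space (M n). \<bar>?X x - FM 1 / L\<bar> > 2 * t + \<bar>FM 1\<bar> / n}"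
        using le_less_trans by blast
    qed measurable
    also have "\<dots> \<le> card VH * c / (L * t) + b n"
      using block_estimate[OF L t elim(3)] 
      unfolding FM_def b_def c_def a_def by (simp only: add.assoc)
    also have "\<dots> \<le> \<eta>" using small elim(1) by linarith
    finally show ?case .
  qed
  then show "\<exists>c. \<forall>\<^sub>F n in sequentially. measure (M n) {x\<in>space (M n).
      \<bar>free_energy (cylinder_vertices n VH) (cylinder_edges n VH EH) (\<lambda>v. \<nu> n v x) (\<lambda>e. \<omega> n e x) / n - c\<bar> > \<eta>} \<le> \<eta>"
    by blast
qed

section \<open>Variance and limit law of the number of unpaired vertices\<close>

definition unpaired_variance ::
    "'v set \<Rightarrow> 'v set set \<Rightarrow> ('v \<Rightarrow> real) \<Rightarrow> ('v set \<Rightarrow> real) \<Rightarrow> real" where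
  "unpaired_variance V E \<nu> \<omega> = gibbs_average V E \<nu> \<omega> (\<lambda>m. (num_unpaired V m)\<^sup>2)
     - (gibbs_average V E \<nu> \<omega> (num_unpaired V))\<^sup>2"

lemma gibbs_poisson_binomial:
  assumes "finite_simple_graph V E"
  obtains K p where "K \<le> card V" "poisson_binomial (matchings E) (gibbs_weight V E \<nu> \<omega>) card K p"
proof (rule gibbs_edge_count_Bernoulli[OF assms, of \<nu> \<omega>])
  have fE: "finite E" using assms by (rule finite_simple_graph_finite_edges)
  fix K :: nat and p :: "nat \<Rightarrow> real"
  assume K: "K \<le> card V" and p: "\<And>k. k < K \<Longrightarrow> 0 < p k \<and> p k < 1"
    and pgf: "\<And>z :: complex. (\<Sum>m\<in>matchings E. of_real (gibbs_weight V E \<nu> \<omega> m) * z ^ card m)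
      = (\<Prod>k<K. 1 - of_real (p k) + of_real (p k) * z)"
  have "poisson_binomial (matchings E) (gibbs_weight V E \<nu> \<omega>) card K p"
  proof
    show "finite (matchings E)" using fE by (rule finite_matchings)
    show "0 \<le> gibbs_weight V E \<nu> \<omega> m" for m
      using partition_function_pos[OF fE, of V \<nu> \<omega>] by (simp add: gibbs_weight_def)
  qed (use p pgf in auto)
  with K show thesis by (rule that)
qed

lemma sum_gibbs_weight:
  assumes "finite E"
  shows "(\<Sum>m\<in>matchings E. gibbs_weight V E \<nu> \<omega> m) = 1"
  using partition_function_pos[OF assms, of V \<nu> \<omega>]
  by (simp add: gibbs_weight_def partition_function_def flip: sum_divide_distrib)

lemma num_unpaired_eq:
  assumes "finite_simple_graph V E" "m \<in> matchings E"
  shows "num_unpaired V m = card V - 2 * real (card m)"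
  using matching_card[OF assms] by (simp add: num_unpaired_def)

lemma gibbs_average_num_unpaired:
  assumes "finite_simple_graph V E"
  shows "gibbs_average V E \<nu> \<omega> (num_unpaired V)
    = card V - 2 * (\<Sum>m\<in>matchings E. gibbs_weight V E \<nu> \<omega> m * real (card m))"
proof -
  let ?w = "gibbs_weight V E \<nu> \<omega>"
  have "gibbs_average V E \<nu> \<omega> (num_unpaired V)
      = (\<Sum>m\<in>matchings E. card V * ?w m - 2 * (?w m * real (card m)))"
    unfolding gibbs_average_def
    by (intro sum.cong refl) (simp add: num_unpaired_eq[OF assms] algebra_simps)
  also have "\<dots> = card V - 2 * (\<Sum>m\<in>matchings E. ?w m * real (card m))"
    using sum_gibbs_weight[OF finite_simple_graph_finite_edges[OF assms], of V \<nu> \<omega>]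
    by (simp add: sum_subtractf sum_distrib_left[symmetric])
  finally show ?thesis .
qed

lemma unpaired_variance_eq:
  assumes "finite_simple_graph V E"
  shows "unpaired_variance V E \<nu> \<omega> = 4 * ((\<Sum>m\<in>matchings E. gibbs_weight V E \<nu> \<omega> m * (real (card m))\<^sup>2)
    - (\<Sum>m\<in>matchings E. gibbs_weight V E \<nu> \<omega> m * real (card m))\<^sup>2)"
proof -
  let ?w = "gibbs_weight V E \<nu> \<omega>"
  have "gibbs_average V E \<nu> \<omega> (\<lambda>m. (num_unpaired V m)\<^sup>2)
      = (\<Sum>m\<in>matchings E. (card V)\<^sup>2 * ?w m - 4 * card V * (?w m * real (card m)) + 4 * (?w m * (real (card m))\<^sup>2))"
    unfolding gibbs_average_def
    by (intro sum.cong refl) (simp add: num_unpaired_eq[OF assms] algebra_simps power2_eq_square)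
  also have "\<dots> = (card V)\<^sup>2 - 4 * card V * (\<Sum>m\<in>matchings E. ?w m * real (card m))
      + 4 * (\<Sum>m\<in>matchings E. ?w m * (real (card m))\<^sup>2)"
    using sum_gibbs_weight[OF finite_simple_graph_finite_edges[OF assms], of V \<nu> \<omega>]
    by (simp add: sum_subtractf sum.distrib sum_distrib_left[symmetric])
  finally show ?thesis
    unfolding unpaired_variance_def gibbs_average_num_unpaired[OF assms]
    by (simp add: algebra_simps power2_eq_square)
qed

lemma unpaired_variance_nonneg:
  assumes "finite_simple_graph V E"
  shows "unpaired_variance V E \<nu> \<omega> \<ge> 0"
proof -
  obtain K p where "poisson_binomial (matchings E) (gibbs_weight V E \<nu> \<omega>) card K p"
    using gibbs_poisson_binomial[OF assms] .
  then interpret poisson_binomial "matchings E" "gibbs_weight V E \<nu> \<omega>" card K p .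
  have "(\<Sum>k<K. p k * (1 - p k)) \<ge> 0"
    using p_range by (intro sum_nonneg mult_nonneg_nonneg) (auto intro: less_imp_le)
  then show ?thesis unfolding unpaired_variance_eq[OF assms] variance by simp
qed

text \<open>Adding \<open>s\<close> to every edge weight multiplies the weight of a matching
  \<open>m\<close> by \<open>exp (s * real (card m))\<close>. The change of the free energy is
  therefore the logarithmic moment generating function of the edge count.\<close>

lemma free_energy_tilt:
  assumes "finite_simple_graph V E"
  shows "free_energy V E \<nu> (\<lambda>e. \<omega> e + s)
    = free_energy V E \<nu> \<omega> + ln (\<Sum>m\<in>matchings E. gibbs_weight V E \<nu> \<omega> m * exp (s * real (card m)))"
proof -
  have fE: "finite E" using assms by (rule finite_simple_graph_finite_edges)
  let ?Z = "partition_function V E \<nu> \<omega>"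
  have Z: "?Z > 0" using fE by (rule partition_function_pos)
  have "hamiltonian V \<nu> (\<lambda>e. \<omega> e + s) m = hamiltonian V \<nu> \<omega> m + s * real (card m)" for m
    by (simp add: hamiltonian_def sum.distrib)
  then have "partition_function V E \<nu> (\<lambda>e. \<omega> e + s)
      = ?Z * (\<Sum>m\<in>matchings E. gibbs_weight V E \<nu> \<omega> m * exp (s * real (card m)))"
    using Z unfolding partition_function_def[of V E \<nu> "\<lambda>e. \<omega> e + s"] sum_distrib_left
    by (intro sum.cong) (simp_all add: gibbs_weight_def exp_add)
  moreover from this have "(\<Sum>m\<in>matchings E. gibbs_weight V E \<nu> \<omega> m * exp (s * real (card m))) > 0"
    using Z partition_function_pos[OF fE, of V \<nu> "\<lambda>e. \<omega> e + s"] by (simp add: zero_less_mult_iff)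
  ultimately show ?thesis using Z by (simp add: free_energy_def ln_mult)
qed

text \<open>
  The error term comes from the third derivative in \<open>s\<close> of the free energy, which is bounded
  because the edge count is a sum of at most \<open>card V\<close> independent Bernoulli variables.
\<close>

lemma unpaired_variance_second_difference:
  fixes \<delta> :: real
  assumes G: "finite_simple_graph V E" and \<delta>: "\<delta> > 0"
  shows "\<bar>unpaired_variance V E \<nu> \<omega> - 4 / \<delta>\<^sup>2 * (free_energy V E \<nu> (\<lambda>e. \<omega> e + \<delta>)
      + free_energy V E \<nu> (\<lambda>e. \<omega> e + - \<delta>) - 2 * free_energy V E \<nu> \<omega>)\<bar> \<le> 4 * card V * \<delta>"
proof -
  obtain K p where K: "K \<le> card V" and "poisson_binomial (matchings E) (gibbs_weight V E \<nu> \<omega>) card K p"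
    using gibbs_poisson_binomial[OF G] .
  then interpret poisson_binomial "matchings E" "gibbs_weight V E \<nu> \<omega>" card K p by simp
  let ?w = "gibbs_weight V E \<nu> \<omega>"
  define D where "D = free_energy V E \<nu> (\<lambda>e. \<omega> e + \<delta>)
      + free_energy V E \<nu> (\<lambda>e. \<omega> e + - \<delta>) - 2 * free_energy V E \<nu> \<omega>"
  define v where "v = (\<Sum>m\<in>matchings E. ?w m * (real (card m))\<^sup>2) - (\<Sum>m\<in>matchings E. ?w m * real (card m))\<^sup>2"
  have "\<bar>D - \<delta>\<^sup>2 * v\<bar> \<le> K * \<delta> ^ 3"
    using ln_mgf_second_difference[OF \<delta>]
    unfolding D_def v_def free_energy_tilt[OF G] by (simp add: algebra_simps)
  also have "\<dots> \<le> card V * \<delta> ^ 3" using K \<delta> by (intro mult_right_mono) auto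
  finally have *: "\<bar>D - \<delta>\<^sup>2 * v\<bar> \<le> card V * \<delta> ^ 3" .
  have "4 * v - 4 / \<delta>\<^sup>2 * D = - (4 / \<delta>\<^sup>2) * (D - \<delta>\<^sup>2 * v)"
    using \<delta> by (simp add: field_simps)
  then have "\<bar>4 * v - 4 / \<delta>\<^sup>2 * D\<bar> = \<bar>4 / \<delta>\<^sup>2\<bar> * \<bar>D - \<delta>\<^sup>2 * v\<bar>"
    by (simp only: abs_mult abs_minus_cancel)
  then have "\<bar>4 * v - 4 / \<delta>\<^sup>2 * D\<bar> = 4 / \<delta>\<^sup>2 * \<bar>D - \<delta>\<^sup>2 * v\<bar>"
    by simp
  also have "\<dots> \<le> 4 / \<delta>\<^sup>2 * (card V * \<delta> ^ 3)" using * by (intro mult_left_mono) auto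
  also have "\<dots> = 4 * card V * \<delta>" using \<delta> by (simp add: field_simps power2_eq_square power3_eq_cube)
  finally show ?thesis unfolding unpaired_variance_eq[OF G] D_def v_def .
qed

text \<open>Shifted edge weights are again independent with a common square integrable law, so the
  law of large numbers is available for each fixed shift.\<close>

lemma weighted_cylinder_tilt:
  assumes W: "weighted_cylinder M n VH EH \<nu> \<omega> P Q" and Q: "prob_space Q" "sets Q = sets borel"
  shows "weighted_cylinder M n VH EH \<nu> (\<lambda>e x. \<omega> e x + s) P (distr Q borel (\<lambda>t. t + s))"
proof -
  interpret weighted_cylinder M n VH EH \<nu> \<omega> P Q by (rule W)
  interpret Q: prob_space Q by (rule Q(1))
  have id: "(\<lambda>t. t) \<in> borel_measurable Q" using Q(2) by (simp cong: measurable_cong_sets)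
  then have shift: "(\<lambda>t. t + s) \<in> measurable Q borel" by simp
  have int: "integrable Q (\<lambda>t. t)"
    using id edge_sq by (rule Q.square_integrable_imp_integrable)
  show ?thesis
  proof unfold_locales
    have "indep_vars (\<lambda>_. borel) (\<lambda>i x. case_sum (\<lambda>_ t. t) (\<lambda>_ t. t + s) i (case_sum \<nu> \<omega> i x))
        (cylinder_vertices n VH <+> cylinder_edges n VH EH)"
      by (rule indep_vars_compose2[OF indep]) (auto split: sum.split)
    moreover have "(\<lambda>i x. case_sum (\<lambda>_ t. t) (\<lambda>_ t. t + s) i (case_sum \<nu> \<omega> i x))
        = case_sum \<nu> (\<lambda>e x. \<omega> e x + s)"
      by (intro ext) (auto split: sum.split)
    ultimately show "indep_vars (\<lambda>_. borel) (case_sum \<nu> (\<lambda>e x. \<omega> e x + s))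
        (cylinder_vertices n VH <+> cylinder_edges n VH EH)" by simp
    show "distr M borel (\<lambda>x. \<omega> e x + s) = distr Q borel (\<lambda>t. t + s)" if "e \<in> cylinder_edges n VH EH" for e
      unfolding edge_law[OF that, symmetric] using rv_edge[OF that] by (subst distr_distr) (auto simp: comp_def)
    have "(\<lambda>t. (t + s)\<^sup>2) = (\<lambda>t. t\<^sup>2 + 2 * s * t + s\<^sup>2)"
      by (auto simp: power2_eq_square algebra_simps)
    then have "integrable Q (\<lambda>t. (t + s)\<^sup>2)"
      using edge_sq int by simp
    then show "integrable (distr Q borel (\<lambda>t. t + s)) (\<lambda>t. t\<^sup>2)"
      by (subst integrable_distr_eq[OF shift]) auto
  qed (use graph vertex_law vertex_sq base in auto)
qed

text \<open>For each accuracy, the second difference of the limiting free energies \<open>f\<close>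
  at one step \<open>\<delta>\<close> is a good enough constant for the Cauchy criterion. The
  remainder bound, uniform in the weights, takes the place of differentiability of
  \<open>f\<close>.\<close>

lemma unpaired_variance_limit:
  fixes M :: "nat \<Rightarrow> 'a measure" and VH :: "'h set"
  assumes W: "\<And>n. n \<ge> 1 \<Longrightarrow> weighted_cylinder (M n) n VH EH (\<nu> n) (\<omega> n) P Q"
    and Q: "prob_space Q" "sets Q = sets borel"
  shows "\<exists>c. converges_in_probability M
    (\<lambda>n x. unpaired_variance (cylinder_vertices n VH) (cylinder_edges n VH EH) (\<lambda>v. \<nu> n v x) (\<lambda>e. \<omega> n e x) / n) c"
proof (rule converges_in_probability_Cauchy)
  fix n :: nat assume n: "n \<ge> 1"
  interpret weighted_cylinder "M n" n VH EH "\<nu> n" "\<omega> n" P Q by (rule W[OF n])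
  show "prob_space (M n)" by unfold_locales
  show "(\<lambda>x. unpaired_variance (cylinder_vertices n VH) (cylinder_edges n VH EH) (\<lambda>v. \<nu> n v x) (\<lambda>e. \<omega> n e x) / n)
    \<in> borel_measurable (M n)"
    unfolding unpaired_variance_def using rv_vertex rv_edge
    by (intro borel_measurable_divide borel_measurable_diff borel_measurable_power borel_measurable_gibbs_average) auto
next
  fix \<eta> :: real assume \<eta>: "\<eta> > 0"
  define FE where "FE = (\<lambda>s n x. free_energy (cylinder_vertices n VH) (cylinder_edges n VH EH)
    (\<lambda>v. \<nu> n v x) (\<lambda>e. \<omega> n e x + s) / n)"
  define VU where "VU = (\<lambda>n x. unpaired_variance (cylinder_vertices n VH) (cylinder_edges n VH EH)
    (\<lambda>v. \<nu> n v x) (\<lambda>e. \<omega> n e x))"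
  have "\<exists>c. converges_in_probability M (FE s) c" for s
    unfolding FE_def by (rule free_energy_LLN[OF weighted_cylinder_tilt[OF W Q]])
  then obtain f where f: "\<And>s. converges_in_probability M (FE s) (f s)" by metis
  have VH: "card VH > 0"
  proof -
    interpret weighted_cylinder "M 1" 1 VH EH "\<nu> 1" "\<omega> 1" P Q by (rule W) simp
    show ?thesis using base by (auto simp: finite_simple_graph_def card_gt_0_iff)
  qed
  \<comment> \<open>The cylinder has \<open>n * card VH\<close> vertices, so the deterministic error
    \<open>4 * card V * \<delta>\<close> becomes n times half of \<open>\<eta>\<close>.\<close>
  define \<delta> where "\<delta> = \<eta> / (8 * card VH)"
  have \<delta>: "\<delta> > 0" using \<eta> VH by (simp add: \<delta>_def)
  \<comment> \<open>The free energies enter the second difference with total weight 4, and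
    \<open>4 / \<delta>\<^sup>2 * (4 * \<tau>)\<close> is the other half of
    \<open>\<eta>\<close>.\<close>
  define \<tau> where "\<tau> = \<eta> * \<delta>\<^sup>2 / 32"
  have \<tau>: "\<tau> > 0" using \<eta> \<delta> by (simp add: \<tau>_def)
  define c where "c = 4 / \<delta>\<^sup>2 * (f \<delta> + f (- \<delta>) - 2 * f 0)"
  let ?P = "\<lambda>s n. measure (M n) {x\<in>space (M n). \<bar>FE s n x - f s\<bar> > \<tau>}"
  have "(\<lambda>n. ?P \<delta> n + ?P (- \<delta>) n + ?P 0 n) \<longlonglongrightarrow> 0 + 0 + 0"
    using f \<tau> unfolding converges_in_probability_def by (intro tendsto_add) blast+
  then have "\<forall>\<^sub>F n in sequentially. ?P \<delta> n + ?P (- \<delta>) n + ?P 0 n < \<eta>"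
    using \<eta> by (intro order_tendstoD) auto
  then have "\<forall>\<^sub>F n in sequentially. measure (M n) {x\<in>space (M n). \<bar>VU n x / n - c\<bar> > \<eta>} \<le> \<eta>"
    using eventually_ge_at_top[of 1]
  proof eventually_elim
    case (elim n)
    interpret weighted_cylinder "M n" n VH EH "\<nu> n" "\<omega> n" P Q by (rule W[OF elim(2)])
    have n: "real n > 0" using elim(2) by simp
    have [measurable]: "FE s n \<in> borel_measurable (M n)" for s
      unfolding FE_def using rv_vertex rv_edge
      by (intro borel_measurable_divide borel_measurable_free_energy borel_measurable_add) auto
    have close: "\<bar>VU n x / n - c\<bar> \<le> \<eta>"
      if x: "\<bar>FE \<delta> n x - f \<delta>\<bar> \<le> \<tau>" "\<bar>FE (- \<delta>) n x - f (- \<delta>)\<bar> \<le> \<tau>" "\<bar>FE 0 n x - f 0\<bar> \<le> \<tau>" for x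
    proof -
      define D where "D = FE \<delta> n x + FE (- \<delta>) n x - 2 * FE 0 n x"
      have "\<bar>VU n x - 4 / \<delta>\<^sup>2 * (n * D)\<bar> \<le> 4 * card (cylinder_vertices n VH) * \<delta>"
      proof -
        let ?F = "\<lambda>s. free_energy (cylinder_vertices n VH) (cylinder_edges n VH EH)
          (\<lambda>v. \<nu> n v x) (\<lambda>e. \<omega> n e x + s)"
        have "n * D = ?F \<delta> + ?F (- \<delta>) - 2 * ?F 0"
          using n unfolding D_def FE_def by (simp only: field_simps) simp
        then show ?thesis
          using unpaired_variance_second_difference[OF graph \<delta>, of "\<lambda>v. \<nu> n v x" "\<lambda>e. \<omega> n e x"]
          unfolding VU_def by simp
      qed
      also have "\<dots> = n * (\<eta> / 2)"
        using VH by (simp add: cylinder_vertices_eq card_cartesian_product \<delta>_def)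
      finally have "\<bar>VU n x - 4 / \<delta>\<^sup>2 * (n * D)\<bar> / n \<le> n * (\<eta> / 2) / n"
        using n by (intro divide_right_mono) auto
      moreover have "VU n x / n - 4 / \<delta>\<^sup>2 * D = (VU n x - 4 / \<delta>\<^sup>2 * (n * D)) / n"
        using n \<delta> by (simp add: field_simps)
      ultimately have 1: "\<bar>VU n x / n - 4 / \<delta>\<^sup>2 * D\<bar> \<le> \<eta> / 2"
        using n by simp
      have "\<bar>D - (f \<delta> + f (- \<delta>) - 2 * f 0)\<bar> \<le> 4 * \<tau>"
        using x unfolding D_def by linarith
      then have "4 / \<delta>\<^sup>2 * \<bar>D - (f \<delta> + f (- \<delta>) - 2 * f 0)\<bar> \<le> 4 / \<delta>\<^sup>2 * (4 * \<tau>)"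
        by (intro mult_left_mono) auto
      also have "\<dots> = \<eta> / 2" using \<delta> by (simp add: \<tau>_def)
      finally have "4 / \<delta>\<^sup>2 * \<bar>D - (f \<delta> + f (- \<delta>) - 2 * f 0)\<bar> \<le> \<eta> / 2" .
      moreover have "4 / \<delta>\<^sup>2 = \<bar>4 / \<delta>\<^sup>2\<bar>" by simp
      moreover have "4 / \<delta>\<^sup>2 * D - c = 4 / \<delta>\<^sup>2 * (D - (f \<delta> + f (- \<delta>) - 2 * f 0))"
        unfolding c_def by (rule right_diff_distrib[symmetric])
      ultimately have 2: "\<bar>4 / \<delta>\<^sup>2 * D - c\<bar> \<le> \<eta> / 2" by (metis abs_mult)
      have "\<bar>VU n x / n - c\<bar> \<le> \<bar>VU n x / n - 4 / \<delta>\<^sup>2 * D\<bar> + \<bar>4 / \<delta>\<^sup>2 * D - c\<bar>"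
        using abs_triangle_ineq[of "VU n x / n - 4 / \<delta>\<^sup>2 * D" "4 / \<delta>\<^sup>2 * D - c"] by simp
      also have "\<dots> \<le> \<eta> / 2 + \<eta> / 2" by (rule add_mono[OF 1 2])
      finally show ?thesis by simp
    qed
    let ?S = "\<lambda>s. {x\<in>space (M n). \<bar>FE s n x - f s\<bar> > \<tau>}"
    have "prob {x\<in>space (M n). \<bar>VU n x / n - c\<bar> > \<eta>} \<le> prob (?S \<delta> \<union> ?S (- \<delta>) \<union> ?S 0)"
    proof (rule finite_measure_mono)
      show "{x\<in>space (M n). \<bar>VU n x / n - c\<bar> > \<eta>} \<subseteq> ?S \<delta> \<union> ?S (- \<delta>) \<union> ?S 0"
        using close by (auto simp: not_le[symmetric])
    qed measurable
    also have "\<dots> \<le> prob (?S \<delta> \<union> ?S (- \<delta>)) + prob (?S 0)" by (intro measure_Un_le) measurable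
    also have "prob (?S \<delta> \<union> ?S (- \<delta>)) \<le> prob (?S \<delta>) + prob (?S (- \<delta>))"
      by (intro measure_Un_le) measurable
    finally show ?case using elim(1) by linarith
  qed
  then show "\<exists>c. \<forall>\<^sub>F n in sequentially. measure (M n) {x\<in>space (M n).
      \<bar>unpaired_variance (cylinder_vertices n VH) (cylinder_edges n VH EH) (\<lambda>v. \<nu> n v x) (\<lambda>e. \<omega> n e x) / n - c\<bar> > \<eta>} \<le> \<eta>"
    unfolding VU_def by blast
qed

text \<open>
  Given the growth of the variance, the quenched limit law is deterministic: it holds for every
  realisation of the weights.
\<close>

lemma gibbs_CLT:
  fixes VH :: "'h set" and \<phi> :: "real \<Rightarrow> real"
  assumes G: "finite_simple_graph VH EH" and s: "s \<ge> 0"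
    and \<phi>: "continuous_on UNIV \<phi>" "bounded (range \<phi>)" and \<delta>: "\<delta> > 0"
  defines "V \<equiv> \<lambda>n. cylinder_vertices n VH" and "E \<equiv> \<lambda>n. cylinder_edges n VH EH"
  defines "avg \<equiv> \<lambda>n \<nu> \<omega>. gibbs_average (V n) (E n) \<nu> \<omega>"
  shows "\<exists>\<eta>>0. \<exists>N. \<forall>n\<ge>N. \<forall>\<nu> \<omega>. \<bar>unpaired_variance (V n) (E n) \<nu> \<omega> / n - s\<bar> \<le> \<eta> \<longrightarrow>
    \<bar>avg n \<nu> \<omega> (\<lambda>m. \<phi> ((num_unpaired (V n) m - avg n \<nu> \<omega> (num_unpaired (V n))) / sqrt n))
      - (\<integral>y. \<phi> y \<partial>normal_law 0 s)\<bar> \<le> \<delta>"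
proof (rule ccontr)
  let ?far = "\<lambda>n \<nu> \<omega>. \<bar>avg n \<nu> \<omega> (\<lambda>m. \<phi> ((num_unpaired (V n) m - avg n \<nu> \<omega> (num_unpaired (V n))) / sqrt n))
      - (\<integral>y. \<phi> y \<partial>normal_law 0 s)\<bar> > \<delta>"
  assume contra: "\<not> ?thesis"
  \<comment> \<open>The claim is uniform over all weights. Its failure supplies a sequence of bad
    weights along which the scaled variance tends to \<open>s\<close>, and the central limit theorem
    for that sequence is contradicted. The chosen sizes tend to infinity but need not be
    increasing.\<close>
  have "\<exists>n \<nu> \<omega>. n \<ge> Suc j \<and> \<bar>unpaired_variance (V n) (E n) \<nu> \<omega> / n - s\<bar> \<le> 1 / Suc j \<and> ?far n \<nu> \<omega>" for j
  proof (rule ccontr)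
    assume "\<not> ?thesis"
    then have "\<forall>n\<ge>Suc j. \<forall>\<nu> \<omega>. \<bar>unpaired_variance (V n) (E n) \<nu> \<omega> / n - s\<bar> \<le> 1 / Suc j \<longrightarrow> \<not> ?far n \<nu> \<omega>"
      by blast
    moreover have "1 / real (Suc j) > 0" by simp
    ultimately show False using contra unfolding not_less by blast
  qed
  then obtain n \<nu> \<omega> where n: "\<And>j. n j \<ge> Suc j"
    and var: "\<And>j. \<bar>unpaired_variance (V (n j)) (E (n j)) (\<nu> j) (\<omega> j) / n j - s\<bar> \<le> 1 / Suc j"
    and far: "\<And>j. ?far (n j) (\<nu> j) (\<omega> j)"
    by metis
  have graph: "finite_simple_graph (V n) (E n)" for n
    unfolding V_def E_def using G by (rule finite_simple_graph_cylinder)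
  define w where "w = (\<lambda>j. gibbs_weight (V (n j)) (E (n j)) (\<nu> j) (\<omega> j))"
  have "\<exists>K p. K \<le> card (V (n j)) \<and> poisson_binomial (matchings (E (n j))) (w j) card K p" for j
    using gibbs_poisson_binomial[OF graph] unfolding w_def by metis
  then obtain K p where K: "\<And>j. K j \<le> card (V (n j))"
    and pb: "\<And>j. poisson_binomial (matchings (E (n j))) (w j) card (K j) (p j)"
    by metis
  \<comment> \<open>The number of unpaired vertices is \<open>card V\<close> minus twice the edge
    count, so centring leaves the factor -2. The sign is kept because \<open>\<phi>\<close> need not
    be even.\<close>
  define b where "b = (\<lambda>j. - 2 / sqrt (n j))"
  have n_pos: "real (n j) > 0" for j using n[of j] by simp
  have inv_sqrt: "(\<lambda>j. 1 / sqrt (n j)) \<longlonglongrightarrow> 0"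
  proof (rule Lim_null_comparison)
    show "(\<lambda>j. 1 / sqrt (Suc j)) \<longlonglongrightarrow> 0" by real_asymp
    have "1 / sqrt (n j) \<le> 1 / sqrt (Suc j)" for j
      using n[of j] n_pos[of j]
      by (intro divide_left_mono real_sqrt_le_mono mult_pos_pos) (simp_all only: of_nat_le_iff real_sqrt_gt_0_iff of_nat_0_less_iff zero_less_Suc zero_le_one)
    then show "\<forall>\<^sub>F j in sequentially. norm (1 / sqrt (n j)) \<le> 1 / sqrt (Suc j)"
      by (intro always_eventually allI) simp
  qed
  have b: "b \<longlonglongrightarrow> 0"
    unfolding b_def using tendsto_mult[OF tendsto_const inv_sqrt, of "- 2"] by simp
  have Kb: "(\<lambda>j. real (K j) * \<bar>b j\<bar> ^ 3) \<longlonglongrightarrow> 0"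
  proof (rule Lim_null_comparison)
    show "(\<lambda>j. 8 * card VH * (1 / sqrt (n j))) \<longlonglongrightarrow> 0"
      using tendsto_mult[OF tendsto_const inv_sqrt, of "8 * card VH"] by simp
    show "\<forall>\<^sub>F j in sequentially. norm (real (K j) * \<bar>b j\<bar> ^ 3) \<le> 8 * card VH * (1 / sqrt (n j))"
    proof (intro always_eventually allI)
      fix j
      \<comment> \<open>The number of Bernoulli factors is at most of order n, while the cube of the
        scale is of order n^(-3/2).\<close>
      have "real (K j) \<le> real (n j) * card VH"
        using K[of j] by (simp add: V_def cylinder_vertices_eq card_cartesian_product flip: of_nat_mult)
      then have "real (K j) * \<bar>b j\<bar> ^ 3 \<le> real (n j) * card VH * \<bar>b j\<bar> ^ 3"
        by (intro mult_right_mono) auto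
      also have "\<dots> = 8 * card VH * (1 / sqrt (n j))"
      proof -
        have "\<bar>b j\<bar> ^ 3 = 8 / (n j * sqrt (n j))"
          using n_pos[of j] by (simp add: b_def power3_eq_cube field_simps)
        then show ?thesis using n_pos[of j] by simp
      qed
      finally show "norm (real (K j) * \<bar>b j\<bar> ^ 3) \<le> 8 * card VH * (1 / sqrt (n j))" by simp
    qed
  qed
  define mean where "mean = (\<lambda>j. \<Sum>m\<in>matchings (E (n j)). w j m * real (card m))"
  have "(\<lambda>j. unpaired_variance (V (n j)) (E (n j)) (\<nu> j) (\<omega> j) / n j - s) \<longlonglongrightarrow> 0"
  proof (rule Lim_null_comparison)
    show "(\<lambda>j. 1 / real (Suc j)) \<longlonglongrightarrow> 0" by real_asymp
  qed (use var in auto)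
  then have "(\<lambda>j. unpaired_variance (V (n j)) (E (n j)) (\<nu> j) (\<omega> j) / n j) \<longlonglongrightarrow> s"
    by (rule LIM_zero_cancel)
  moreover have "unpaired_variance (V (n j)) (E (n j)) (\<nu> j) (\<omega> j) / n j
      = (b j)\<^sup>2 * ((\<Sum>m\<in>matchings (E (n j)). w j m * (real (card m))\<^sup>2) - (mean j)\<^sup>2)" for j
    using n_pos[of j] by (simp add: unpaired_variance_eq[OF graph] b_def w_def mean_def power_divide)
  ultimately have var_lim: "(\<lambda>j. (b j)\<^sup>2 * ((\<Sum>m\<in>matchings (E (n j)). w j m * (real (card m))\<^sup>2) - (mean j)\<^sup>2)) \<longlonglongrightarrow> s"
    by simp
  have lim: "(\<lambda>j. \<Sum>m\<in>matchings (E (n j)). w j m * \<phi> (b j * (real (card m) - mean j)))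
      \<longlonglongrightarrow> (\<integral>y. \<phi> y \<partial>normal_law 0 s)"
    unfolding mean_def using pb Kb b var_lim[unfolded mean_def] s \<phi> by (rule poisson_binomial_clt)
  have eq: "avg (n j) (\<nu> j) (\<omega> j)
      (\<lambda>m. \<phi> ((num_unpaired (V (n j)) m - avg (n j) (\<nu> j) (\<omega> j) (num_unpaired (V (n j)))) / sqrt (n j)))
    = (\<Sum>m\<in>matchings (E (n j)). w j m * \<phi> (b j * (real (card m) - mean j)))" for j
  proof -
    have "(num_unpaired (V (n j)) m - avg (n j) (\<nu> j) (\<omega> j) (num_unpaired (V (n j)))) / sqrt (n j)
        = b j * (real (card m) - mean j)" if "m \<in> matchings (E (n j))" for m
      unfolding avg_def gibbs_average_num_unpaired[OF graph] num_unpaired_eq[OF graph that]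
      by (simp add: b_def mean_def w_def diff_divide_distrib algebra_simps)
    then show ?thesis
      unfolding avg_def gibbs_average_def by (intro sum.cong refl) (simp add: w_def mult.commute)
  qed
  have "\<forall>\<^sub>F j in sequentially. \<bar>(\<Sum>m\<in>matchings (E (n j)). w j m * \<phi> (b j * (real (card m) - mean j)))
      - (\<integral>y. \<phi> y \<partial>normal_law 0 s)\<bar> < \<delta>"
    using tendstoD[OF lim \<delta>] by (simp add: dist_real_def)
  then obtain j where "\<bar>(\<Sum>m\<in>matchings (E (n j)). w j m * \<phi> (b j * (real (card m) - mean j)))
      - (\<integral>y. \<phi> y \<partial>normal_law 0 s)\<bar> < \<delta>"
    using eventually_happens' sequentially_bot by blast
  then show False using far[of j] unfolding eq by simp
qed

theorem theorem1p4:
  fixes VH :: "'h set" and EH :: "'h set set"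
    and M :: "nat \<Rightarrow> 'a measure"
    and \<nu> :: "nat \<Rightarrow> nat \<times> 'h \<Rightarrow> 'a \<Rightarrow> real"
    and \<omega> :: "nat \<Rightarrow> (nat \<times> 'h) set \<Rightarrow> 'a \<Rightarrow> real"
    and P Q :: "real measure"
    and \<epsilon> :: real
  defines "V \<equiv> \<lambda>n. cylinder_vertices n VH"
    and "E \<equiv> \<lambda>n. cylinder_edges n VH EH"
  defines "avg \<equiv> \<lambda>n x. gibbs_average (V n) (E n) (\<lambda>v. \<nu> n v x) (\<lambda>e. \<omega> n e x)"
    and "U \<equiv> \<lambda>n. num_unpaired (V n)"
  assumes H: "finite_simple_graph VH EH" "VH \<noteq> {}"
    and prob: "\<And>n. n \<ge> 1 \<Longrightarrow> prob_space (M n)"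
    and indep: "\<And>n. n \<ge> 1 \<Longrightarrow>
      prob_space.indep_vars (M n) (\<lambda>_. borel) (case_sum (\<nu> n) (\<omega> n)) (V n <+> E n)"
    and vertex_law: "\<And>n v. n \<ge> 1 \<Longrightarrow> v \<in> V n \<Longrightarrow> distr (M n) borel (\<nu> n v) = P"
    and edge_law: "\<And>n e. n \<ge> 1 \<Longrightarrow> e \<in> E n \<Longrightarrow> distr (M n) borel (\<omega> n e) = Q"
    and eps: "\<epsilon> > 0"
    and vertex_moment: "integrable P (\<lambda>t. \<bar>t\<bar> powr (2 + \<epsilon>))"
    and edge_moment: "integrable Q (\<lambda>t. \<bar>t\<bar> powr (2 + \<epsilon>))"
  shows "\<exists>\<sigma>Q2::real. \<sigma>Q2 \<ge> 0 \<and>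
    converges_in_probability M
      (\<lambda>n x. (avg n x (\<lambda>m. (U n m)\<^sup>2) - (avg n x (U n))\<^sup>2) / real n) \<sigma>Q2 \<and>
    (\<forall>\<phi>::real \<Rightarrow> real. continuous_on UNIV \<phi> \<longrightarrow> bounded (range \<phi>) \<longrightarrow>
      converges_in_probability M
        (\<lambda>n x. avg n x (\<lambda>m. \<phi> ((U n m - avg n x (U n)) / sqrt (real n))))
        (\<integral>y. \<phi> y \<partial>normal_law 0 \<sigma>Q2))"
proof -
  have abs_sq: "integrable P (\<lambda>t. t\<^sup>2)"
    if "prob_space P" "sets P = sets borel" "integrable P (\<lambda>t. \<bar>t\<bar> powr (2 + \<epsilon>))" for P :: "real measure"
  proof (rule Bochner_Integration.integrable_bound)
    interpret prob_space P by (rule that)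
    show "integrable P (\<lambda>t. 1 + \<bar>t\<bar> powr (2 + \<epsilon>))" using that(3) by simp
    show "(\<lambda>t. t\<^sup>2) \<in> borel_measurable P" using that(2) by (simp cong: measurable_cong_sets)
    show "AE t in P. norm (t\<^sup>2) \<le> norm (1 + \<bar>t\<bar> powr (2 + \<epsilon>))"
    proof (rule AE_I2)
      fix t :: real
      have "t\<^sup>2 \<le> 1 + \<bar>t\<bar> powr (2 + \<epsilon>)"
      proof (cases "\<bar>t\<bar> \<le> 1")
        case True
        then have "t\<^sup>2 \<le> 1" by (simp add: abs_square_le_1)
        then show ?thesis by (smt (verit) powr_ge_zero)
      next
        case False
        then have "t\<^sup>2 = \<bar>t\<bar> powr 2" by (simp add: powr_numeral)
        also have "\<dots> \<le> \<bar>t\<bar> powr (2 + \<epsilon>)" using False eps by (intro powr_mono) auto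
        finally show ?thesis by simp
      qed
      then show "norm (t\<^sup>2) \<le> norm (1 + \<bar>t\<bar> powr (2 + \<epsilon>))" by simp
    qed
  qed
  have graph: "finite_simple_graph (V n) (E n)" for n
    unfolding V_def E_def using H(1) by (rule finite_simple_graph_cylinder)
  have rv: "i \<in> V n <+> E n \<Longrightarrow> case_sum (\<nu> n) (\<omega> n) i \<in> borel_measurable (M n)" if "n \<ge> 1" for n i
    using indep[OF that] unfolding prob_space.indep_vars_def[OF prob[OF that]] by blast
  obtain h where h: "h \<in> VH" using H(2) by auto
  \<comment> \<open>With two layers the cylinder contains an edge along the path whatever
    \<open>EH\<close> is. One of its vertices and one of its edges show that \<open>P\<close> and
    \<open>Q\<close> are laws of real random variables, hence Borel probability measures.\<close>
  have v2: "(1, h) \<in> V 2" using h by (simp add: V_def cylinder_vertices_eq)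
  have e2: "{(1, h), (Suc 1, h)} \<in> E 2"
    unfolding E_def cylinder_edges_eq[OF H(1)] strip_edges_def using h by auto
  interpret M2: prob_space "M 2" by (rule prob) simp
  have P: "prob_space P" "sets P = sets borel"
    using vertex_law[OF _ v2] M2.prob_space_distr[of "\<nu> 2 (1, h)" borel] rv[of 2 "Inl (1, h)"] v2
    by (auto simp flip: vertex_law[OF _ v2])
  have Q: "prob_space Q" "sets Q = sets borel"
    using edge_law[OF _ e2] M2.prob_space_distr[of "\<omega> 2 {(1, h), (Suc 1, h)}" borel]
      rv[of 2 "Inr {(1, h), (Suc 1, h)}"] e2
    by (auto simp flip: edge_law[OF _ e2])
  have W: "weighted_cylinder (M n) n VH EH (\<nu> n) (\<omega> n) P Q" if n: "n \<ge> 1" for n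
  proof -
    interpret prob_space "M n" by (rule prob[OF n])
    show ?thesis
      using graph[of n] indep[OF n] vertex_law[OF n] edge_law[OF n] abs_sq[OF P vertex_moment]
        abs_sq[OF Q edge_moment] H
      by unfold_locales (auto simp: V_def E_def)
  qed
  define VU where "VU = (\<lambda>n x. unpaired_variance (V n) (E n) (\<lambda>v. \<nu> n v x) (\<lambda>e. \<omega> n e x) / n)"
  \<comment> \<open>Fixed before any test function, so that one variance serves all
    \<open>\<phi>\<close>.\<close>
  obtain s where s: "converges_in_probability M VU s"
    using unpaired_variance_limit[OF W Q] unfolding VU_def V_def E_def by blast
  have VU_meas: "VU n \<in> borel_measurable (M n)" if "n \<ge> 1" for n
  proof -
    interpret weighted_cylinder "M n" n VH EH "\<nu> n" "\<omega> n" P Q by (rule W[OF that])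
    show ?thesis
      unfolding VU_def unpaired_variance_def V_def E_def using rv_vertex rv_edge
      by (intro borel_measurable_divide borel_measurable_diff borel_measurable_power
          borel_measurable_gibbs_average) auto
  qed
  have VU_nonneg: "VU n x \<ge> 0" for n x
    unfolding VU_def using unpaired_variance_nonneg[OF graph] by (intro divide_nonneg_nonneg) auto
  \<comment> \<open>The scaled variances are nonnegative. If \<open>s\<close> were negative, all of
    them would be farther than \<open>- s / 2\<close> from \<open>s\<close>, on the whole
    space.\<close>
  have s_nonneg: "s \<ge> 0"
  proof (rule ccontr)
    assume "\<not> s \<ge> 0"
    then have "(\<lambda>n. measure (M n) {x\<in>space (M n). \<bar>VU n x - s\<bar> > - s / 2}) \<longlonglongrightarrow> 0"
      using s unfolding converges_in_probability_def by auto
    moreover have "\<forall>\<^sub>F n in sequentially. measure (M n) {x\<in>space (M n). \<bar>VU n x - s\<bar> > - s / 2} = 1"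
      using eventually_ge_at_top[of 1]
    proof eventually_elim
      case (elim n)
      interpret prob_space "M n" by (rule prob[OF elim])
      have "\<bar>VU n x - s\<bar> > - s / 2" for x using VU_nonneg[of n x] \<open>\<not> s \<ge> 0\<close> by linarith
      then have "{x\<in>space (M n). \<bar>VU n x - s\<bar> > - s / 2} = space (M n)" by blast
      then show ?case by (simp add: prob_space)
    qed
    ultimately have "(\<lambda>n::nat. 1::real) \<longlonglongrightarrow> 0"
      by (rule Lim_transform_eventually)
    then show False by (simp add: LIMSEQ_const_iff)
  qed
  have clt: "converges_in_probability M
      (\<lambda>n x. avg n x (\<lambda>m. \<phi> ((U n m - avg n x (U n)) / sqrt (real n)))) (\<integral>y. \<phi> y \<partial>normal_law 0 s)"
    if \<phi>: "continuous_on UNIV \<phi>" "bounded (range \<phi>)" for \<phi> :: "real \<Rightarrow> real"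
    unfolding converges_in_probability_def
  proof (intro allI impI)
    fix \<delta> :: real assume \<delta>: "\<delta> > 0"
    let ?X = "\<lambda>n x. avg n x (\<lambda>m. \<phi> ((U n m - avg n x (U n)) / sqrt (real n)))"
    obtain \<eta> N where \<eta>: "\<eta> > 0"
      and close: "\<And>n x. n \<ge> N \<Longrightarrow> \<bar>VU n x - s\<bar> \<le> \<eta> \<Longrightarrow> \<bar>?X n x - (\<integral>y. \<phi> y \<partial>normal_law 0 s)\<bar> \<le> \<delta>"
      using gibbs_CLT[OF H(1) s_nonneg \<phi> \<delta>] unfolding VU_def V_def E_def avg_def U_def by blast
    show "(\<lambda>n. measure (M n) {x\<in>space (M n). \<bar>?X n x - (\<integral>y. \<phi> y \<partial>normal_law 0 s)\<bar> > \<delta>}) \<longlonglongrightarrow> 0"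
    \<comment> \<open>By the deterministic limit law, a Gibbs average far from the Gaussian one
      forces the scaled variance away from \<open>s\<close>. The probability of the latter tends to
      0.\<close>
    proof (rule Lim_null_comparison)
      show "(\<lambda>n. measure (M n) {x\<in>space (M n). \<bar>VU n x - s\<bar> > \<eta>}) \<longlonglongrightarrow> 0"
        using s \<eta> unfolding converges_in_probability_def by blast
      show "\<forall>\<^sub>F n in sequentially. norm (measure (M n) {x\<in>space (M n). \<bar>?X n x - (\<integral>y. \<phi> y \<partial>normal_law 0 s)\<bar> > \<delta>})
          \<le> measure (M n) {x\<in>space (M n). \<bar>VU n x - s\<bar> > \<eta>}"
        using eventually_ge_at_top[of "max 1 N"]
      proof eventually_elim
        case (elim n)
        interpret prob_space "M n" using elim by (intro prob) simp
        have [measurable]: "VU n \<in> borel_measurable (M n)" using elim by (intro VU_meas) simp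
        have "prob {x\<in>space (M n). \<bar>?X n x - (\<integral>y. \<phi> y \<partial>normal_law 0 s)\<bar> > \<delta>}
            \<le> prob {x\<in>space (M n). \<bar>VU n x - s\<bar> > \<eta>}"
        proof (rule finite_measure_mono)
          show "{x\<in>space (M n). \<bar>?X n x - (\<integral>y. \<phi> y \<partial>normal_law 0 s)\<bar> > \<delta>}
              \<subseteq> {x\<in>space (M n). \<bar>VU n x - s\<bar> > \<eta>}"
            using close[of n] elim by (auto simp: not_le[symmetric])
        qed measurable
        then show ?case by simp
      qed
    qed
  qed
  have "converges_in_probability M
      (\<lambda>n x. (avg n x (\<lambda>m. (U n m)\<^sup>2) - (avg n x (U n))\<^sup>2) / real n) s"
    using s unfolding VU_def unpaired_variance_def avg_def U_def .
  with s_nonneg clt show ?thesis by blast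
qed

end
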